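(* Consider the interconnected system with output equation $$\dot y(t)=b(t)u(t)+\left(L(w[t],y(t))\right)'\theta_2(t)+d(t)$$ and unmeasured component $w$, in closed loop with the feedback law $$u=-(\kappa+\exp(z))^7\left(P_1(y)+P_2(y)y^2+P_3(y)y^6\right)y,\qquad \dot z=\Gamma\exp(-z)\left(V(y)-\varepsilon\right)^+,$$ where all objects are as described in the context, and suppose that assumptions (A1) and (A2) of the context hold. Let $\varepsilon,\Gamma,\kappa,a,C>0$ be constants with $2\kappa>a$. Then every solution $(w,y,z)$ of the closed-loop system, where $w\in C^0(\mathbb{R}_+;X)$ with $t\mapsto\Phi(w[t])$ locally absolutely continuous on $\mathbb{R}_+$ and $w\in L^1((0,T);S)$ for each $T>0$, $z\in C^1(\mathbb{R}_+)$, and $y\in C^0(\mathbb{R}_+)$ is locally absolutely continuous, that corresponds to some $d\in L^\infty(\mathbb{R}_+)$, $\theta_1\in L^\infty(\mathbb{R}_+;\mho)$, $\theta_2\in L^\infty(\mathbb{R}_+;\mathbb{R}^{p_2})$, $\delta\in L^\infty(\mathbb{R}_+;\mathcal{E})$, $b\in L^\infty(\mathbb{R}_+;(0,+\infty))$ with $\inf_{t\ge 0}(b(t))>0$, satisfies the following estimates for all $t\ge 0$: $$2K_1\|w[t]\|^2+|y(t)|^2\le\exp(-\mu t)\left(2K_2\|w[0]\|^2+|y(0)|^2\right)+2\mu^{-1}Z,$$ $$z(0)\le z(t)\le\ln\left(\exp(z(0))+\frac{\Gamma}{4C}|y(0)|^2+aB\,\frac{2C(1+\exp(z(0)))+\varepsilon\Gamma}{4C^2\varepsilon\min(1,\kappa)(1+\exp(z(0)))}\right),$$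 $$\limsup_{t\to+\infty}\|w[t]\|\le\sqrt{\frac{K_2}{K_1}\left(2\varepsilon R^2\Big(\limsup_{t\to+\infty}\|\theta_1[t]\|_{\mho}\Big)^2+G\Big(\limsup_{t\to+\infty}\|\delta[t]\|_{\mathcal{E}}\Big)^2\right)},$$ $$\limsup_{t\to+\infty}|y(t)|\le\sqrt{2\varepsilon},$$ where $$\mu:=\min\left(\frac{2\kappa-a}{2\kappa K_2},2C\right),$$ $$Z:=G\|\delta\|_\infty^2+\frac{a}{\kappa+\exp(z(0))}\left(\|d\|_\infty^2+g(\|\theta_2\|_\infty,z(0))+g^2(\|\theta_2\|_\infty,z(0))\right)+\frac{a}{\kappa+\exp(z(0))}\left(4\inf_{s\ge0}(b(s))\,g\Big(\frac{1}{\inf_{s\ge0}(b(s))},z(0)\Big)+g^2(R\|\theta_1\|_\infty,z(0))\right),$$ $$B:=\frac{1}{2K_1}\left(K_2\|w[0]\|^2+\frac12|y(0)|^2+\mu^{-1}Z\right)+g(\|\theta_2\|_\infty,z(0))+\|d\|_\infty^2+g^2(\|\theta_2\|_\infty,z(0))+2\inf_{s\ge0}(b(s))\,g\Big(\frac{1}{\inf_{s\ge0}(b(s))},z(0)\Big),$$ $$g(s,l):=\left(\left(s-\kappa-\exp(l)\right)^+\right)^2 .$$ Finally, if $\lim_{t\to+\infty}d(t)=0$, $\lim_{t\to+\infty}\delta[t]=0$ and $\liminf_{t\to+\infty}b(t)\ge 1/\kappa$, then one of the following holds: either $\lim_{t\to+\infty}|y(t)|=\lim_{t\to+\infty}\|w[t]\|=0$,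 or $$\kappa+\exp\Big(\lim_{s\to+\infty}z(s)\Big)<\limsup_{t\to+\infty}\Big(\max\big(R\|\theta_1[t]\|_{\mho},|\theta_2(t)|\big)\Big).$$
   Context: Notation: $\mathbb{R}_+=[0,+\infty)$; $s^+=\max(s,0)$; $'$ denotes transpose; $|\cdot|$ is the Euclidean norm; $\|\cdot\|_\infty$ is the essential supremum over $\mathbb{R}_+$ of the norm of the function (in the relevant space); $w[t]$ is the value of $w$ at time $t$. Setting: $X$ is a Banach space with norm $\|\cdot\|$; $S\subseteq X$ is a Banach space; $\mho,\mathcal{E}$ are Banach spaces with norms $\|\cdot\|_{\mho},\|\cdot\|_{\mathcal{E}}$; $p_2$ is a positive integer; $L:S\times\mathbb{R}\to\mathbb{R}^{p_2}$ is a functional. $y(t)\in\mathbb{R}$ is the output, $u(t)\in\mathbb{R}$ the control input, $d(t)\in\mathbb{R}$ a disturbance, $\theta_2(t)\in\mathbb{R}^{p_2}$ and $b(t)>0$ are unknown time-varying parameters, $w[t]$ is an unmeasured state component. The dynamics of $w$ (which may depend on $w$, $y$ and on unknown time-varying $\theta_1[t]\in\mho$, $\delta[t]\in\mathcal{E}$) are not specified; all that is required of them is (A1). Differential equations for solutions are understood to hold for almost every $t\ge0$. (A1) There exist a continuous functional $\Phi:X\to\mathbb{R}_+$ and constants $K_1,K_2,G,R>0$ such that $$K_1\|w\|^2\le\Phi(w)\le K_2\|w\|^2\quad\text{for all }w\in X,$$ $$\dot\Phi(w,y,\theta_1,\delta)\le-\|w\|^2+R^2\|\theta_1\|_{\mho}^2|y|^2+G\|\delta\|_{\mathcal{E}}^2\quad\text{for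 all }w\in S,\ y\in\mathbb{R},\ \theta_1\in\mho,\ \delta\in\mathcal{E},$$ where $\dot\Phi:S\times\mathbb{R}\times\mho\times\mathcal{E}\to\mathbb{R}$ is a functional that is equal to the upper right Dini derivative of $\Phi$ along every solution: $\dot\Phi(w[t],y(t),\theta_1[t],\delta[t])=\limsup_{h\to0^+}h^{-1}\left(\Phi(w[t+h])-\Phi(w[t])\right)$ for all $t\ge0$ for which $w[t]\in S$ and this limsup exists. (A2) For all $y\in\mathbb{R}$ and $w\in S$, $|L(w,y)|\le\|w\|+\phi(y)|y|$, where $\phi\in C^\infty(\mathbb{R};\mathbb{R}_+)$ is a known smooth non-negative function. Controller: $V(y)=\frac12y^2$, and $P_1,P_2,P_3\in C^\infty(\mathbb{R})$ are functions satisfying for all $y\in\mathbb{R}$ $$P_1(y)\ge\frac{1}{4a\kappa^6}\left(\kappa+4aC+4\kappa^3+4a\kappa\phi(y)+8a\kappa^2\right),$$ $$P_2(y)\ge\frac{1}{4a^3\kappa^5}\left(\frac{1}{16\kappa}\left(\kappa+4aC+4\kappa^3+4a\kappa\phi(y)\right)^2+\kappa^2+a^2\phi^2(y)+4a^2(\kappa^3+1)\right),$$ $$P_3(y)\ge\frac{1}{64a^7\kappa^4}\left(\left(\kappa^2+a^2\phi^2(y)\right)^2+16a^4\right).$$ *)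

theory Defs
  imports "HOL-Analysis.Analysis" "HOL-Probability.Essential_Supremum"
begin

definition smooth_real :: "(real \<Rightarrow> real) \<Rightarrow> bool" where
  "smooth_real f \<longleftrightarrow> (\<forall>n x. (deriv ^^ n) f differentiable (at x))"

definition abs_continuous_on_interval :: "real \<Rightarrow> real \<Rightarrow> (real \<Rightarrow> real) \<Rightarrow> bool" where
  "abs_continuous_on_interval l r f \<longleftrightarrow>
     (\<forall>e>0. \<exists>\<eta>>0. \<forall>(n::nat) p q.
        (\<forall>i<n. l \<le> p i \<and> p i \<le> q i \<and> q i \<le> r) \<and>
        (\<forall>i<n. \<forall>k<n. i \<noteq> k \<longrightarrow> {p i<..<q i} \<inter> {p k<..<q k} = {}) \<and>
        (\<Sum>i<n. q i - p i) < \<eta>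
        \<longrightarrow> (\<Sum>i<n. \<bar>f (q i) - f (p i)\<bar>) < e)"

definition locally_abs_continuous :: "(real \<Rightarrow> real) \<Rightarrow> bool" where
  "locally_abs_continuous f \<longleftrightarrow> (\<forall>T>0. abs_continuous_on_interval 0 T f)"

definition C1_on_nonneg :: "(real \<Rightarrow> real) \<Rightarrow> bool" where
  "C1_on_nonneg f \<longleftrightarrow>
     (\<exists>f'. continuous_on {0..} f' \<and>
           (\<forall>t\<ge>0. (f has_real_derivative f' t) (at t within {0..})))"

text \<open>
  The Banach spaces below need not be separable, whereas the Bochner integral of the library
  is only available for second countable codomains. Strong (Bochner) measurability and the
  spaces \<open>L\<^sup>1\<close> and \<open>L\<^sup>\<infinity>\<close> are therefore spelled out.
\<close>

definition strongly_measurable :: "'a measure \<Rightarrow> ('a \<Rightarrow> 'b::real_normed_vector) \<Rightarrow> bool" where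
  "strongly_measurable M f \<longleftrightarrow>
     (\<exists>F. (\<forall>n. simple_function M (F n)) \<and> (AE x in M. (\<lambda>n. F n x) \<longlonglongrightarrow> f x))"

definition in_L1 :: "'a measure \<Rightarrow> ('a \<Rightarrow> 'b::real_normed_vector) \<Rightarrow> bool" where
  "in_L1 M f \<longleftrightarrow> strongly_measurable M f \<and> integrable M (\<lambda>x. norm (f x))"

text \<open>
  Functions of time have type \<open>real \<Rightarrow> _\<close>; only their values on \<open>{0..}\<close> matter.
\<close>

definition in_Linf :: "(real \<Rightarrow> 'b::real_normed_vector) \<Rightarrow> bool" where
  "in_Linf f \<longleftrightarrow>
     strongly_measurable (lebesgue_on {0..}) f \<and>
     esssup (lebesgue_on {0..}) (\<lambda>t. ereal (norm (f t))) < \<infinity>"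

definition Linf_norm :: "(real \<Rightarrow> 'b::real_normed_vector) \<Rightarrow> real" where
  "Linf_norm f = real_of_ereal (esssup (lebesgue_on {0..}) (\<lambda>t. ereal (norm (f t))))"

text \<open>
  Infima and limits for \<open>t \<rightarrow> \<infinity>\<close> of \<open>L\<^sup>\<infinity>\<close> functions are taken up to null sets, so that they do
  not depend on the representative: a property holds eventually along \<open>ess_at_top\<close> iff, for
  some \<open>T\<close>, it holds for almost every \<open>t \<ge> T\<close>.
\<close>

definition ess_inf :: "(real \<Rightarrow> real) \<Rightarrow> real" where
  "ess_inf f = real_of_ereal (Liminf (ae_filter (lebesgue_on {0..})) (\<lambda>t. ereal (f t)))"

definition ess_at_top :: "real filter" where
  "ess_at_top = inf at_top (ae_filter lebesgue)"

lemma eventually_ess_at_top: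
  "eventually P ess_at_top \<longleftrightarrow> (\<exists>T. AE t in lebesgue. t \<ge> T \<longrightarrow> P t)"
proof
  assume "eventually P ess_at_top"
  then obtain Q R where Q: "eventually Q at_top" and R: "AE t in lebesgue. R t"
    and QR: "\<And>t. Q t \<Longrightarrow> R t \<Longrightarrow> P t"
    by (auto simp: ess_at_top_def eventually_inf)
  from Q obtain T where "\<forall>t\<ge>T. Q t"
    by (auto simp: eventually_at_top_linorder)
  with R QR have "AE t in lebesgue. t \<ge> T \<longrightarrow> P t"
    by (auto elim!: eventually_mono)
  then show "\<exists>T. AE t in lebesgue. t \<ge> T \<longrightarrow> P t" ..
next
  assume "\<exists>T. AE t in lebesgue. t \<ge> T \<longrightarrow> P t"
  then obtain T where "AE t in lebesgue. t \<ge> T \<longrightarrow> P t" ..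
  then show "eventually P ess_at_top"
    unfolding ess_at_top_def eventually_inf using eventually_ge_at_top[of T] by blast
qed

definition ess_limsup :: "(real \<Rightarrow> real) \<Rightarrow> real" where
  "ess_limsup f = real_of_ereal (Limsup ess_at_top (\<lambda>t. ereal (f t)))"

text \<open>
  The Banach space \<open>S \<subseteq> X\<close> carries its own norm, so it is a type \<open>'s\<close> of its own together with
  the inclusion map \<open>\<iota>\<close>; \<open>w[t] \<in> S\<close> means \<open>w t = \<iota> v\<close> for some \<open>v\<close>. Continuity of the inclusion
  is not assumed. The predicate \<open>dyn w y \<theta>1 \<delta>\<close> stands for the unspecified dynamics of \<open>w\<close>:
  it says that \<open>w\<close> is a solution for the output \<open>y\<close> and the inputs \<open>\<theta>1\<close> and \<open>\<delta>\<close>.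
  The limit superior in the last clause exists when it is a real number \<open>r\<close>.
\<close>

definition dissipation_assumption ::
    "('s::banach \<Rightarrow> 'x::banach) \<Rightarrow>
     ((real \<Rightarrow> 'x) \<Rightarrow> (real \<Rightarrow> real) \<Rightarrow> (real \<Rightarrow> 'm::banach) \<Rightarrow> (real \<Rightarrow> 'e::banach) \<Rightarrow> bool) \<Rightarrow>
     ('x \<Rightarrow> real) \<Rightarrow> ('s \<Rightarrow> real \<Rightarrow> 'm \<Rightarrow> 'e \<Rightarrow> real) \<Rightarrow>
     real \<Rightarrow> real \<Rightarrow> real \<Rightarrow> real \<Rightarrow> bool" where
  "dissipation_assumption \<iota> dyn \<Phi> \<Phi>dot K1 K2 G R \<longleftrightarrow>
     K1 > 0 \<and> K2 > 0 \<and> G > 0 \<and> R > 0 \<and>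
     continuous_on UNIV \<Phi> \<and> (\<forall>x. 0 \<le> \<Phi> x) \<and>
     (\<forall>x. K1 * (norm x)\<^sup>2 \<le> \<Phi> x \<and> \<Phi> x \<le> K2 * (norm x)\<^sup>2) \<and>
     (\<forall>v \<upsilon> \<theta> e. \<Phi>dot v \<upsilon> \<theta> e
        \<le> - (norm (\<iota> v))\<^sup>2 + R\<^sup>2 * (norm \<theta>)\<^sup>2 * \<bar>\<upsilon>\<bar>\<^sup>2 + G * (norm e)\<^sup>2) \<and>
     (\<forall>w y \<theta>1 \<delta>. dyn w y \<theta>1 \<delta> \<longrightarrow>
        (\<forall>t\<ge>0. \<forall>v r. w t = \<iota> v \<and>
           Limsup (at_right 0) (\<lambda>h. ereal ((\<Phi> (w (t + h)) - \<Phi> (w t)) / h)) = ereal r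
           \<longrightarrow> \<Phi>dot v (y t) (\<theta>1 t) (\<delta> t) = r))"

definition V :: "real \<Rightarrow> real" where
  "V y = y\<^sup>2 / 2"

definition feedback ::
    "real \<Rightarrow> (real \<Rightarrow> real) \<Rightarrow> (real \<Rightarrow> real) \<Rightarrow> (real \<Rightarrow> real) \<Rightarrow> real \<Rightarrow> real \<Rightarrow> real" where
  "feedback \<kappa> P1 P2 P3 y z =
     - ((\<kappa> + exp z) ^ 7 * (P1 y + P2 y * y\<^sup>2 + P3 y * y ^ 6) * y)"

definition g :: "real \<Rightarrow> real \<Rightarrow> real \<Rightarrow> real" where
  "g \<kappa> s l = (max (s - \<kappa> - exp l) 0)\<^sup>2"

end

theory Submission
  imports Defs
begin

text \<open>
  Write \<open>r = \<kappa> + exp z\<close>. Young's inequality, with every excess of a parameter over \<open>r\<close>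
  collected in the terms \<open>g\<close>, gives for the energy \<open>U = \<Phi>(w) + y\<^sup>2/2\<close> a differential inequality
  \<open>U' \<le> - \<mu> U + Z\<close> along solutions, and \<open>v = y\<^sup>2/2\<close> alone satisfies
  \<open>v' \<le> - 2 C v + a B / (\<kappa> + exp z)\<close>. As \<open>(exp z)' = \<Gamma> (v - \<epsilon>)\<^sup>+\<close>, once \<open>exp z\<close> is so
  large that \<open>v\<close> is driven below \<open>\<epsilon>\<close>, the function \<open>exp z + \<Gamma> / (2 C) (v - \<epsilon>)\<^sup>+\<close> no longer
  increases, which bounds \<open>z\<close>. Then \<open>z\<close> converges, and since \<open>v'\<close> is bounded above this forces
  \<open>limsup v \<le> \<epsilon>\<close>. If finally \<open>\<kappa> + exp (lim z)\<close> dominates the parameters, all perturbation terms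
  vanish in the limit and \<open>U \<rightarrow> 0\<close>.

  Along solutions only an upper right Dini derivative of \<open>\<Phi>\<close> is controlled, and only where it is
  finite. For an absolutely continuous function it is smaller than \<open>\<infinity>\<close> almost everywhere, and
  such a function is nonincreasing if its Dini derivative is at most zero almost everywhere; this
  replaces the fundamental theorem of calculus.
\<close>

section \<open>Absolutely continuous functions\<close>

text \<open>The exponent 7 of the feedback splits as \<open>r * r^6\<close>. After multiplication of
  the output equation by \<open>y\<close>, the control contributes \<open>- b * r\<close> times
  \<open>r^6 * P1\<close>, \<open>r^6 * P2\<close>, \<open>r^6 * P3\<close> as coefficients of
  \<open>y^2\<close>, \<open>y^4\<close>, \<open>y^8\<close>. The terms to be dominated have degree
  at most three in \<open>r\<close>, and their squares occur as well; hence lower bounds for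
  \<open>P1\<close>, \<open>P2\<close>, \<open>P3\<close> that are exact at
  \<open>r = \<kappa>\<close> suffice for all \<open>r \<ge> \<kappa>\<close>. The spare factor
  \<open>r\<close> compensates the unknown \<open>b\<close>, since \<open>b * r \<ge> 1\<close> up
  to a defect governed by the positive part of \<open>1/b - r\<close>. Every dominated term costs
  one defect. Two terms come from the perturbation, whence the factor 2 in \<open>B\<close>; two
  more pay for the gain from \<open>y\<close> to \<open>w\<close>, whence the factor 4 in
  \<open>Z\<close>. In the inequality for \<open>v\<close> alone, \<open>w\<close> acts as a
  disturbance that the energy estimate bounds uniformly in time. Its effect decays like
  \<open>1 / r\<close>, which is what makes the adaptation stop.\<close>

lemma abs_continuous_on_intervalE:
  assumes "abs_continuous_on_interval l r f" "e > 0"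
  obtains \<eta> where "\<eta> > 0" "\<And>n p q. \<lbrakk>\<forall>i<n. l \<le> p i \<and> p i \<le> q i \<and> q i \<le> r;
      \<forall>i<n. \<forall>k<n. i \<noteq> k \<longrightarrow> {p i<..<q i} \<inter> {p k<..<q k} = {}; (\<Sum>i<n::nat. q i - p i) < \<eta>\<rbrakk>
      \<Longrightarrow> (\<Sum>i<n. \<bar>f (q i) - f (p i)\<bar>) < e"
  using assms unfolding abs_continuous_on_interval_def by auto

text \<open>Coverings and suprema over families produce unordered finite sets of endpoint pairs; an
  enumeration of \<open>D\<close> carries the definition over to them.\<close>

lemma abs_continuous_on_interval_finite:
  fixes f :: "real \<Rightarrow> real"
  assumes "abs_continuous_on_interval l r f" "e > 0"
  obtains \<eta> where "\<eta> > 0"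
    "\<And>(D :: (real \<times> real) set). \<lbrakk>finite D; \<And>p q. (p, q) \<in> D \<Longrightarrow> l \<le> p \<and> p \<le> q \<and> q \<le> r;
        pairwise (\<lambda>i j. disjnt {fst i<..<snd i} {fst j<..<snd j}) D;
        (\<Sum>(p, q)\<in>D. q - p) < \<eta>\<rbrakk> \<Longrightarrow> (\<Sum>(p, q)\<in>D. \<bar>f q - f p\<bar>) < e"
proof -
  obtain \<eta> where \<eta>: "\<eta> > 0" and ac: "\<And>n p q. \<lbrakk>\<forall>i<n. l \<le> p i \<and> p i \<le> q i \<and> q i \<le> r;
      \<forall>i<n. \<forall>k<n. i \<noteq> k \<longrightarrow> {p i<..<q i} \<inter> {p k<..<q k} = {}; (\<Sum>i<n::nat. q i - p i) < \<eta>\<rbrakk>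
      \<Longrightarrow> (\<Sum>i<n. \<bar>f (q i) - f (p i)\<bar>) < e"
    by (rule abs_continuous_on_intervalE[OF assms]) (rule that)
  show ?thesis
  proof (rule that[OF \<eta>])
    fix D :: "(real \<times> real) set"
    assume D: "finite D" "\<And>p q. (p, q) \<in> D \<Longrightarrow> l \<le> p \<and> p \<le> q \<and> q \<le> r"
      and disj: "pairwise (\<lambda>i j. disjnt {fst i<..<snd i} {fst j<..<snd j}) D"
      and small: "(\<Sum>(p, q)\<in>D. q - p) < \<eta>"
    obtain h where h: "bij_betw h {..<card D} D"
      using ex_bij_betw_nat_finite[OF D(1)] by (auto simp: atLeast0LessThan)
    have sum_h: "(\<Sum>(p, q)\<in>D. F p q) = (\<Sum>i<card D. F (fst (h i)) (snd (h i)))"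
      for F :: "real \<Rightarrow> real \<Rightarrow> real"
      using sum.reindex_bij_betw[OF h, of "\<lambda>(p, q). F p q"] by (simp add: case_prod_beta)
    have hD: "h i \<in> D" if "i < card D" for i
      using h that by (auto simp: bij_betw_def)
    have "(\<Sum>i<card D. \<bar>f (snd (h i)) - f (fst (h i))\<bar>) < e"
    proof (rule ac)
      show "\<forall>i<card D. l \<le> fst (h i) \<and> fst (h i) \<le> snd (h i) \<and> snd (h i) \<le> r"
        using D(2) hD by (metis prod.collapse)
      show "\<forall>i<card D. \<forall>k<card D. i \<noteq> k \<longrightarrow>
          {fst (h i)<..<snd (h i)} \<inter> {fst (h k)<..<snd (h k)} = {}"
      proof (intro allI impI)
        fix i k assume ik: "i < card D" "k < card D" "i \<noteq> k"
        then have "h i \<noteq> h k"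
          using h by (auto simp: bij_betw_def inj_on_def)
        with ik hD disj show "{fst (h i)<..<snd (h i)} \<inter> {fst (h k)<..<snd (h k)} = {}"
          by (auto simp: pairwise_def disjnt_def)
      qed
      show "(\<Sum>i<card D. snd (h i) - fst (h i)) < \<eta>"
        using small sum_h by simp
    qed
    then show "(\<Sum>(p, q)\<in>D. \<bar>f q - f p\<bar>) < e"
      using sum_h by simp
  qed
qed

lemma abs_continuous_on_interval_subset:
  "abs_continuous_on_interval l r f \<Longrightarrow> l \<le> l' \<Longrightarrow> r' \<le> r \<Longrightarrow> abs_continuous_on_interval l' r' f"
  unfolding abs_continuous_on_interval_def[of l' r']
proof (intro allI impI)
  fix e :: real
  assume ac: "abs_continuous_on_interval l r f" and le: "l \<le> l'" "r' \<le> r" and "e > 0"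
  obtain \<eta> where \<eta>: "\<eta> > 0" "\<And>n p q. \<lbrakk>\<forall>i<n. l \<le> p i \<and> p i \<le> q i \<and> q i \<le> r;
      \<forall>i<n. \<forall>k<n. i \<noteq> k \<longrightarrow> {p i<..<q i} \<inter> {p k<..<q k} = {}; (\<Sum>i<n::nat. q i - p i) < \<eta>\<rbrakk>
      \<Longrightarrow> (\<Sum>i<n. \<bar>f (q i) - f (p i)\<bar>) < e"
    by (rule abs_continuous_on_intervalE[OF ac \<open>e > 0\<close>]) (rule that)
  show "\<exists>\<eta>>0. \<forall>(n::nat) p q. (\<forall>i<n. l' \<le> p i \<and> p i \<le> q i \<and> q i \<le> r') \<and>
        (\<forall>i<n. \<forall>k<n. i \<noteq> k \<longrightarrow> {p i<..<q i} \<inter> {p k<..<q k} = {}) \<and>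
        (\<Sum>i<n. q i - p i) < \<eta> \<longrightarrow> (\<Sum>i<n. \<bar>f (q i) - f (p i)\<bar>) < e"
    using \<eta>(1) le by (intro exI[of _ \<eta>] conjI allI impI \<eta>(2)) (auto intro: order_trans)
qed

text \<open>This comparison of increments is the source of the closure properties below: Lipschitz
  functions, sums, multiples, products, positive parts and the exponential of \<open>z\<close>. As
  \<open>M\<close> may have any sign, the proof works with the positive number
  \<open>\<bar>M\<bar> + 1\<close>.\<close>

lemma abs_continuous_on_interval_dominated:
  fixes f g h :: "real \<Rightarrow> real"
  assumes f: "abs_continuous_on_interval l r f" and g: "abs_continuous_on_interval l r g"
    and dom: "\<And>p q. \<lbrakk>l \<le> p; p \<le> q; q \<le> r\<rbrakk> \<Longrightarrow> \<bar>h q - h p\<bar> \<le> M * \<bar>f q - f p\<bar> + M * \<bar>g q - g p\<bar>"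
  shows "abs_continuous_on_interval l r h"
  unfolding abs_continuous_on_interval_def
proof (intro allI impI)
  fix e :: real assume "e > 0"
  define e' where "e' = e / (2 * (\<bar>M\<bar> + 1))"
  have e': "e' > 0" using \<open>e > 0\<close> by (simp add: e'_def add_nonneg_pos)
  obtain \<eta>1 where 1: "\<eta>1 > 0" "\<And>n p q. \<lbrakk>\<forall>i<n. l \<le> p i \<and> p i \<le> q i \<and> q i \<le> r;
      \<forall>i<n. \<forall>k<n. i \<noteq> k \<longrightarrow> {p i<..<q i} \<inter> {p k<..<q k} = {}; (\<Sum>i<n::nat. q i - p i) < \<eta>1\<rbrakk>
      \<Longrightarrow> (\<Sum>i<n. \<bar>f (q i) - f (p i)\<bar>) < e'"
    by (rule abs_continuous_on_intervalE[OF f e']) (rule that)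
  obtain \<eta>2 where 2: "\<eta>2 > 0" "\<And>n p q. \<lbrakk>\<forall>i<n. l \<le> p i \<and> p i \<le> q i \<and> q i \<le> r;
      \<forall>i<n. \<forall>k<n. i \<noteq> k \<longrightarrow> {p i<..<q i} \<inter> {p k<..<q k} = {}; (\<Sum>i<n::nat. q i - p i) < \<eta>2\<rbrakk>
      \<Longrightarrow> (\<Sum>i<n. \<bar>g (q i) - g (p i)\<bar>) < e'"
    by (rule abs_continuous_on_intervalE[OF g e']) (rule that)
  show "\<exists>\<eta>>0. \<forall>(n::nat) p q.
        (\<forall>i<n. l \<le> p i \<and> p i \<le> q i \<and> q i \<le> r) \<and>
        (\<forall>i<n. \<forall>k<n. i \<noteq> k \<longrightarrow> {p i<..<q i} \<inter> {p k<..<q k} = {}) \<and>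
        (\<Sum>i<n. q i - p i) < \<eta>
        \<longrightarrow> (\<Sum>i<n. \<bar>h (q i) - h (p i)\<bar>) < e"
  proof (intro exI[of _ "min \<eta>1 \<eta>2"] conjI allI impI)
    show "min \<eta>1 \<eta>2 > 0" using 1 2 by simp
    fix n :: nat and p q :: "nat \<Rightarrow> real"
    assume A: "(\<forall>i<n. l \<le> p i \<and> p i \<le> q i \<and> q i \<le> r) \<and>
        (\<forall>i<n. \<forall>k<n. i \<noteq> k \<longrightarrow> {p i<..<q i} \<inter> {p k<..<q k} = {}) \<and>
        (\<Sum>i<n. q i - p i) < min \<eta>1 \<eta>2"
    have f': "(\<Sum>i<n. \<bar>f (q i) - f (p i)\<bar>) < e'" and g': "(\<Sum>i<n. \<bar>g (q i) - g (p i)\<bar>) < e'"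
      using A by (intro 1(2) 2(2); simp)+
    have "(\<Sum>i<n. \<bar>h (q i) - h (p i)\<bar>)
        \<le> (\<Sum>i<n. (\<bar>M\<bar> + 1) * (\<bar>f (q i) - f (p i)\<bar> + \<bar>g (q i) - g (p i)\<bar>))"
    proof (rule sum_mono)
      fix i assume "i \<in> {..<n}"
      then have "\<bar>h (q i) - h (p i)\<bar> \<le> M * \<bar>f (q i) - f (p i)\<bar> + M * \<bar>g (q i) - g (p i)\<bar>"
        using A by (intro dom) auto
      also have "\<dots> = M * (\<bar>f (q i) - f (p i)\<bar> + \<bar>g (q i) - g (p i)\<bar>)"
        by (simp add: distrib_left)
      also have "\<dots> \<le> (\<bar>M\<bar> + 1) * (\<bar>f (q i) - f (p i)\<bar> + \<bar>g (q i) - g (p i)\<bar>)"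
        by (intro mult_right_mono) auto
      finally show "\<bar>h (q i) - h (p i)\<bar> \<le> \<dots>" .
    qed
    also have "\<dots> = (\<bar>M\<bar> + 1) * ((\<Sum>i<n. \<bar>f (q i) - f (p i)\<bar>) + (\<Sum>i<n. \<bar>g (q i) - g (p i)\<bar>))"
      by (simp only: sum_distrib_left[symmetric] sum.distrib)
    also have "\<dots> < (\<bar>M\<bar> + 1) * (e' + e')"
      using f' g' by (intro mult_strict_left_mono) auto
    also have "\<dots> = e"
    proof -
      have "X * (e / (2 * X) + e / (2 * X)) = e" if "X \<noteq> 0" for X :: real
        using that by simp
      from this[of "\<bar>M\<bar> + 1"] show ?thesis unfolding e'_def by linarith
    qed
    finally show "(\<Sum>i<n. \<bar>h (q i) - h (p i)\<bar>) < e" .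
  qed
qed

lemma abs_continuous_on_interval_Lipschitz:
  assumes "\<And>p q. \<lbrakk>l \<le> p; p \<le> q; q \<le> r\<rbrakk> \<Longrightarrow> \<bar>f q - f p\<bar> \<le> M * (q - p)"
  shows "abs_continuous_on_interval l r f"
proof (rule abs_continuous_on_interval_dominated)
  show "abs_continuous_on_interval l r (\<lambda>t. t)" "abs_continuous_on_interval l r (\<lambda>t. t)"
    unfolding abs_continuous_on_interval_def by auto
  show "\<bar>f q - f p\<bar> \<le> M/2 * \<bar>q - p\<bar> + M/2 * \<bar>q - p\<bar>" if "l \<le> p" "p \<le> q" "q \<le> r" for p q
    using assms[OF that] that by simp
qed

lemma abs_continuous_on_interval_continuous:
  fixes f :: "real \<Rightarrow> real"
  assumes "abs_continuous_on_interval l r f"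
  shows "continuous_on {l..r} f"
  unfolding continuous_on_iff
proof (intro ballI allI impI)
  fix x e :: real assume x: "x \<in> {l..r}" and "e > 0"
  obtain \<eta> where \<eta>: "\<eta> > 0" and ac:
    "\<And>(D :: (real \<times> real) set). \<lbrakk>finite D; \<And>p q. (p, q) \<in> D \<Longrightarrow> l \<le> p \<and> p \<le> q \<and> q \<le> r;
        pairwise (\<lambda>i j. disjnt {fst i<..<snd i} {fst j<..<snd j}) D;
        (\<Sum>(p, q)\<in>D. q - p) < \<eta>\<rbrakk> \<Longrightarrow> (\<Sum>(p, q)\<in>D. \<bar>f q - f p\<bar>) < e"
    using abs_continuous_on_interval_finite[OF assms \<open>e > 0\<close>] by blast
  show "\<exists>d>0. \<forall>x'\<in>{l..r}. dist x' x < d \<longrightarrow> dist (f x') (f x) < e"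
  proof (intro exI[of _ \<eta>] conjI ballI impI \<eta>)
    fix x' assume "x' \<in> {l..r}" "dist x' x < \<eta>"
    then show "dist (f x') (f x) < e"
      using ac[of "{(min x x', max x x')}"] x
      by (cases "x \<le> x'") (auto simp: dist_real_def min_def max_def pairwise_def)
  qed
qed

lemma abs_continuous_on_interval_mult:
  fixes f g :: "real \<Rightarrow> real"
  assumes f: "abs_continuous_on_interval l r f" and g: "abs_continuous_on_interval l r g"
  shows "abs_continuous_on_interval l r (\<lambda>t. f t * g t)"
proof -
  obtain Mf where Mf: "\<And>t. t \<in> {l..r} \<Longrightarrow> \<bar>f t\<bar> \<le> Mf"
    using compact_imp_bounded[OF compact_continuous_image[OF abs_continuous_on_interval_continuous[OF f]]]
    by (force simp: bounded_iff)
  obtain Mg where Mg: "\<And>t. t \<in> {l..r} \<Longrightarrow> \<bar>g t\<bar> \<le> Mg"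
    using compact_imp_bounded[OF compact_continuous_image[OF abs_continuous_on_interval_continuous[OF g]]]
    by (force simp: bounded_iff)
  show ?thesis
  proof (rule abs_continuous_on_interval_dominated[OF f g])
    fix p q assume pq: "l \<le> p" "p \<le> q" "q \<le> r"
    have "f q * g q - f p * g p = g q * (f q - f p) + f p * (g q - g p)"
      by (simp add: algebra_simps)
    then have "\<bar>f q * g q - f p * g p\<bar> \<le> \<bar>g q\<bar> * \<bar>f q - f p\<bar> + \<bar>f p\<bar> * \<bar>g q - g p\<bar>"
      by (metis abs_mult abs_triangle_ineq)
    also have "\<dots> \<le> max Mf Mg * \<bar>f q - f p\<bar> + max Mf Mg * \<bar>g q - g p\<bar>"
      using Mf[of p] Mg[of q] pq by (intro add_mono mult_right_mono) auto
    finally show "\<bar>f q * g q - f p * g p\<bar> \<le> \<dots>" .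
  qed
qed

lemma abs_continuous_on_interval_C1:
  fixes f :: "real \<Rightarrow> real"
  assumes "continuous_on {l..r} f'"
    and "\<And>t. t \<in> {l..r} \<Longrightarrow> (f has_real_derivative f' t) (at t within {l..r})"
  shows "abs_continuous_on_interval l r f"
proof -
  obtain M where M: "\<And>t. t \<in> {l..r} \<Longrightarrow> \<bar>f' t\<bar> \<le> M"
    using compact_imp_bounded[OF compact_continuous_image[OF assms(1)]] by (force simp: bounded_iff)
  show ?thesis
  proof (rule abs_continuous_on_interval_Lipschitz)
    fix p q assume pq: "l \<le> p" "p \<le> q" "q \<le> r"
    have "norm (f q - f p) \<le> M * norm (q - p)"
      using pq M by (intro field_differentiable_bound[of "{l..r}" f f']) (auto intro: assms(2))
    then show "\<bar>f q - f p\<bar> \<le> M * (q - p)" using pq by simp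
  qed
qed

lemma abs_continuous_on_interval_add:
  fixes f k :: "real \<Rightarrow> real"
  assumes "abs_continuous_on_interval l r f" "abs_continuous_on_interval l r k"
  shows "abs_continuous_on_interval l r (\<lambda>t. f t + k t)"
  by (rule abs_continuous_on_interval_dominated[OF assms, of _ 1]) (auto simp: abs_if)

lemma abs_continuous_on_interval_cmult:
  fixes f :: "real \<Rightarrow> real"
  assumes "abs_continuous_on_interval l r f"
  shows "abs_continuous_on_interval l r (\<lambda>t. c * f t)"
  by (rule abs_continuous_on_interval_dominated[OF assms assms, of _ "\<bar>c\<bar>"])
    (simp add: abs_mult flip: right_diff_distrib)

lemma abs_continuous_on_interval_max:
  fixes f :: "real \<Rightarrow> real"
  assumes "abs_continuous_on_interval l r f"
  shows "abs_continuous_on_interval l r (\<lambda>t. max (f t - c) 0)"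
  by (rule abs_continuous_on_interval_dominated[OF assms assms, of _ 1]) (auto simp: abs_if max_def)

lemma abs_continuous_on_interval_linear: "abs_continuous_on_interval l r (\<lambda>t. c * t + k)"
  by (rule abs_continuous_on_interval_Lipschitz[of _ _ _ "\<bar>c\<bar>"])
    (simp add: abs_mult flip: right_diff_distrib)

lemma locally_abs_continuousD:
  "locally_abs_continuous f \<Longrightarrow> 0 \<le> s \<Longrightarrow> abs_continuous_on_interval s t f"
  unfolding locally_abs_continuous_def
  \<comment> \<open>The endpoint \<open>max t 1\<close> is positive, as local absolute continuity
    speaks of \<open>T > 0\<close> only.\<close>
  by (rule abs_continuous_on_interval_subset[of 0 "max t 1"]) (auto simp: max_def)

lemma C1_on_nonneg_locally_abs_continuous:
  assumes "C1_on_nonneg f" shows "locally_abs_continuous f"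
  unfolding locally_abs_continuous_def
proof (intro allI impI)
  fix T :: real
  obtain f' where f': "continuous_on {0..} f'" "\<And>t. t \<ge> 0 \<Longrightarrow> (f has_real_derivative f' t) (at t within {0..})"
    using assms unfolding C1_on_nonneg_def by blast
  show "abs_continuous_on_interval 0 T f"
  proof (rule abs_continuous_on_interval_C1)
    show "continuous_on {0..T} f'" using f'(1) by (rule continuous_on_subset) auto
    show "(f has_real_derivative f' t) (at t within {0..T})" if "t \<in> {0..T}" for t
      using that by (intro DERIV_subset[OF f'(2)]) auto
  qed
qed

section \<open>Upper right Dini derivatives\<close>

text \<open>Encodes that the upper right Dini derivative of \<open>f\<close> at \<open>t\<close> is
  at most \<open>c\<close>. Written as an eventual inequality without quotients, it also covers the
  value \<open>-\<infinity>\<close>, and bounds can be added without meeting undefined sums of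
  infinities.\<close>

definition dini_le :: "(real \<Rightarrow> real) \<Rightarrow> real \<Rightarrow> real \<Rightarrow> bool" where
  "dini_le f t c \<longleftrightarrow> (\<forall>e>c. eventually (\<lambda>s. f s - f t \<le> e * (s - t)) (at_right t))"

text \<open>Disjointness turns the sum of the lengths into the measure of a union contained in
  \<open>Q\<close>. Thus a small enclosing set yields the smallness condition of absolute
  continuity.\<close>

lemma sum_lengths_le_measure:
  fixes D :: "(real \<times> real) set"
  assumes "finite D" "pairwise (\<lambda>i j. disjnt {fst i<..<snd i} {fst j<..<snd j}) D"
    and "\<And>p q. (p, q) \<in> D \<Longrightarrow> p \<le> q \<and> {p<..<q} \<subseteq> Q" "Q \<in> lmeasurable"
  shows "(\<Sum>(p, q)\<in>D. q - p) \<le> measure lebesgue Q"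
proof -
  have "(\<Sum>(p, q)\<in>D. q - p) = (\<Sum>i\<in>D. measure lebesgue {fst i<..<snd i})"
    using assms(3) by (intro sum.cong refl) (auto simp: case_prod_beta)
  also have "\<dots> = measure lebesgue (\<Union>i\<in>D. {fst i<..<snd i})"
    using assms by (intro measure_UNION'[symmetric]) auto
  also have "\<dots> \<le> measure lebesgue Q"
    using assms(3) fmeasurableD[OF assms(4)]
    by (intro measure_mono_fmeasurable[OF UN_least _ assms(4)]) (auto simp: assms(1))
  finally show ?thesis .
qed

text \<open>Walking to the right from \<open>l\<close>, steps at good points gain at most \<open>e\<close> times their length,
  while steps at bad points stay in a small open set, where absolute continuity bounds the total
  variation by \<open>e\<close>.\<close>
lemma abs_continuous_nonincreasing:
  fixes f :: "real \<Rightarrow> real"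
  assumes ac: "abs_continuous_on_interval l r f" and lr: "l \<le> r"
    and dini: "AE t in lebesgue. l \<le> t \<and> t < r \<longrightarrow> dini_le f t 0"
  shows "f r \<le> f l"
proof (rule field_le_epsilon)
  fix e0 :: real assume "e0 > 0"
  \<comment> \<open>Good steps may gain \<open>e * (r - l)\<close> and bad steps \<open>e\<close>,
    together \<open>e0\<close>.\<close>
  define e where "e = e0 / (r - l + 1)"
  have e: "e > 0" "e * (r - l) + e = e0"
    using \<open>e0 > 0\<close> lr by (auto simp: e_def divide_simps add_nonneg_pos) (simp add: algebra_simps)
  obtain \<eta> where \<eta>: "\<eta> > 0" and small:
    "\<And>(D :: (real \<times> real) set). \<lbrakk>finite D; \<And>p q. (p, q) \<in> D \<Longrightarrow> l \<le> p \<and> p \<le> q \<and> q \<le> r;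
        pairwise (\<lambda>i j. disjnt {fst i<..<snd i} {fst j<..<snd j}) D;
        (\<Sum>(p, q)\<in>D. q - p) < \<eta>\<rbrakk> \<Longrightarrow> (\<Sum>(p, q)\<in>D. \<bar>f q - f p\<bar>) < e"
    using abs_continuous_on_interval_finite[OF ac e(1)] by blast
  obtain N where N: "negligible N" and good: "\<And>t. l \<le> t \<Longrightarrow> t < r \<Longrightarrow> t \<notin> N \<Longrightarrow> dini_le f t 0"
    using dini unfolding eventually_ae_filter negligible_iff_null_sets by auto
  have "N \<in> sets lebesgue" using N by (simp add: negligible_imp_sets)
  then obtain Q where Q: "open Q" "N \<subseteq> Q" "Q - N \<in> lmeasurable" "emeasure lebesgue (Q - N) < ennreal \<eta>"
    using sets_lebesgue_outer_open[OF _ \<eta>] by metis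
  have Qm: "Q \<in> lmeasurable"
    using Q N by (metis Diff_partition fmeasurable.Un inf_sup_aci(5) negligible_imp_measurable)
  have "measure lebesgue Q = measure lebesgue (Q - N)"
    using N Q(1) by (simp add: measure_Diff_null_set negligible_iff_null_sets Qm fmeasurableD)
  also have "\<dots> < \<eta>"
    using Q(3,4) \<eta> by (simp add: emeasure_eq_measure2 ennreal_less_iff)
  finally have Q\<eta>: "measure lebesgue Q < \<eta>" .
  \<comment> \<open>\<open>VQ t\<close> is the variation of \<open>f\<close> over finite disjoint
    families of intervals inside \<open>Q\<close> and to the left of \<open>t\<close>. Depending on
    \<open>t\<close> only, it accounts for the bad steps without a record of the walk, whose number
    of steps may be infinite.\<close>
  define fam where "fam t = {D :: (real \<times> real) set. finite D \<and>
      (\<forall>i\<in>D. l \<le> fst i \<and> fst i \<le> snd i \<and> snd i \<le> t \<and> {fst i<..<snd i} \<subseteq> Q) \<and>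
      pairwise (\<lambda>i j. disjnt {fst i<..<snd i} {fst j<..<snd j}) D}" for t
  define var where "var D = (\<Sum>(p, q)\<in>D. \<bar>f q - f p\<bar>)" for D :: "(real \<times> real) set"
  define VQ where "VQ t = Sup (var ` fam t)" for t
  have var_le: "var D \<le> e" if "D \<in> fam t" "t \<le> r" for D t
  proof -
    have D: "finite D" "pairwise (\<lambda>i j. disjnt {fst i<..<snd i} {fst j<..<snd j}) D"
      "\<And>p q. (p, q) \<in> D \<Longrightarrow> l \<le> p \<and> p \<le> q \<and> q \<le> t \<and> {p<..<q} \<subseteq> Q"
      using that(1) unfolding fam_def by fastforce+
    have "(\<Sum>(p, q)\<in>D. q - p) \<le> measure lebesgue Q"
      using D(3) by (intro sum_lengths_le_measure[OF D(1,2) _ Qm]) blast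
    then have "(\<Sum>(p, q)\<in>D. q - p) < \<eta>" using Q\<eta> by simp
    then have "(\<Sum>(p, q)\<in>D. \<bar>f q - f p\<bar>) < e"
      using D(3) that(2) by (intro small[OF D(1) _ D(2)]) (blast intro: order_trans)+
    then show ?thesis by (simp add: var_def)
  qed
  have bdd: "bdd_above (var ` fam t)" if "t \<le> r" for t
    using var_le that by (intro bdd_aboveI[of _ e]) auto
  have fam0: "{} \<in> fam t" for t by (simp add: fam_def)
  have VQ_le: "VQ t \<le> e" if "t \<le> r" for t
    unfolding VQ_def using var_le that fam0 by (intro cSup_least) blast+
  have VQ_mono: "VQ s \<le> VQ t" if "s \<le> t" "t \<le> r" for s t
  proof -
    have "fam s \<subseteq> fam t"
      unfolding fam_def using that(1) by (fastforce intro: order_trans)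
    moreover have "var ` fam s \<noteq> {}" using fam0 by blast
    ultimately show ?thesis
      unfolding VQ_def using bdd[OF that(2)] by (intro cSup_subset_mono image_mono)
  qed
  have VQ_step: "VQ s + \<bar>f t - f s\<bar> \<le> VQ t"
    if st: "l \<le> s" "s < t" "t \<le> r" "{s<..<t} \<subseteq> Q" for s t
  proof -
    have "VQ s \<le> VQ t - \<bar>f t - f s\<bar>"
      unfolding VQ_def[of s]
    proof (rule cSup_least)
      show "var ` fam s \<noteq> {}" using fam0 by blast
      fix v assume "v \<in> var ` fam s"
      then obtain D where D: "D \<in> fam s" "v = var D" by blast
      have notin: "(s, t) \<notin> D"
        using D(1) st by (auto simp: fam_def)
      have D': "finite D" "pairwise (\<lambda>i j. disjnt {fst i<..<snd i} {fst j<..<snd j}) D"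
        "\<And>i. i \<in> D \<Longrightarrow> l \<le> fst i \<and> fst i \<le> snd i \<and> snd i \<le> s \<and> {fst i<..<snd i} \<subseteq> Q"
        using D(1) unfolding fam_def by blast+
      have "disjnt {fst i<..<snd i} {s<..<t}" if "i \<in> D" for i
        using D'(3)[OF that] by (auto simp: disjnt_def)
      then have "pairwise (\<lambda>i j. disjnt {fst i<..<snd i} {fst j<..<snd j}) (insert (s, t) D)"
        using D'(2) by (simp add: pairwise_insert disjnt_sym)
      moreover have "\<forall>i\<in>insert (s, t) D.
          l \<le> fst i \<and> fst i \<le> snd i \<and> snd i \<le> t \<and> {fst i<..<snd i} \<subseteq> Q"
        using D'(3) st by fastforce
      ultimately have "insert (s, t) D \<in> fam t"
        using D'(1) unfolding fam_def by blast
      moreover have "var (insert (s, t) D) = var D + \<bar>f t - f s\<bar>"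
        using D notin by (simp add: var_def fam_def)
      ultimately have "var D + \<bar>f t - f s\<bar> \<le> VQ t"
        unfolding VQ_def using bdd[OF st(3)] by (metis cSup_upper image_eqI)
      then show "v \<le> VQ t - \<bar>f t - f s\<bar>" using D by simp
    qed
    then show ?thesis by simp
  qed
  \<comment> \<open>\<open>A\<close> collects the points where the accumulated gain is within
    budget. Its supremum \<open>\<tau>\<close> belongs to it by continuity of \<open>f\<close> and
    monotonicity of \<open>VQ\<close>; from any \<open>\<tau> < r\<close> one more step would be
    possible, so \<open>\<tau> = r\<close>.\<close>
  define A where "A = {t. l \<le> t \<and> t \<le> r \<and> f t - f l \<le> e * (t - l) + VQ t}"
  have VQ_nonneg: "VQ t \<ge> 0" if "t \<le> r" for t
  proof -
    have "var {} \<le> VQ t"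
      unfolding VQ_def using fam0 by (intro cSup_upper bdd[OF that] imageI)
    then show ?thesis by (simp add: var_def)
  qed
  have lA: "l \<in> A" using lr VQ_nonneg by (auto simp: A_def)
  have Abdd: "bdd_above A" by (auto simp: A_def intro: bdd_aboveI)
  define \<tau> where "\<tau> = Sup A"
  have \<tau>: "l \<le> \<tau>" "\<tau> \<le> r"
  proof -
    show "l \<le> \<tau>" unfolding \<tau>_def using lA Abdd by (rule cSup_upper)
    show "\<tau> \<le> r" unfolding \<tau>_def using lA by (intro cSup_least) (auto simp: A_def)
  qed
  have "\<tau> \<in> A"
  proof -
    have "f \<tau> - f l - e * (\<tau> - l) - VQ \<tau> \<le> 0"
    proof (rule field_le_epsilon)
      fix k :: real assume "k > 0"
      obtain d where d: "d > 0" "\<And>t. t \<in> {l..r} \<Longrightarrow> \<bar>t - \<tau>\<bar> < d \<Longrightarrow> \<bar>f t - f \<tau>\<bar> < k"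
        using abs_continuous_on_interval_continuous[OF ac] \<tau> \<open>k > 0\<close>
        unfolding continuous_on_iff dist_real_def by (metis atLeastAtMost_iff)
      obtain t where t: "t \<in> A" "\<tau> - d < t"
        using less_cSupD[of A "\<tau> - d"] lA d(1) \<tau>_def by auto
      then have "t \<le> \<tau>" unfolding \<tau>_def using Abdd by (auto intro: cSup_upper)
      then have "\<bar>f t - f \<tau>\<bar> < k" using t by (intro d(2)) (auto simp: A_def)
      moreover have "VQ t \<le> VQ \<tau>" using \<open>t \<le> \<tau>\<close> \<tau> by (intro VQ_mono)
      moreover have "e * (t - l) \<le> e * (\<tau> - l)" using \<open>t \<le> \<tau>\<close> e by simp
      ultimately show "f \<tau> - f l - e * (\<tau> - l) - VQ \<tau> \<le> 0 + k" using t by (auto simp: A_def)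
    qed
    then show ?thesis using \<tau> by (simp add: A_def)
  qed
  have "\<tau> = r"
  proof (rule ccontr)
    assume "\<tau> \<noteq> r"
    with \<tau> have "\<tau> < r" by simp
    have "\<exists>t>\<tau>. t \<in> A"
    proof (cases "\<tau> \<in> N")
      case True
      then obtain d where d: "d > 0" "ball \<tau> d \<subseteq> Q"
        using Q by (meson open_contains_ball subsetD)
      define t where "t = min r (\<tau> + d)"
      have t: "\<tau> < t" "t \<le> r" using d \<open>\<tau> < r\<close> by (auto simp: t_def)
      have "{\<tau><..<t} \<subseteq> ball \<tau> d" by (auto simp: t_def dist_real_def)
      then have "VQ \<tau> + \<bar>f t - f \<tau>\<bar> \<le> VQ t" using t \<tau> d by (intro VQ_step) auto
      moreover have "e * (\<tau> - l) \<le> e * (t - l)" using t e by simp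
      ultimately show ?thesis using \<open>\<tau> \<in> A\<close> t \<tau> by (intro exI[of _ t]) (auto simp: A_def)
    next
      case False
      then have "dini_le f \<tau> 0" using good \<tau> \<open>\<tau> < r\<close> by simp
      then have "eventually (\<lambda>s. f s - f \<tau> \<le> e * (s - \<tau>)) (at_right \<tau>)"
        using e by (auto simp: dini_le_def)
      moreover have "eventually (\<lambda>s. s \<in> {\<tau><..<r}) (at_right \<tau>)"
        using \<open>\<tau> < r\<close> by (rule eventually_at_right_real)
      ultimately have "eventually (\<lambda>s. f s - f \<tau> \<le> e * (s - \<tau>) \<and> s \<in> {\<tau><..<r}) (at_right \<tau>)"
        by (rule eventually_conj)
      then obtain t where t: "f t - f \<tau> \<le> e * (t - \<tau>)" "\<tau> < t" "t < r"
        using eventually_happens'[of "at_right \<tau>"] by fastforce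
      have "VQ \<tau> \<le> VQ t" using t by (intro VQ_mono) auto
      moreover have "e * (t - l) = e * (t - \<tau>) + e * (\<tau> - l)" by (simp add: algebra_simps)
      ultimately show ?thesis using \<open>\<tau> \<in> A\<close> t \<tau> by (intro exI[of _ t]) (auto simp: A_def)
    qed
    then show False using Abdd \<tau>_def by (meson cSup_upper leD)
  qed
  then show "f r \<le> f l + e0"
    using \<open>\<tau> \<in> A\<close> VQ_le[of r] e by (auto simp: A_def)
qed

lemma dini_le_mono: "dini_le f t c \<Longrightarrow> c \<le> c' \<Longrightarrow> dini_le f t c'"
  by (auto simp: dini_le_def)

lemma dini_le_add:
  assumes "dini_le f t c" "dini_le k t c'"
  shows "dini_le (\<lambda>s. f s + k s) t (c + c')"
  unfolding dini_le_def
proof (intro allI impI)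
  fix e assume "e > c + c'"
  define h where "h = (e - c - c') / 2"
  have h: "h > 0" "e = (c + h) + (c' + h)" using \<open>e > c + c'\<close> by (auto simp: h_def field_simps)
  have "eventually (\<lambda>s. f s - f t \<le> (c + h) * (s - t)) (at_right t)"
    "eventually (\<lambda>s. k s - k t \<le> (c' + h) * (s - t)) (at_right t)"
    using assms h by (auto simp: dini_le_def)
  then show "eventually (\<lambda>s. f s + k s - (f t + k t) \<le> e * (s - t)) (at_right t)"
    by eventually_elim (simp add: h(2) algebra_simps)
qed

lemma dini_le_cmult:
  assumes "dini_le f t c" "k > 0"
  shows "dini_le (\<lambda>s. k * f s) t (k * c)"
  unfolding dini_le_def
proof (intro allI impI)
  fix e assume "e > k * c"
  then have "e / k > c" using assms(2) by (simp add: field_simps)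
  then have "eventually (\<lambda>s. f s - f t \<le> e / k * (s - t)) (at_right t)"
    using assms(1) unfolding dini_le_def by blast
  then show "eventually (\<lambda>s. k * f s - k * f t \<le> e * (s - t)) (at_right t)"
  proof eventually_elim
    case (elim s)
    then have "k * (f s - f t) \<le> k * (e / k * (s - t))" using assms(2) by (intro mult_left_mono) auto
    then show ?case using assms(2) by (simp add: right_diff_distrib)
  qed
qed

lemma dini_le_derivative:
  assumes "(f has_real_derivative c) (at t within {0..})" "t \<ge> 0"
  shows "dini_le f t c"
  unfolding dini_le_def
proof (intro allI impI)
  fix e assume "e > c"
  have "(f has_real_derivative c) (at_right t)"
    using assms by (elim DERIV_subset) auto
  then have "((\<lambda>s. (f s - f t) / (s - t)) \<longlongrightarrow> c) (at_right t)"
    by (simp add: has_field_derivative_iff)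
  then have "eventually (\<lambda>s. (f s - f t) / (s - t) < e) (at_right t)"
    using \<open>e > c\<close> by (rule order_tendstoD)
  moreover have "eventually (\<lambda>s. s > t) (at_right t)"
    by (simp add: eventually_at_right_less)
  ultimately show "eventually (\<lambda>s. f s - f t \<le> e * (s - t)) (at_right t)"
    by eventually_elim (simp add: divide_simps)
qed

text \<open>The increment splits into \<open>exp (\<mu> * s) * (f s - f t)\<close> and
  \<open>f t\<close> times the increment of the exponential. Positivity of the exponential preserves
  the one-sided bound in the first part; the difference quotient of the second has a genuine limit,
  whatever the sign of \<open>f t\<close>.\<close>

lemma dini_le_exp_mult:
  assumes f: "dini_le f t c"
  shows "dini_le (\<lambda>s. exp (\<mu> * s) * f s) t (exp (\<mu> * t) * (c + \<mu> * f t))"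
  unfolding dini_le_def
proof (intro allI impI)
  fix e assume e: "e > exp (\<mu> * t) * (c + \<mu> * f t)"
  define h where "h = (e / exp (\<mu> * t) - (c + \<mu> * f t)) / 2"
  have h: "h > 0" using e by (simp add: h_def field_simps)
  have ee: "exp (\<mu> * t) * (c + h) + f t * (exp (\<mu> * t) * \<mu>) < e"
  proof -
    have "e / exp (\<mu> * t) = c + \<mu> * f t + 2 * h" by (simp add: h_def diff_divide_distrib add_divide_distrib)
    then have "e = exp (\<mu> * t) * (c + \<mu> * f t + 2 * h)" by (simp add: field_simps)
    then show ?thesis using h by (simp add: algebra_simps)
  qed
  have "((\<lambda>s. exp (\<mu> * s)) has_real_derivative exp (\<mu> * t) * \<mu>) (at_right t)"
    by (auto intro!: derivative_eq_intros)
  then have D: "((\<lambda>s. (exp (\<mu> * s) - exp (\<mu> * t)) / (s - t)) \<longlongrightarrow> exp (\<mu> * t) * \<mu>) (at_right t)"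
    by (simp add: has_field_derivative_iff)
  have "((\<lambda>s. exp (\<mu> * s) * (c + h) + f t * ((exp (\<mu> * s) - exp (\<mu> * t)) / (s - t)))
      \<longlongrightarrow> exp (\<mu> * t) * (c + h) + f t * (exp (\<mu> * t) * \<mu>)) (at_right t)"
    by (intro tendsto_intros D)
  then have "eventually (\<lambda>s. exp (\<mu> * s) * (c + h) + f t * ((exp (\<mu> * s) - exp (\<mu> * t)) / (s - t)) < e) (at_right t)"
    using ee by (rule order_tendstoD)
  moreover have "eventually (\<lambda>s. f s - f t \<le> (c + h) * (s - t)) (at_right t)"
    using f h by (simp add: dini_le_def)
  moreover have "eventually (\<lambda>s. s > t) (at_right t)"
    by (simp add: eventually_at_right_less)
  ultimately show "eventually (\<lambda>s. exp (\<mu> * s) * f s - exp (\<mu> * t) * f t \<le> e * (s - t)) (at_right t)"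
  proof eventually_elim
    case (elim s)
    have "exp (\<mu> * s) * f s - exp (\<mu> * t) * f t
        = exp (\<mu> * s) * (f s - f t) + f t * ((exp (\<mu> * s) - exp (\<mu> * t)) / (s - t)) * (s - t)"
    proof -
      have "(exp (\<mu> * s) - exp (\<mu> * t)) / (s - t) * (s - t) = exp (\<mu> * s) - exp (\<mu> * t)"
        using elim(3) by simp
      then show ?thesis by (simp only: mult.assoc) (simp add: algebra_simps)
    qed
    also have "\<dots> \<le> exp (\<mu> * s) * ((c + h) * (s - t)) + f t * ((exp (\<mu> * s) - exp (\<mu> * t)) / (s - t)) * (s - t)"
      using elim(2) by simp
    also have "\<dots> = (exp (\<mu> * s) * (c + h) + f t * ((exp (\<mu> * s) - exp (\<mu> * t)) / (s - t))) * (s - t)"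
      by (simp add: algebra_simps)
    also have "\<dots> \<le> e * (s - t)" using elim(1,3) by (intro mult_right_mono) auto
    finally show ?case .
  qed
qed

lemma dini_le_linear: "dini_le (\<lambda>s. c * s + k) t c"
  unfolding dini_le_def
proof (intro allI impI)
  fix e assume "e > c"
  show "\<forall>\<^sub>F s in at_right t. c * s + k - (c * t + k) \<le> e * (s - t)"
    using eventually_at_right_less[of t]
  proof eventually_elim
    case (elim s)
    then have "c * (s - t) \<le> e * (s - t)" using \<open>e > c\<close> by (intro mult_right_mono) auto
    then show ?case by (simp add: algebra_simps)
  qed
qed

text \<open>Only the kink is delicate: where \<open>f t = \<epsilon>\<close>, the right derivative
  of the positive part is \<open>max c 0\<close>, and the last hypothesis makes it zero.\<close>

lemma dini_le_max:
  assumes "(f has_real_derivative c) (at t within {0..})" "t \<ge> 0" and "f t = \<epsilon> \<Longrightarrow> c \<le> 0"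
  shows "dini_le (\<lambda>s. max (f s - \<epsilon>) 0) t (if f t > \<epsilon> then c else 0)"
proof -
  have f: "dini_le f t c" using assms by (intro dini_le_derivative)
  have "continuous (at_right t) f"
    using assms by (intro DERIV_continuous[OF DERIV_subset]) auto
  then have lim: "(f \<longlongrightarrow> f t) (at_right t)" by (simp add: continuous_within)
  consider "f t > \<epsilon>" | "f t = \<epsilon>" | "f t < \<epsilon>" by linarith
  then show ?thesis
  proof cases
    case 1
    have "eventually (\<lambda>s. f s > \<epsilon>) (at_right t)" using lim 1 by (rule order_tendstoD)
    show ?thesis unfolding dini_le_def
    proof (intro allI impI)
      fix e assume "e > (if f t > \<epsilon> then c else 0)"
      then have "eventually (\<lambda>s. f s - f t \<le> e * (s - t)) (at_right t)"
        using f 1 by (simp add: dini_le_def)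
      with \<open>eventually (\<lambda>s. f s > \<epsilon>) (at_right t)\<close>
      show "eventually (\<lambda>s. max (f s - \<epsilon>) 0 - max (f t - \<epsilon>) 0 \<le> e * (s - t)) (at_right t)"
        by eventually_elim (use 1 in simp)
    qed
  next
    case 2
    show ?thesis unfolding dini_le_def
    proof (intro allI impI)
      fix e assume e: "e > (if f t > \<epsilon> then c else 0)"
      then have "eventually (\<lambda>s. f s - f t \<le> e * (s - t)) (at_right t)"
        using f 2 assms(3) by (simp add: dini_le_def)
      moreover have "eventually (\<lambda>s. s > t) (at_right t)"
        by (simp add: eventually_at_right_less)
      ultimately
      show "eventually (\<lambda>s. max (f s - \<epsilon>) 0 - max (f t - \<epsilon>) 0 \<le> e * (s - t)) (at_right t)"
        by eventually_elim (use 2 e in simp)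
    qed
  next
    case 3
    have "eventually (\<lambda>s. f s < \<epsilon>) (at_right t)" using lim 3 by (rule order_tendstoD)
    moreover have "eventually (\<lambda>s. s > t) (at_right t)"
      by (simp add: eventually_at_right_less)
    ultimately have "eventually (\<lambda>s. max (f s - \<epsilon>) 0 - max (f t - \<epsilon>) 0 \<le> e * (s - t)) (at_right t)"
      if "e > 0" for e
      by eventually_elim (use 3 that in simp)
    then show ?thesis using 3 by (simp add: dini_le_def)
  qed
qed

lemma Limsup_quotient_dini_le:
  assumes "Limsup (at_right 0) (\<lambda>h. ereal ((f (t + h) - f t) / h)) \<le> ereal c"
  shows "dini_le f t c"
  unfolding dini_le_def
proof (intro allI impI)
  fix e assume "e > c"
  with assms have "Limsup (at_right 0) (\<lambda>h. ereal ((f (t + h) - f t) / h)) < ereal e"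
    by (simp add: order_le_less_trans)
  then have "eventually (\<lambda>h. ereal ((f (t + h) - f t) / h) < ereal e) (at_right 0)"
    by (rule Limsup_lessD)
  moreover have "eventually (\<lambda>h. h > 0) (at_right (0::real))"
    by (simp add: eventually_at_right_less)
  ultimately have "eventually (\<lambda>h. f (t + h) - f t \<le> e * h) (at_right 0)"
    by eventually_elim (simp add: field_simps)
  then show "eventually (\<lambda>s. f s - f t \<le> e * (s - t)) (at_right t)"
    unfolding eventually_at_right_to_0[of _ t] by (simp add: add.commute)
qed

text \<open>Vitali covering: intervals on which the difference quotient exceeds \<open>M\<close> have total length
  at most \<open>1/M\<close>, since the total variation over them is at most one.\<close>
lemma negligible_infinite_Limsup_quotient:
  fixes f :: "real \<Rightarrow> real"
  assumes small: "\<And>(D :: (real \<times> real) set). \<lbrakk>finite D; \<And>p q. (p, q) \<in> D \<Longrightarrow> l \<le> p \<and> p \<le> q \<and> q \<le> r;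
        pairwise (\<lambda>i j. disjnt {fst i<..<snd i} {fst j<..<snd j}) D\<rbrakk> \<Longrightarrow> (\<Sum>(p, q)\<in>D. \<bar>f q - f p\<bar>) \<le> 1"
  shows "negligible {t. l \<le> t \<and> t < r \<and> Limsup (at_right 0) (\<lambda>h. ereal ((f (t + h) - f t) / h)) = \<infinity>}"
    (is "negligible ?E")
  unfolding negligible_outer_le
proof (intro allI impI)
  fix e :: real assume "e > 0"
  \<comment> \<open>Vitali's lemma enlarges the selected intervals by the factor 5, so the covering
    has measure at most \<open>5 / M = e\<close>.\<close>
  define M where "M = 5 / e"
  have M: "M > 0" using \<open>e > 0\<close> by (simp add: M_def)
  define K where "K = {(p, q). l \<le> p \<and> p < q \<and> q \<le> r \<and> f q - f p > M * (q - p)}"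
  \<comment> \<open>Midpoint and half length present the intervals as the closed balls of the
    covering lemma.\<close>
  define a where "a i = (fst i + snd i) / 2" for i :: "real \<times> real"
  define \<rho> where "\<rho> i = (snd i - fst i) / 2" for i :: "real \<times> real"
  have cb: "cball (a i) (\<rho> i) = {fst i..snd i}" for i
    by (auto simp: a_def \<rho>_def cball_eq_atLeastAtMost field_simps)
  have "?E \<subseteq> (\<Union>i\<in>K. cball (a i) (\<rho> i))"
  proof
    fix t assume t: "t \<in> ?E"
    have "frequently (\<lambda>h. (f (t + h) - f t) / h > M) (at_right 0)"
    proof (rule ccontr)
      assume "\<not> frequently (\<lambda>h. (f (t + h) - f t) / h > M) (at_right 0)"
      then have "eventually (\<lambda>h. ereal ((f (t + h) - f t) / h) \<le> ereal M) (at_right 0)"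
        by (simp add: frequently_def not_less)
      then have "Limsup (at_right 0) (\<lambda>h. ereal ((f (t + h) - f t) / h)) \<le> ereal M"
        by (rule Limsup_bounded)
      then show False using t by simp
    qed
    moreover have "eventually (\<lambda>h. h \<in> {0<..<r - t}) (at_right 0)"
      using t by (intro eventually_at_right_real) auto
    then have "eventually (\<lambda>h. (f (t + h) - f t) / h > M \<longrightarrow>
        (f (t + h) - f t) / h > M \<and> h \<in> {0<..<r - t}) (at_right 0)"
      by eventually_elim blast
    ultimately have "frequently (\<lambda>h. (f (t + h) - f t) / h > M \<and> h \<in> {0<..<r - t}) (at_right 0)"
      by (rule frequently_rev_mp)
    then obtain h where "(f (t + h) - f t) / h > M" "0 < h" "h < r - t"
      using frequently_ex by fastforce
    then have "(t, t + h) \<in> K" using t by (auto simp: K_def field_simps)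
    then show "t \<in> (\<Union>i\<in>K. cball (a i) (\<rho> i))"
      using \<open>0 < h\<close> by (intro UN_I[of "(t, t + h)"]) (auto simp: cb)
  qed
  moreover have "0 < \<rho> i \<and> \<rho> i \<le> r - l" if "i \<in> K" for i
    using that by (auto simp: K_def \<rho>_def)
  ultimately obtain C where C: "countable C" "C \<subseteq> K"
    and disj: "pairwise (\<lambda>i j. disjnt (cball (a i) (\<rho> i)) (cball (a j) (\<rho> j))) C"
    and cov: "?E \<subseteq> (\<Union>i\<in>C. cball (a i) (5 * \<rho> i))"
    by (rule Vitali_covering_lemma_cballs)
  have bound: "measure lebesgue (\<Union>i\<in>D. cball (a i) (5 * \<rho> i)) \<le> e" if D: "D \<subseteq> C" "finite D" for D
  proof -
    have DK: "l \<le> p \<and> p < q \<and> q \<le> r \<and> M * (q - p) < f q - f p" if "(p, q) \<in> D" for p q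
      using that D C by (auto simp: K_def)
    have "measure lebesgue (\<Union>i\<in>D. cball (a i) (5 * \<rho> i)) \<le> (\<Sum>i\<in>D. measure lebesgue (cball (a i) (5 * \<rho> i)))"
      using D by (intro measure_UNION_le) auto
    also have "\<dots> = (\<Sum>i\<in>D. 5 * (snd i - fst i))"
    proof (rule sum.cong)
      fix i assume "i \<in> D"
      then have "fst i < snd i" using DK[of "fst i" "snd i"] by simp
      then show "measure lebesgue (cball (a i) (5 * \<rho> i)) = 5 * (snd i - fst i)"
        by (simp add: \<rho>_def cball_eq_atLeastAtMost) (simp add: field_simps)
    qed simp
    also have "\<dots> = (5 / M) * (\<Sum>(p, q)\<in>D. M * (q - p))"
      using M by (simp add: sum_distrib_left case_prod_beta)
    also have "\<dots> \<le> (5 / M) * (\<Sum>(p, q)\<in>D. \<bar>f q - f p\<bar>)"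
      using DK M by (intro mult_left_mono sum_mono) (fastforce)+
    also have "\<dots> \<le> (5 / M) * 1"
    proof (intro mult_left_mono small D)
      show "l \<le> p \<and> p \<le> q \<and> q \<le> r" if "(p, q) \<in> D" for p q using DK[OF that] by simp
      show "pairwise (\<lambda>i j. disjnt {fst i<..<snd i} {fst j<..<snd j}) D"
        using pairwise_subset[OF disj D(1)] unfolding cb
        by (rule pairwise_mono) (auto simp: disjnt_def)
    qed (use M in auto)
    also have "\<dots> = e" using \<open>e > 0\<close> by (simp add: M_def)
    finally show ?thesis .
  qed
  show "\<exists>T. ?E \<subseteq> T \<and> T \<in> lmeasurable \<and> measure lebesgue T \<le> e"
    using cov bound
    by (intro exI[of _ "\<Union>i\<in>C. cball (a i) (5 * \<rho> i)"] conjI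
        fmeasurable_UN_bound[OF C(1)] measure_UN_bound[OF C(1)]) auto
qed

text \<open>The covering argument needs total variation at most one, which absolute continuity
  grants on intervals shorter than \<open>\<eta>\<close>. Therefore the half-line is cut into unit
  intervals, and these into pieces of length at most \<open>1 / m < \<eta>\<close>; a countable
  union of null sets is null.\<close>

lemma abs_continuous_Limsup_quotient_finite:
  fixes f :: "real \<Rightarrow> real"
  assumes "locally_abs_continuous f"
  shows "AE t in lebesgue. t \<ge> 0 \<longrightarrow> Limsup (at_right 0) (\<lambda>h. ereal ((f (t + h) - f t) / h)) \<noteq> \<infinity>"
proof -
  let ?P = "\<lambda>t. Limsup (at_right 0) (\<lambda>h. ereal ((f (t + h) - f t) / h)) = \<infinity>"
  have "negligible {t. real n \<le> t \<and> t < real n + 1 \<and> ?P t}" for n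
  proof -
    have ac: "abs_continuous_on_interval (real n) (real n + 1) f"
      using assms by (intro locally_abs_continuousD) auto
    obtain \<eta> where \<eta>: "\<eta> > 0" and small:
      "\<And>(D :: (real \<times> real) set). \<lbrakk>finite D; \<And>p q. (p, q) \<in> D \<Longrightarrow> real n \<le> p \<and> p \<le> q \<and> q \<le> real n + 1;
          pairwise (\<lambda>i j. disjnt {fst i<..<snd i} {fst j<..<snd j}) D;
          (\<Sum>(p, q)\<in>D. q - p) < \<eta>\<rbrakk> \<Longrightarrow> (\<Sum>(p, q)\<in>D. \<bar>f q - f p\<bar>) < 1"
      using abs_continuous_on_interval_finite[OF ac zero_less_one] by blast
    obtain m where m: "m > 0" "inverse (real m) < \<eta>" using ex_inverse_of_nat_less[OF \<eta>] by blast
    have mm: "inverse (real m) > 0" using m by simp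
    define L where "L k = real n + real k * inverse (real m)" for k
    \<comment> \<open>The pieces are clipped at \<open>n + 1\<close>, since \<open>\<eta>\<close>
      belongs to this unit interval; those beyond it are empty.\<close>
    define R where "R k = min (L k + inverse (real m)) (real n + 1)" for k
    have "negligible {t. L k \<le> t \<and> t < R k \<and> ?P t}" for k
    proof (cases "L k \<le> R k")
      case False
      then have "{t. L k \<le> t \<and> t < R k \<and> ?P t} = {}" by auto
      then show ?thesis by (simp only: negligible_empty)
    next
      case True
      have L: "real n \<le> L k" by (simp add: L_def)
      show ?thesis
      proof (rule negligible_infinite_Limsup_quotient)
        fix D :: "(real \<times> real) set"
        assume D: "finite D" "\<And>p q. (p, q) \<in> D \<Longrightarrow> L k \<le> p \<and> p \<le> q \<and> q \<le> R k"
          "pairwise (\<lambda>i j. disjnt {fst i<..<snd i} {fst j<..<snd j}) D"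
        have "(\<Sum>(p, q)\<in>D. q - p) \<le> measure lebesgue {L k..R k}"
          using D(2) by (intro sum_lengths_le_measure D) force+
        also have "\<dots> \<le> inverse (real m)" using True by (simp add: R_def)
        finally have "(\<Sum>(p, q)\<in>D. q - p) < \<eta>" using m by simp
        then show "(\<Sum>(p, q)\<in>D. \<bar>f q - f p\<bar>) \<le> 1"
          using D(2) L by (intro less_imp_le small D) (fastforce simp: R_def)+
      qed
    qed
    then have "negligible (\<Union>k. {t. L k \<le> t \<and> t < R k \<and> ?P t})" by blast
    then show ?thesis
    proof (rule negligible_subset)
      show "{t. real n \<le> t \<and> t < real n + 1 \<and> ?P t} \<subseteq> (\<Union>k. {t. L k \<le> t \<and> t < R k \<and> ?P t})"
      proof clarify
        fix t assume t: "real n \<le> t" "t < real n + 1" "?P t"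
        define k where "k = nat \<lfloor>(t - real n) * real m\<rfloor>"
        have "real k \<le> (t - real n) * real m" "(t - real n) * real m < real k + 1"
          using t by (auto simp: k_def)
        then have "L k \<le> t" "t < L k + inverse (real m)"
          using m by (auto simp: L_def field_simps)
        then show "t \<in> (\<Union>k. {t. L k \<le> t \<and> t < R k \<and> ?P t})"
          using t by (auto simp: R_def)
      qed
    qed
  qed
  then have "negligible (\<Union>n. {t. real n \<le> t \<and> t < real n + 1 \<and> ?P t})" by blast
  then have "negligible {t. t \<ge> 0 \<and> ?P t}"
  proof (rule negligible_subset)
    show "{t. t \<ge> 0 \<and> ?P t} \<subseteq> (\<Union>n. {t. real n \<le> t \<and> t < real n + 1 \<and> ?P t})"
    proof clarify
      fix t :: real assume "t \<ge> 0" "?P t"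
      moreover from this have "real (nat \<lfloor>t\<rfloor>) \<le> t" "t < real (nat \<lfloor>t\<rfloor>) + 1" by linarith+
      ultimately show "t \<in> (\<Union>n. {t. real n \<le> t \<and> t < real n + 1 \<and> ?P t})" by blast
    qed
  qed
  then show ?thesis
    unfolding eventually_ae_filter negligible_iff_null_sets by (intro bexI) auto
qed

section \<open>Comparison principles for Dini differential inequalities\<close>

lemma dini_le_imp_le:
  assumes ac: "locally_abs_continuous f" and "0 \<le> s" "s \<le> t"
    and dini: "AE \<tau> in lebesgue. s \<le> \<tau> \<and> \<tau> < t \<longrightarrow> dini_le f \<tau> c"
  shows "f t - f s \<le> c * (t - s)"
proof -
  have "f t + (- c * t + 0) \<le> f s + (- c * s + 0)"
  proof (rule abs_continuous_nonincreasing[where f = "\<lambda>\<tau>. f \<tau> + (- c * \<tau> + 0)"])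
    show "abs_continuous_on_interval s t (\<lambda>\<tau>. f \<tau> + (- c * \<tau> + 0))"
      using locally_abs_continuousD[OF ac \<open>0 \<le> s\<close>, of t]
      by (intro abs_continuous_on_interval_add abs_continuous_on_interval_linear)
    show "AE \<tau> in lebesgue. s \<le> \<tau> \<and> \<tau> < t \<longrightarrow> dini_le (\<lambda>\<tau>. f \<tau> + (- c * \<tau> + 0)) \<tau> 0"
      using dini
    proof eventually_elim
      case (elim \<tau>)
      then show ?case using dini_le_add[OF _ dini_le_linear[of "-c" 0], of f \<tau> c] by simp
    qed
  qed fact
  then show ?thesis by (simp add: algebra_simps)
qed

text \<open>A Gronwall argument: \<open>c / \<mu>\<close> is the equilibrium of the comparison
  equation, and the integrating factor \<open>exp (\<mu> * \<tau>)\<close> makes the deviation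
  \<open>f - c / \<mu>\<close> nonincreasing.\<close>

lemma dini_comparison:
  assumes ac: "locally_abs_continuous f" and "\<mu> > 0" "0 \<le> s" "s \<le> t"
    and dini: "AE \<tau> in lebesgue. s \<le> \<tau> \<and> \<tau> < t \<longrightarrow> dini_le f \<tau> (c - \<mu> * f \<tau>)"
  shows "f t \<le> c / \<mu> + exp (- \<mu> * (t - s)) * (f s - c / \<mu>)"
proof -
  \<comment> \<open>The constant \<open>- c / \<mu>\<close> is written as a linear function of slope
    zero, so that the rules for linear summands apply.\<close>
  let ?F = "\<lambda>\<tau>. exp (\<mu> * \<tau>) * (f \<tau> + (0 * \<tau> + - c / \<mu>))"
  have "?F t \<le> ?F s"
  proof (rule abs_continuous_nonincreasing[where f = ?F])
    have "abs_continuous_on_interval s t (\<lambda>\<tau>. exp (\<mu> * \<tau>))"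
      by (rule abs_continuous_on_interval_C1[where f' = "\<lambda>\<tau>. exp (\<mu> * \<tau>) * \<mu>"])
        (auto intro!: continuous_intros derivative_eq_intros)
    then show "abs_continuous_on_interval s t ?F"
      using locally_abs_continuousD[OF ac \<open>0 \<le> s\<close>, of t]
      by (intro abs_continuous_on_interval_mult abs_continuous_on_interval_add
          abs_continuous_on_interval_linear)
    show "AE \<tau> in lebesgue. s \<le> \<tau> \<and> \<tau> < t \<longrightarrow> dini_le ?F \<tau> 0"
      using dini
    proof eventually_elim
      case (elim \<tau>)
      show ?case
      proof
        assume "s \<le> \<tau> \<and> \<tau> < t"
        with elim have "dini_le f \<tau> (c - \<mu> * f \<tau>)" by simp
        then have "dini_le ?F \<tau> (exp (\<mu> * \<tau>) * (c - \<mu> * f \<tau> + 0 + \<mu> * (f \<tau> + (0 * \<tau> + - c / \<mu>))))"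
          by (intro dini_le_exp_mult dini_le_add dini_le_linear)
        moreover have "c - \<mu> * f \<tau> + 0 + \<mu> * (f \<tau> + (0 * \<tau> + - c / \<mu>)) = 0"
          using \<open>\<mu> > 0\<close> by (simp add: field_simps)
        ultimately show "dini_le ?F \<tau> 0" by simp
      qed
    qed
  qed fact
  then have "exp (- \<mu> * t) * (exp (\<mu> * t) * (f t - c / \<mu>)) \<le> exp (- \<mu> * t) * (exp (\<mu> * s) * (f s - c / \<mu>))"
    by (intro mult_left_mono) auto
  then have "(exp (- \<mu> * t) * exp (\<mu> * t)) * (f t - c / \<mu>) \<le> (exp (- \<mu> * t) * exp (\<mu> * s)) * (f s - c / \<mu>)"
    by (simp only: mult.assoc)
  moreover have "exp (- \<mu> * t) * exp (\<mu> * t) = 1" by (simp flip: exp_add)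
  moreover have "exp (- \<mu> * t) * exp (\<mu> * s) = exp (- \<mu> * (t - s))"
    by (simp add: algebra_simps flip: exp_add)
  ultimately have "1 * (f t - c / \<mu>) \<le> exp (- \<mu> * (t - s)) * (f s - c / \<mu>)"
    by (simp only:)
  then show ?thesis by simp
qed

text \<open>The deviation from the equilibrium \<open>c / \<mu>\<close> at the time from which the
  inequality holds is forgotten exponentially, so every level above the equilibrium is finally
  undercut.\<close>

lemma dini_comparison_eventually:
  assumes ac: "locally_abs_continuous f" and "\<mu> > 0"
    and dini: "eventually (\<lambda>\<tau>. dini_le f \<tau> (c - \<mu> * f \<tau>)) ess_at_top" and l: "c / \<mu> < l"
  shows "eventually (\<lambda>t. f t < l) at_top"
proof -
  obtain T where T: "AE t in lebesgue. t \<ge> T \<longrightarrow> dini_le f t (c - \<mu> * f t)"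
    using dini unfolding eventually_ess_at_top by blast
  define s where "s = max T 0"
  have bound: "f t \<le> c / \<mu> + exp (- \<mu> * (t - s)) * (f s - c / \<mu>)" if "t \<ge> s" for t
  proof (rule dini_comparison[OF ac \<open>\<mu> > 0\<close> _ that])
    show "AE \<tau> in lebesgue. s \<le> \<tau> \<and> \<tau> < t \<longrightarrow> dini_le f \<tau> (c - \<mu> * f \<tau>)"
      using T by eventually_elim (simp add: s_def)
  qed (simp add: s_def)
  have "((\<lambda>t. c / \<mu> + exp (- \<mu> * (t - s)) * (f s - c / \<mu>)) \<longlongrightarrow> c / \<mu> + 0 * (f s - c / \<mu>)) at_top"
  proof (intro tendsto_intros)
    have "filterlim (\<lambda>t. - \<mu> * (t - s)) at_bot at_top"
      using \<open>\<mu> > 0\<close> by real_asymp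
    then show "((\<lambda>t. exp (- \<mu> * (t - s))) \<longlongrightarrow> 0) at_top"
      by (rule filterlim_compose[OF exp_at_bot])
  qed
  then have "eventually (\<lambda>t. c / \<mu> + exp (- \<mu> * (t - s)) * (f s - c / \<mu>) < l) at_top"
    by (rule order_tendstoD) (use l in simp)
  then show ?thesis
    using eventually_ge_at_top[of s]
  proof eventually_elim
    case (elim t)
    then show ?case using bound[of t] by simp
  qed
qed

section \<open>The feedback gains\<close>

lemma amgm_weighted: "0 < k \<Longrightarrow> u * v \<le> k * u\<^sup>2 + v\<^sup>2 / (4 * k)" for k u v :: real
proof -
  assume k: "0 < k"
  have "0 \<le> (2 * k * u - v)\<^sup>2 / (4 * k)" using k by simp
  also have "\<dots> = k * u\<^sup>2 - u * v + v\<^sup>2 / (4 * k)"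
    using k by (simp add: field_simps power2_eq_square)
  finally show ?thesis by simp
qed

text \<open>If \<open>b\<close> is small, the control dominates \<open>Y\<close> only up to a multiple of \<open>(1/b - r)\<^sup>+\<close>. Absorbing this
  defect costs \<open>Y\<^sup>2\<close>, hence the squared expressions in the lower bounds for \<open>P\<^sub>2\<close> and \<open>P\<^sub>3\<close>.\<close>
lemma gain_deficit_bound:
  fixes a b r Y :: real
  assumes "a > 0" "b > 0" "r > 0" "Y \<ge> 0"
  shows "Y \<le> b * r * (Y + Y\<^sup>2 / (4 * a)) + a / r * (b * (max (1 / b - r) 0)\<^sup>2)"
proof -
  let ?\<beta> = "max (1 / b - r) 0"
  have "1 / b \<le> r + ?\<beta>" by simp
  then have "1 \<le> b * (r + ?\<beta>)" using assms by (simp add: field_simps)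
  then have "Y \<le> b * (r + ?\<beta>) * Y" using assms(4) by (metis mult_1 mult_right_mono)
  also have "\<dots> = b * r * Y + b * (?\<beta> * Y)" by (simp add: algebra_simps)
  \<comment> \<open>The weight \<open>a / r\<close> gives the defect the prefactor it has in
    \<open>Z\<close>, and leaves \<open>r * Y^2 / (4 * a)\<close>, which fits the control term with
    its factor \<open>b * r\<close>.\<close>
  also have "?\<beta> * Y \<le> a / r * ?\<beta>\<^sup>2 + Y\<^sup>2 / (4 * (a / r))"
    using assms by (intro amgm_weighted) auto
  then have "b * (?\<beta> * Y) \<le> b * (a / r * ?\<beta>\<^sup>2 + Y\<^sup>2 / (4 * (a / r)))"
    using assms by (intro mult_left_mono) auto
  also have "b * r * Y + b * (a / r * ?\<beta>\<^sup>2 + Y\<^sup>2 / (4 * (a / r)))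
      = b * r * (Y + Y\<^sup>2 / (4 * a)) + a / r * (b * ?\<beta>\<^sup>2)"
    using assms by (simp add: field_simps)
  finally show ?thesis by simp
qed

context
  fixes a C \<kappa> f P1 P2 P3 r :: real
  assumes pos: "a > 0" "C > 0" "\<kappa> > 0" "f \<ge> 0" "r \<ge> \<kappa>"
    and P1: "P1 \<ge> 1 / (4 * a * \<kappa> ^ 6) *
        (\<kappa> + 4 * a * C + 4 * \<kappa> ^ 3 + 4 * a * \<kappa> * f + 8 * a * \<kappa>\<^sup>2)"
    and P2: "P2 \<ge> 1 / (4 * a ^ 3 * \<kappa> ^ 5) *
        (1 / (16 * \<kappa>) * (\<kappa> + 4 * a * C + 4 * \<kappa> ^ 3 + 4 * a * \<kappa> * f)\<^sup>2
         + \<kappa>\<^sup>2 + a\<^sup>2 * f\<^sup>2 + 4 * a\<^sup>2 * (\<kappa> ^ 3 + 1))"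
    and P3: "P3 \<ge> 1 / (64 * a ^ 7 * \<kappa> ^ 4) *
        ((\<kappa>\<^sup>2 + a\<^sup>2 * f\<^sup>2)\<^sup>2 + 16 * a ^ 4)"
begin

text \<open>Coefficients of \<open>y^2\<close> and \<open>y^4\<close> left by Young's inequality
  when the perturbation is estimated at \<open>r = s\<close>, with \<open>C\<close> added for the
  decay rate. Here \<open>f\<close> is the value of \<open>\<phi>\<close> at the current output. The
  bracket shared by the bounds for \<open>P1\<close> and \<open>P2\<close> is
  \<open>4 * a * quad \<kappa>\<close>.\<close>

definition "quad s = s ^ 3 / a + s * f + s / (4 * a) + C" for s
definition "quart s = s ^ 3 / (4 * a ^ 3) + s * f\<^sup>2 / (4 * a)" for s

text \<open>All monomials have degree at most three in \<open>r\<close>, so passing from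
  \<open>\<kappa>\<close> to \<open>r = x * \<kappa>\<close> with \<open>x \<ge> 1\<close> costs at
  most \<open>x ^ 3\<close>.\<close>

lemma quad_quart_bounds: "0 \<le> quad r" "quad r \<le> (r/\<kappa>) ^ 3 * quad \<kappa>" "0 \<le> quart r" "quart r \<le> (r/\<kappa>) ^ 3 * quart \<kappa>"
proof -
  define x where "x = r / \<kappa>"
  have x: "x \<ge> 1" "r = x * \<kappa>" using pos by (auto simp: x_def)
  have x3: "x ^ 3 \<ge> 1" "x ^ 3 \<ge> x"
    using x by (auto intro: one_le_power self_le_power)
  show "0 \<le> quad r" "0 \<le> quart r" using pos by (auto simp: quad_def quart_def)
  have "r ^ 3 = x ^ 3 * \<kappa> ^ 3" by (simp add: x power_mult_distrib)
  moreover have "x * (\<kappa> * f) \<le> x ^ 3 * (\<kappa> * f)" "x * (\<kappa> / (4 * a)) \<le> x ^ 3 * (\<kappa> / (4 * a))"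
    "1 * C \<le> x ^ 3 * C" "x * (\<kappa> * f\<^sup>2 / (4 * a)) \<le> x ^ 3 * (\<kappa> * f\<^sup>2 / (4 * a))"
    using x3 pos by (intro mult_right_mono; simp)+
  ultimately show "quad r \<le> (r/\<kappa>) ^ 3 * quad \<kappa>" "quart r \<le> (r/\<kappa>) ^ 3 * quart \<kappa>"
    unfolding x_def[symmetric] quad_def quart_def
    by (simp_all add: x(2) distrib_left mult.assoc)
qed

text \<open>Multiplied by \<open>\<kappa> ^ 6\<close>, the assumed lower bounds are exactly these
  inequalities at \<open>r = \<kappa>\<close>. Passing to \<open>r\<close> multiplies the left sides
  at the right by at most \<open>(r / \<kappa>) ^ 6\<close>, the extreme case being the squares of
  \<open>quad\<close> and \<open>quart\<close>, while \<open>r ^ 6\<close> scales by precisely that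
  factor.\<close>

lemma gain_bounds:
  shows "r ^ 6 * P1 \<ge> quad r + 2 * r\<^sup>2"
    and "r ^ 6 * P2 \<ge> quart r + r / a + (quad r)\<^sup>2 / (4 * a) + r ^ 4 / a"
    and "r ^ 6 * P3 \<ge> (quart r)\<^sup>2 / (4 * a) + r\<^sup>2 / (4 * a ^ 3)"
proof -
  define x where "x = r / \<kappa>"
  have x: "x \<ge> 1" "r = x * \<kappa>" using pos by (auto simp: x_def)
  have pw: "x ^ i \<le> x ^ 6" if "i \<le> 6" for i using x that by (intro power_increasing)
  have r6: "r ^ 6 * P = x ^ 6 * (\<kappa> ^ 6 * P)" for P by (simp add: x power_mult_distrib)
  have sc: "k \<ge> 0 \<Longrightarrow> i \<le> 6 \<Longrightarrow> x ^ i * k \<le> x ^ 6 * k" for i and k :: real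
    using pw by (rule mult_right_mono)
  note qb = quad_quart_bounds[folded x_def]
  have qk: "0 \<le> quad \<kappa>" "0 \<le> quart \<kappa>" using pos by (auto simp: quad_def quart_def)
  have "\<kappa> ^ 6 * (1 / (4 * a * \<kappa> ^ 6) *
        (\<kappa> + 4 * a * C + 4 * \<kappa> ^ 3 + 4 * a * \<kappa> * f + 8 * a * \<kappa>\<^sup>2)) = quad \<kappa> + 2 * \<kappa>\<^sup>2"
    using pos by (simp add: quad_def field_simps)
  then have k1: "quad \<kappa> + 2 * \<kappa>\<^sup>2 \<le> \<kappa> ^ 6 * P1"
    using mult_left_mono[OF P1, of "\<kappa> ^ 6"] pos by simp
  have q: "\<kappa> + 4 * a * C + 4 * \<kappa> ^ 3 + 4 * a * \<kappa> * f = 4 * a * quad \<kappa>"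
    using pos by (simp add: quad_def field_simps)
  have "\<kappa> ^ 6 * (1 / (4 * a ^ 3 * \<kappa> ^ 5) *
        (1 / (16 * \<kappa>) * (\<kappa> + 4 * a * C + 4 * \<kappa> ^ 3 + 4 * a * \<kappa> * f)\<^sup>2
         + \<kappa>\<^sup>2 + a\<^sup>2 * f\<^sup>2 + 4 * a\<^sup>2 * (\<kappa> ^ 3 + 1)))
      = quart \<kappa> + \<kappa> / a + (quad \<kappa>)\<^sup>2 / (4 * a) + \<kappa> ^ 4 / a"
    unfolding q unfolding quart_def using pos
    by (simp add: divide_simps) (simp add: algebra_simps power2_eq_square power3_eq_cube eval_nat_numeral)
  then have k2: "quart \<kappa> + \<kappa> / a + (quad \<kappa>)\<^sup>2 / (4 * a) + \<kappa> ^ 4 / a \<le> \<kappa> ^ 6 * P2"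
    using mult_left_mono[OF P2, of "\<kappa> ^ 6"] pos by simp
  have "\<kappa> ^ 6 * (1 / (64 * a ^ 7 * \<kappa> ^ 4) * ((\<kappa>\<^sup>2 + a\<^sup>2 * f\<^sup>2)\<^sup>2 + 16 * a ^ 4))
      = (quart \<kappa>)\<^sup>2 / (4 * a) + \<kappa>\<^sup>2 / (4 * a ^ 3)"
    unfolding quart_def using pos
    by (simp add: divide_simps) (simp add: algebra_simps power2_eq_square power3_eq_cube eval_nat_numeral)
  then have k3: "(quart \<kappa>)\<^sup>2 / (4 * a) + \<kappa>\<^sup>2 / (4 * a ^ 3) \<le> \<kappa> ^ 6 * P3"
    using mult_left_mono[OF P3, of "\<kappa> ^ 6"] pos by simp
  have sqx: "(x ^ 3 * u)\<^sup>2 = x ^ 6 * u\<^sup>2" for u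
    by (simp add: power_mult_distrib flip: power_mult)
  have quad2: "(quad r)\<^sup>2 / (4 * a) \<le> x ^ 6 * ((quad \<kappa>)\<^sup>2 / (4 * a))"
    using power_mono[OF qb(2,1), of 2] pos by (simp add: sqx divide_right_mono)
  have quart2: "(quart r)\<^sup>2 / (4 * a) \<le> x ^ 6 * ((quart \<kappa>)\<^sup>2 / (4 * a))"
    using power_mono[OF qb(4,3), of 2] pos by (simp add: sqx divide_right_mono)
  have "quad r + 2 * r\<^sup>2 \<le> x ^ 6 * quad \<kappa> + x ^ 6 * (2 * \<kappa>\<^sup>2)"
    using qb(2) sc[of "quad \<kappa>" 3] sc[of "2 * \<kappa>\<^sup>2" 2] qk by (simp add: x(2) power_mult_distrib)
  also have "\<dots> \<le> r ^ 6 * P1"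
    using mult_left_mono[OF k1, of "x ^ 6"] x(1) by (simp add: r6 distrib_left)
  finally show "r ^ 6 * P1 \<ge> quad r + 2 * r\<^sup>2" .
  have "quart r + r / a + (quad r)\<^sup>2 / (4 * a) + r ^ 4 / a
      \<le> x ^ 6 * quart \<kappa> + x ^ 6 * (\<kappa> / a) + x ^ 6 * ((quad \<kappa>)\<^sup>2 / (4 * a)) + x ^ 6 * (\<kappa> ^ 4 / a)"
    using qb(4) sc[of "quart \<kappa>" 3] sc[of "\<kappa> / a" 1] sc[of "\<kappa> ^ 4 / a" 4] quad2 qk pos
    by (simp add: x(2) power_mult_distrib)
  also have "\<dots> \<le> r ^ 6 * P2"
    using mult_left_mono[OF k2, of "x ^ 6"] x(1) by (simp add: r6 distrib_left)
  finally show "r ^ 6 * P2 \<ge> quart r + r / a + (quad r)\<^sup>2 / (4 * a) + r ^ 4 / a" .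
  have "(quart r)\<^sup>2 / (4 * a) + r\<^sup>2 / (4 * a ^ 3)
      \<le> x ^ 6 * ((quart \<kappa>)\<^sup>2 / (4 * a)) + x ^ 6 * (\<kappa>\<^sup>2 / (4 * a ^ 3))"
    using quart2 sc[of "\<kappa>\<^sup>2 / (4 * a ^ 3)" 2] pos
    by (simp add: x(2) power_mult_distrib)
  also have "\<dots> \<le> r ^ 6 * P3"
    using mult_left_mono[OF k3, of "x ^ 6"] x(1) by (simp add: r6 distrib_left)
  finally show "r ^ 6 * P3 \<ge> (quart r)\<^sup>2 / (4 * a) + r\<^sup>2 / (4 * a ^ 3)" .
qed

text \<open>With \<open>norm \<theta> \<le> r + \<sigma>\<close> the product splits into five terms.
  Except for \<open>r * f * y^2\<close>, each is treated by Young's inequality with a weight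
  proportional to \<open>a / r\<close>, so that what \<open>y\<close> cannot absorb is damped by
  large \<open>r\<close>. The two terms containing \<open>n\<close> get \<open>a / (4 * r)\<close>
  each.\<close>

lemma perturbation_bound:
  fixes L \<theta> :: "'v::real_inner" and n y d :: real
  defines "\<sigma> \<equiv> max (norm \<theta> - r) 0"
  assumes L: "norm L \<le> n + f * \<bar>y\<bar>" and n: "n \<ge> 0"
  shows "y * (L \<bullet> \<theta> + d) \<le> (quad r - C) * y\<^sup>2 + quart r * y ^ 4
      + a / (2 * r) * n\<^sup>2 + a / r * (d\<^sup>2 + \<sigma>\<^sup>2 + \<sigma> ^ 4)"
proof -
  have r: "r > 0" using pos by simp
  have \<sigma>: "\<sigma> \<ge> 0" "norm \<theta> \<le> r + \<sigma>" by (auto simp: \<sigma>_def)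
  have "\<bar>L \<bullet> \<theta>\<bar> \<le> (n + f * \<bar>y\<bar>) * (r + \<sigma>)"
    using Cauchy_Schwarz_ineq2[of L \<theta>] mult_mono[OF L \<sigma>(2)] n pos by simp
  then have "\<bar>y\<bar> * (\<bar>L \<bullet> \<theta>\<bar> + \<bar>d\<bar>) \<le> \<bar>y\<bar> * ((n + f * \<bar>y\<bar>) * (r + \<sigma>) + \<bar>d\<bar>)"
    by (intro mult_left_mono) auto
  moreover have "y * (L \<bullet> \<theta> + d) \<le> \<bar>y\<bar> * (\<bar>L \<bullet> \<theta>\<bar> + \<bar>d\<bar>)"
  proof -
    have "y * (L \<bullet> \<theta> + d) \<le> \<bar>y\<bar> * \<bar>L \<bullet> \<theta> + d\<bar>" by (simp flip: abs_mult)
    also have "\<dots> \<le> \<bar>y\<bar> * (\<bar>L \<bullet> \<theta>\<bar> + \<bar>d\<bar>)" by (intro mult_left_mono) auto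
    finally show ?thesis .
  qed
  moreover have "\<bar>y\<bar> * ((n + f * \<bar>y\<bar>) * (r + \<sigma>) + \<bar>d\<bar>)
      = n * (r * \<bar>y\<bar>) + n * (\<sigma> * \<bar>y\<bar>) + r * f * y\<^sup>2 + \<sigma> * (f * y\<^sup>2) + \<bar>d\<bar> * \<bar>y\<bar>"
    by (simp add: algebra_simps power2_eq_square)
  moreover have "n * (r * \<bar>y\<bar>) \<le> a / (4 * r) * n\<^sup>2 + r ^ 3 / a * y\<^sup>2"
    using amgm_weighted[of "a / (4 * r)" n "r * \<bar>y\<bar>"] pos(1) r
    by (simp add: power_mult_distrib power2_eq_square power3_eq_cube mult_ac)
  moreover have "n * (\<sigma> * \<bar>y\<bar>) \<le> a / (4 * r) * n\<^sup>2 + \<sigma>\<^sup>2 * (r / a * y\<^sup>2)"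
    using amgm_weighted[of "a / (4 * r)" n "\<sigma> * \<bar>y\<bar>"] pos(1) r
    by (simp add: power_mult_distrib power2_eq_square power3_eq_cube mult_ac)
  \<comment> \<open>A second use of Young's inequality separates the mixed term left by
    \<open>n * (\<sigma> * \<bar>y\<bar>)\<close>; this is where \<open>\<sigma> ^ 4\<close>, hence
    the square of \<open>g\<close>, comes from.\<close>
  moreover have "\<sigma>\<^sup>2 * (r / a * y\<^sup>2) \<le> a / r * \<sigma> ^ 4 + r ^ 3 / (4 * a ^ 3) * y ^ 4"
    using amgm_weighted[of "a / r" "\<sigma>\<^sup>2" "r / a * y\<^sup>2"] pos(1) r
    by (simp add: power_mult_distrib power_divide power2_eq_square power3_eq_cube power4_eq_xxxx mult_ac)
  moreover have "\<sigma> * (f * y\<^sup>2) \<le> a / r * \<sigma>\<^sup>2 + r * f\<^sup>2 / (4 * a) * y ^ 4"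
    using amgm_weighted[of "a / r" \<sigma> "f * y\<^sup>2"] pos(1) r
    by (simp add: power_mult_distrib power_divide power2_eq_square power4_eq_xxxx mult_ac)
  moreover have "\<bar>d\<bar> * \<bar>y\<bar> \<le> a / r * d\<^sup>2 + r / (4 * a) * y\<^sup>2"
    using amgm_weighted[of "a / r" "\<bar>d\<bar>" "\<bar>y\<bar>"] pos(1) r
    by (simp add: mult_ac)
  moreover have "a / (2 * r) * n\<^sup>2 = a / (4 * r) * n\<^sup>2 + a / (4 * r) * n\<^sup>2"
    using r by (simp add: field_simps)
  moreover have "(quad r - C) * y\<^sup>2 = r ^ 3 / a * y\<^sup>2 + r * f * y\<^sup>2 + r / (4 * a) * y\<^sup>2"
    by (simp add: quad_def distrib_right)
  moreover have "quart r * y ^ 4 = r ^ 3 / (4 * a ^ 3) * y ^ 4 + r * f\<^sup>2 / (4 * a) * y ^ 4"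
    by (simp add: quart_def distrib_right)
  moreover have "a / r * (d\<^sup>2 + \<sigma>\<^sup>2 + \<sigma> ^ 4) = a / r * d\<^sup>2 + a / r * \<sigma>\<^sup>2 + a / r * \<sigma> ^ 4"
    by (simp add: distrib_left)
  ultimately show ?thesis by linarith
qed

text \<open>\<open>?Y1\<close> and \<open>?Y2\<close> absorb the perturbation, while
  \<open>?Y3\<close> and \<open>?Y4\<close> are a reserve for the gain from \<open>y\<close> to
  \<open>w\<close>. The defect estimate is applied to each separately, so the weaker bound pays for
  two defects and the stronger one for four.\<close>

lemma control_power_bounds:
  fixes L \<theta> :: "'v::real_inner" and n y d b :: real
  defines "\<sigma> \<equiv> max (norm \<theta> - r) 0" and "\<beta> \<equiv> b * (max (1 / b - r) 0)\<^sup>2"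
  assumes L: "norm L \<le> n + f * \<bar>y\<bar>" and n: "n \<ge> 0" and b: "b > 0"
  shows "y * (b * (- (r ^ 7 * (P1 + P2 * y\<^sup>2 + P3 * y ^ 6) * y)) + L \<bullet> \<theta> + d)
      \<le> - C * y\<^sup>2 + a / (2 * r) * n\<^sup>2 + a / r * (d\<^sup>2 + \<sigma>\<^sup>2 + \<sigma> ^ 4 + 2 * \<beta>)" (is "?l \<le> ?weak")
    and "y * (b * (- (r ^ 7 * (P1 + P2 * y\<^sup>2 + P3 * y ^ 6) * y)) + L \<bullet> \<theta> + d)
      \<le> - C * y\<^sup>2 - 2 * r\<^sup>2 * y\<^sup>2 - r / a * y ^ 4
        + a / (2 * r) * n\<^sup>2 + a / r * (d\<^sup>2 + \<sigma>\<^sup>2 + \<sigma> ^ 4 + 4 * \<beta>)"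
proof -
  have r: "r > 0" using pos by simp
  let ?X = "r ^ 6 * P1 * y\<^sup>2 + r ^ 6 * P2 * y ^ 4 + r ^ 6 * P3 * y ^ 8"
  let ?Y1 = "quad r * y\<^sup>2" and ?Y2 = "quart r * y ^ 4" and ?Y3 = "2 * r\<^sup>2 * y\<^sup>2" and ?Y4 = "r / a * y ^ 4"
  let ?h = "\<lambda>Y. Y + Y\<^sup>2 / (4 * a)"
  have h0: "?h Y \<ge> 0" if "Y \<ge> 0" for Y using that pos by simp
  have Y0: "?Y1 \<ge> 0" "?Y2 \<ge> 0" "?Y3 \<ge> 0" "?Y4 \<ge> 0"
    using quad_quart_bounds pos r by auto
  have "(quad r + 2 * r\<^sup>2) * y\<^sup>2 + (quart r + r / a + (quad r)\<^sup>2 / (4 * a) + r ^ 4 / a) * y ^ 4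
      + ((quart r)\<^sup>2 / (4 * a) + r\<^sup>2 / (4 * a ^ 3)) * y ^ 8 \<le> ?X"
    using gain_bounds by (intro add_mono mult_right_mono) auto
  \<comment> \<open>Sorting the four terms and their squares by powers of \<open>y\<close> gives the
    coefficients required of \<open>r ^ 6 * P1\<close>, \<open>r ^ 6 * P2\<close> and
    \<open>r ^ 6 * P3\<close>.\<close>
  moreover have "?h ?Y1 + ?h ?Y2 + ?h ?Y3 + ?h ?Y4
      = (quad r + 2 * r\<^sup>2) * y\<^sup>2 + (quart r + r / a + (quad r)\<^sup>2 / (4 * a) + r ^ 4 / a) * y ^ 4
        + ((quart r)\<^sup>2 / (4 * a) + r\<^sup>2 / (4 * a ^ 3)) * y ^ 8"
  proof -
    have "?Y1\<^sup>2 / (4 * a) = (quad r)\<^sup>2 / (4 * a) * y ^ 4" "?Y2\<^sup>2 / (4 * a) = (quart r)\<^sup>2 / (4 * a) * y ^ 8"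
      "?Y3\<^sup>2 / (4 * a) = r ^ 4 / a * y ^ 4" "?Y4\<^sup>2 / (4 * a) = r\<^sup>2 / (4 * a ^ 3) * y ^ 8"
      using pos by (simp_all add: power_mult_distrib power_divide field_simps eval_nat_numeral)
    then show ?thesis by (simp only: distrib_right)
  qed
  ultimately have hX: "?h ?Y1 + ?h ?Y2 + ?h ?Y3 + ?h ?Y4 \<le> ?X" by simp
  have br: "b * r \<ge> 0" using b r by simp
  have gd: "Y \<le> b * r * ?h Y + a / r * \<beta>" if "Y \<ge> 0" for Y
    using gain_deficit_bound[OF pos(1) b r that] unfolding \<beta>_def by simp
  have "y * (b * (- (r ^ 7 * (P1 + P2 * y\<^sup>2 + P3 * y ^ 6) * y)) + L \<bullet> \<theta> + d)
      = - (b * r * ?X) + y * (L \<bullet> \<theta> + d)"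
    by (simp add: algebra_simps eval_nat_numeral)
  also have "\<dots> \<le> - (b * r * ?X) + (?Y1 + ?Y2 - C * y\<^sup>2 + a / (2 * r) * n\<^sup>2 + a / r * (d\<^sup>2 + \<sigma>\<^sup>2 + \<sigma> ^ 4))"
    using perturbation_bound[OF L n, of \<theta> d] unfolding \<sigma>_def by (simp add: left_diff_distrib)
  finally have main: "?l \<le> \<dots>" .
  define W k1 k2 where "W = b * r * ?X" and "k1 = a / r * \<beta>" and "k2 = a / r * (d\<^sup>2 + \<sigma>\<^sup>2 + \<sigma> ^ 4)"
  define H where "H Y = b * r * ?h Y" for Y
  have gd': "Y \<le> H Y + k1" if "Y \<ge> 0" for Y using gd[OF that] by (simp only: H_def k1_def)
  \<comment> \<open>The nonnegative contributions of \<open>?Y3\<close> and \<open>?Y4\<close> are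
    dropped before the defect estimate, so they cost no defect here.\<close>
  have "H ?Y1 + H ?Y2 \<le> W"
    unfolding H_def W_def distrib_left[symmetric, of "b * r"]
    using hX h0[OF Y0(3)] h0[OF Y0(4)] by (intro mult_left_mono[OF _ br]) linarith
  then have "?Y1 + ?Y2 \<le> W + 2 * k1"
    using gd'[OF Y0(1)] gd'[OF Y0(2)] by linarith
  moreover have "a / r * (d\<^sup>2 + \<sigma>\<^sup>2 + \<sigma> ^ 4 + 2 * \<beta>) = k2 + 2 * k1"
    by (simp only: distrib_left mult.left_commute k1_def k2_def)
  ultimately show "?l \<le> ?weak"
    using main unfolding W_def[symmetric] k2_def[symmetric] by linarith
  have "H ?Y1 + H ?Y2 + H ?Y3 + H ?Y4 \<le> W"
    unfolding H_def W_def distrib_left[symmetric, of "b * r"] using hX by (rule mult_left_mono[OF _ br])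
  then have "?Y1 + ?Y2 + ?Y3 + ?Y4 \<le> W + 4 * k1"
    using gd'[OF Y0(1)] gd'[OF Y0(2)] gd'[OF Y0(3)] gd'[OF Y0(4)] by linarith
  moreover have "a / r * (d\<^sup>2 + \<sigma>\<^sup>2 + \<sigma> ^ 4 + 4 * \<beta>) = k2 + 4 * k1"
    by (simp only: distrib_left mult.left_commute k1_def k2_def)
  ultimately show "?l \<le> - C * y\<^sup>2 - 2 * r\<^sup>2 * y\<^sup>2 - r / a * y ^ 4
        + a / (2 * r) * n\<^sup>2 + a / r * (d\<^sup>2 + \<sigma>\<^sup>2 + \<sigma> ^ 4 + 4 * \<beta>)"
    using main unfolding W_def[symmetric] k2_def[symmetric] by linarith
qed

end

section \<open>Energy estimates for the closed loop\<close>

lemma g_mono: "s \<le> s' \<Longrightarrow> l' \<le> l \<Longrightarrow> g \<kappa> s l \<le> g \<kappa> s' l'"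
  unfolding g_def
proof (intro power_mono)
  assume "s \<le> s'" "l' \<le> l"
  moreover from this have "exp l' \<le> exp l" by simp
  ultimately show "max (s - \<kappa> - exp l) 0 \<le> max (s' - \<kappa> - exp l') 0"
    by (intro max.mono order_refl) linarith
qed simp

lemma g_nonneg [simp]: "g \<kappa> s l \<ge> 0"
  by (simp add: g_def)

text \<open>Monotonicity of \<open>g\<close> alone does not decide, as the factor \<open>b\<close>
  grows. With the positive part active, the expression equals
  \<open>(1 - b * (\<kappa> + exp l))^2 / b\<close>, whose base and denominator both move in the
  favourable direction.\<close>

lemma gain_deficit_mono:
  assumes b: "0 < b0" "b0 \<le> b" and l: "l0 \<le> l" and "\<kappa> > 0"
  shows "b * g \<kappa> (1 / b) l \<le> b0 * g \<kappa> (1 / b0) l0"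
proof (cases "1 / b \<le> \<kappa> + exp l")
  case True
  then have "g \<kappa> (1 / b) l = 0" by (simp add: g_def max_def)
  then show ?thesis using b by simp
next
  case False
  have exps: "exp l0 \<le> exp l" using l by simp
  have inv: "1 / b \<le> 1 / b0" using b by (simp add: frac_le)
  have eq: "c * (1 / c - \<kappa> - exp k)\<^sup>2 = (1 - c * (\<kappa> + exp k))\<^sup>2 / c" if "c > 0" for c k
    using that by (simp add: field_simps power2_eq_square)
  have "b * g \<kappa> (1 / b) l = (1 - b * (\<kappa> + exp l))\<^sup>2 / b"
    using False b eq[of b l] by (simp add: g_def max_def)
  also have "\<dots> \<le> (1 - b0 * (\<kappa> + exp l0))\<^sup>2 / b0"
  proof (rule frac_le)
    have "1 - b * (\<kappa> + exp l) \<ge> 0" using False b by (simp add: field_simps)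
    moreover have "b0 * (\<kappa> + exp l0) \<le> b * (\<kappa> + exp l)"
      using b exps assms(4) by (intro mult_mono) (auto simp: add_nonneg_nonneg)
    ultimately show "(1 - b * (\<kappa> + exp l))\<^sup>2 \<le> (1 - b0 * (\<kappa> + exp l0))\<^sup>2"
      by (intro power_mono) auto
  qed (use b in auto)
  also have "\<dots> = b0 * g \<kappa> (1 / b0) l0"
  proof -
    have "1 / b0 - \<kappa> - exp l0 > 0" using False inv exps by linarith
    then have "g \<kappa> (1 / b0) l0 = (1 / b0 - \<kappa> - exp l0)\<^sup>2" by (simp only: g_def max_def) simp
    then show ?thesis using eq[of b0 l0] b by simp
  qed
  finally show ?thesis .
qed

text \<open>Here \<open>p\<close> and \<open>n\<close> stand for \<open>\<Phi>(w)\<close> and \<open>\<parallel>w\<parallel>\<close>, and \<open>t1\<close>, \<open>t2\<close>, \<open>e\<close> for the norms of \<open>\<theta>\<^sub>1\<close>, \<open>\<theta>\<^sub>2\<close>,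
  \<open>\<delta>\<close>. Of the two bounds for \<open>y y'\<close>, the first serves for \<open>v = y\<^sup>2/2\<close> alone; the second keeps the
  negative terms that compensate the gain \<open>R\<^sup>2 \<parallel>\<theta>\<^sub>1\<parallel>\<^sup>2 y\<^sup>2\<close> of \<open>\<Phi>(w)\<close>.\<close>
locale closed_loop =
  fixes p n y z t1 t2 d b e :: "real \<Rightarrow> real" and K1 K2 G R \<epsilon> \<Gamma> \<kappa> a C :: real
  assumes constants: "K1 > 0" "K2 > 0" "G > 0" "R > 0" "\<epsilon> > 0" "\<Gamma> > 0" "\<kappa> > 0" "a > 0" "C > 0"
      "2 * \<kappa> > a"
    and p_ac: "locally_abs_continuous p" and y_ac: "locally_abs_continuous y"
    and z_ac: "locally_abs_continuous z"
    and p_lower: "K1 * (n t)\<^sup>2 \<le> p t" and p_upper: "p t \<le> K2 * (n t)\<^sup>2"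
    and nonneg: "n t \<ge> 0" "t1 t \<ge> 0" "t2 t \<ge> 0" "e t \<ge> 0"
    and p_dini: "AE t in lebesgue. t \<ge> 0 \<longrightarrow>
        dini_le p t (- (n t)\<^sup>2 + R\<^sup>2 * (t1 t)\<^sup>2 * (y t)\<^sup>2 + G * (e t)\<^sup>2)"
    and y_deriv: "AE t in lebesgue. t \<ge> 0 \<longrightarrow>
        (\<exists>y'. (y has_real_derivative y') (at t within {0..}) \<and>
          y t * y' \<le> - C * (y t)\<^sup>2 + a / (2 * (\<kappa> + exp (z t))) * (n t)\<^sup>2
            + a / (\<kappa> + exp (z t)) * ((d t)\<^sup>2 + g \<kappa> (t2 t) (z t) + (g \<kappa> (t2 t) (z t))\<^sup>2
                + 2 * (b t * g \<kappa> (1 / b t) (z t))) \<and>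
          y t * y' \<le> - C * (y t)\<^sup>2 - 2 * (\<kappa> + exp (z t))\<^sup>2 * (y t)\<^sup>2 - (\<kappa> + exp (z t)) / a * (y t) ^ 4
            + a / (2 * (\<kappa> + exp (z t))) * (n t)\<^sup>2
            + a / (\<kappa> + exp (z t)) * ((d t)\<^sup>2 + g \<kappa> (t2 t) (z t) + (g \<kappa> (t2 t) (z t))\<^sup>2
                + 4 * (b t * g \<kappa> (1 / b t) (z t))))"
    and z_deriv: "AE t in lebesgue. t \<ge> 0 \<longrightarrow>
        (z has_real_derivative \<Gamma> * exp (- z t) * max ((y t)\<^sup>2 / 2 - \<epsilon>) 0) (at t within {0..})"
begin

section \<open>The energy and its differential inequality\<close>

definition "\<mu> = min ((2 * \<kappa> - a) / (2 * \<kappa> * K2)) (2 * C)"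
definition "v t = (y t)\<^sup>2 / 2"
definition "U t = p t + v t"
text \<open>The forcing of the energy at time \<open>t\<close>, of which \<open>Z\<close> is the
  worst case. The time-dependent form is kept because the final convergence rests on
  \<open>load\<close> tending to zero.\<close>

definition "load t = G * (e t)\<^sup>2 + a / (\<kappa> + exp (z t)) *
   ((d t)\<^sup>2 + g \<kappa> (t2 t) (z t) + (g \<kappa> (t2 t) (z t))\<^sup>2 + 4 * (b t * g \<kappa> (1 / b t) (z t))
     + (g \<kappa> (R * t1 t) (z t))\<^sup>2)"

lemma \<mu>_pos: "\<mu> > 0"
  using constants by (simp add: \<mu>_def)

lemma r_pos: "\<kappa> + exp l > 0"
  using constants by (simp add: add_pos_pos)

lemma v_nonneg: "v t \<ge> 0"
  by (simp add: v_def)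

lemma v_ac: "locally_abs_continuous v"
  unfolding locally_abs_continuous_def
proof (intro allI impI)
  fix T :: real
  have "abs_continuous_on_interval 0 T y"
    using y_ac by (rule locally_abs_continuousD) simp
  then have "abs_continuous_on_interval 0 T (\<lambda>t. (1/2) * (y t * y t))"
    by (intro abs_continuous_on_interval_cmult abs_continuous_on_interval_mult)
  then show "abs_continuous_on_interval 0 T v"
    by (simp add: v_def[abs_def] power2_eq_square)
qed

lemma U_ac: "locally_abs_continuous U"
  using p_ac v_ac unfolding U_def[abs_def] locally_abs_continuous_def
  by (auto intro: abs_continuous_on_interval_add)

lemma v_deriv: "(y has_real_derivative y') (at t within A) \<Longrightarrow> (v has_real_derivative y t * y') (at t within A)"
  unfolding v_def[abs_def] by (auto intro!: derivative_eq_intros)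

text \<open>With \<open>m\<close> the excess of \<open>R * s\<close> over \<open>r\<close>, one has
  \<open>(r + m)^2 \<le> 2 * r^2 + 2 * m^2\<close>; Young's inequality with weight
  \<open>a / r\<close> then separates \<open>m^2\<close> from \<open>w^2\<close>. The two terms in
  \<open>w\<close> are the reserve kept in the stronger bound for \<open>y y'\<close>.\<close>

lemma small_gain_term: "R\<^sup>2 * s\<^sup>2 * w\<^sup>2 \<le> 2 * (\<kappa> + exp l)\<^sup>2 * w\<^sup>2 + (\<kappa> + exp l) / a * w ^ 4
    + a / (\<kappa> + exp l) * (g \<kappa> (R * s) l)\<^sup>2" if "s \<ge> 0"
proof -
  let ?r = "\<kappa> + exp l" and ?m = "max (R * s - \<kappa> - exp l) 0"
  have "R\<^sup>2 * s\<^sup>2 \<le> (?r + ?m)\<^sup>2"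
    unfolding power_mult_distrib[symmetric] using that constants by (intro power_mono) auto
  also have "\<dots> \<le> 2 * ?r\<^sup>2 + 2 * ?m\<^sup>2"
    using sum_squares_bound[of ?r ?m] by (simp add: power2_sum)
  finally have "R\<^sup>2 * s\<^sup>2 * w\<^sup>2 \<le> (2 * ?r\<^sup>2 + 2 * g \<kappa> (R * s) l) * w\<^sup>2"
    unfolding g_def by (intro mult_right_mono) auto
  also have "\<dots> = 2 * ?r\<^sup>2 * w\<^sup>2 + g \<kappa> (R * s) l * (2 * w\<^sup>2)" by (simp add: algebra_simps)
  also have "g \<kappa> (R * s) l * (2 * w\<^sup>2) \<le> a / ?r * (g \<kappa> (R * s) l)\<^sup>2 + (2 * w\<^sup>2)\<^sup>2 / (4 * (a / ?r))"
    using constants r_pos[of l] by (intro amgm_weighted) simp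
  also have "(2 * w\<^sup>2)\<^sup>2 / (4 * (a / ?r)) = ?r / a * w ^ 4"
    using constants r_pos[of l] by (simp add: power_mult_distrib power2_eq_square power4_eq_xxxx)
  finally show ?thesis by simp
qed

lemma energy_dini: "AE t in lebesgue. t \<ge> 0 \<longrightarrow> dini_le U t (load t - \<mu> * U t)"
  using p_dini y_deriv
proof eventually_elim
  case (elim t)
  show ?case
  proof
    assume t: "t \<ge> 0"
    let ?r = "\<kappa> + exp (z t)"
    let ?D = "(d t)\<^sup>2 + g \<kappa> (t2 t) (z t) + (g \<kappa> (t2 t) (z t))\<^sup>2 + 4 * (b t * g \<kappa> (1 / b t) (z t))"
    obtain y' where y': "(y has_real_derivative y') (at t within {0..})"
      and le: "y t * y' \<le> - C * (y t)\<^sup>2 - 2 * ?r\<^sup>2 * (y t)\<^sup>2 - ?r / a * (y t) ^ 4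
        + a / (2 * ?r) * (n t)\<^sup>2 + a / ?r * ?D"
      using elim(2) t by blast
    have "dini_le v t (y t * y')"
      using v_deriv[OF y'] t by (rule dini_le_derivative)
    with elim(1) t have sum: "dini_le U t (- (n t)\<^sup>2 + R\<^sup>2 * (t1 t)\<^sup>2 * (y t)\<^sup>2 + G * (e t)\<^sup>2 + y t * y')"
      unfolding U_def[abs_def] by (intro dini_le_add) auto
    \<comment> \<open>Of the dissipation \<open>(n t)^2\<close> the output equation consumes
      \<open>a / (2 * r)\<close>. At least \<open>1 - a / (2 * \<kappa>)\<close> remains, which is
      positive by \<open>2 * \<kappa> > a\<close>; dividing by \<open>K2\<close> gives the first
      entry of \<open>\<mu>\<close>.\<close>
    have "\<mu> * p t \<le> (1 - a / (2 * ?r)) * (n t)\<^sup>2"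
    proof -
      have "\<mu> * p t \<le> \<mu> * (K2 * (n t)\<^sup>2)"
        using p_upper \<mu>_pos by (intro mult_left_mono) auto
      also have "\<dots> = (\<mu> * K2) * (n t)\<^sup>2" by simp
      also have "\<dots> \<le> (1 - a / (2 * ?r)) * (n t)\<^sup>2"
      proof (rule mult_right_mono)
        have "\<mu> * K2 \<le> (2 * \<kappa> - a) / (2 * \<kappa> * K2) * K2"
          using constants by (intro mult_right_mono) (auto simp: \<mu>_def)
        also have "\<dots> = 1 - a / (2 * \<kappa>)" using constants by (simp add: field_simps)
        also have "\<dots> \<le> 1 - a / (2 * ?r)"
          using constants by (intro diff_left_mono frac_le) auto
        finally show "\<mu> * K2 \<le> 1 - a / (2 * ?r)" .
      qed simp
      finally show ?thesis .
    qed
    moreover have "\<mu> * v t \<le> C * (y t)\<^sup>2"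
    proof -
      have "\<mu> * v t \<le> (2 * C) * v t" by (intro mult_right_mono v_nonneg) (simp add: \<mu>_def)
      then show ?thesis by (simp add: v_def)
    qed
    moreover have "load t = G * (e t)\<^sup>2 + a / ?r * ?D + a / ?r * (g \<kappa> (R * t1 t) (z t))\<^sup>2"
      unfolding load_def by (simp only: distrib_left add.assoc)
    ultimately have "- (n t)\<^sup>2 + R\<^sup>2 * (t1 t)\<^sup>2 * (y t)\<^sup>2 + G * (e t)\<^sup>2 + y t * y' \<le> load t - \<mu> * U t"
      using le small_gain_term[of "t1 t" "y t" "z t", OF nonneg(2)]
      unfolding U_def distrib_left left_diff_distrib mult_1 by linarith
    with sum show "dini_le U t (load t - \<mu> * U t)" by (rule dini_le_mono)
  qed
qed

section \<open>Growth of the adaptive gain\<close>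

lemma z_mono: "0 \<le> s \<Longrightarrow> s \<le> t \<Longrightarrow> z s \<le> z t"
proof -
  assume st: "0 \<le> s" "s \<le> t"
  have "(-1) * z t \<le> (-1) * z s"
  proof (rule abs_continuous_nonincreasing[where f = "\<lambda>t. (-1) * z t"])
    show "abs_continuous_on_interval s t (\<lambda>t. (-1) * z t)"
      using z_ac st by (intro abs_continuous_on_interval_cmult locally_abs_continuousD)
    show "AE \<tau> in lebesgue. s \<le> \<tau> \<and> \<tau> < t \<longrightarrow> dini_le (\<lambda>t. (-1) * z t) \<tau> 0"
      using z_deriv
    proof eventually_elim
      case (elim \<tau>)
      show ?case
      proof
        assume \<tau>: "s \<le> \<tau> \<and> \<tau> < t"
        with elim st have "((\<lambda>t. (-1) * z t) has_real_derivative
            (-1) * (\<Gamma> * exp (- z \<tau>) * max ((y \<tau>)\<^sup>2 / 2 - \<epsilon>) 0)) (at \<tau> within {0..})"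
          by (intro DERIV_cmult) auto
        then have "dini_le (\<lambda>t. (-1) * z t) \<tau> ((-1) * (\<Gamma> * exp (- z \<tau>) * max ((y \<tau>)\<^sup>2 / 2 - \<epsilon>) 0))"
          using \<tau> st by (intro dini_le_derivative) auto
        then show "dini_le (\<lambda>t. (-1) * z t) \<tau> 0"
          by (rule dini_le_mono) (use constants in simp)
      qed
    qed
  qed (use st in simp)
  then show ?thesis by simp
qed

definition "\<zeta> t = exp (z t)"

lemma \<zeta>_ac: "locally_abs_continuous \<zeta>"
  unfolding locally_abs_continuous_def
proof (intro allI impI)
  fix T :: real assume "T > 0"
  have z: "abs_continuous_on_interval 0 T z"
    using z_ac by (rule locally_abs_continuousD) simp
  show "abs_continuous_on_interval 0 T \<zeta>"
  proof (rule abs_continuous_on_interval_dominated[OF z z])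
    fix s t assume st: "0 \<le> s" "s \<le> t" "t \<le> T"
    have "z s \<le> z t" "z t \<le> z T" using st by (auto intro: z_mono)
    \<comment> \<open>Monotonicity of \<open>z\<close> keeps all values below \<open>z T\<close>,
      where \<open>exp\<close> is Lipschitz with constant \<open>exp (z T)\<close>.\<close>
    have "norm (exp (z t) - exp (z s)) \<le> exp (z T) * norm (z t - z s)"
    proof (rule field_differentiable_bound[where S = "{..z T}" and f' = exp])
      show "(exp has_field_derivative exp x) (at x within {..z T})" for x
        by (auto intro!: derivative_eq_intros)
    qed (use \<open>z s \<le> z t\<close> \<open>z t \<le> z T\<close> in auto)
    then show "\<bar>\<zeta> t - \<zeta> s\<bar> \<le> exp (z T) * \<bar>z t - z s\<bar> + exp (z T) * \<bar>z t - z s\<bar>"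
      unfolding \<zeta>_def by simp
  qed
qed

lemma \<zeta>_deriv: "AE t in lebesgue. t \<ge> 0 \<longrightarrow>
    (\<zeta> has_real_derivative \<Gamma> * max (v t - \<epsilon>) 0) (at t within {0..})"
  using z_deriv
proof eventually_elim
  case (elim t)
  show ?case
  proof
    assume "t \<ge> 0"
    with elim have "(\<zeta> has_real_derivative
        exp (z t) * (\<Gamma> * exp (- z t) * max ((y t)\<^sup>2 / 2 - \<epsilon>) 0)) (at t within {0..})"
      unfolding \<zeta>_def[abs_def] by (auto intro!: derivative_eq_intros)
    moreover have "exp (z t) * (\<Gamma> * exp (- z t) * M) = (exp (z t) * exp (- z t)) * (\<Gamma> * M)" for M
      by (simp only: mult_ac)
    moreover have "exp (z t) * exp (- z t) = 1" by (simp flip: exp_add)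
    ultimately show "(\<zeta> has_real_derivative \<Gamma> * max (v t - \<epsilon>) 0) (at t within {0..})"
      by (simp only: v_def mult_1)
  qed
qed

lemma \<zeta>_mono: "0 \<le> s \<Longrightarrow> s \<le> t \<Longrightarrow> \<zeta> s \<le> \<zeta> t"
  by (simp add: \<zeta>_def z_mono)

lemma \<zeta>_pos: "\<zeta> t > 0"
  by (simp add: \<zeta>_def)

section \<open>Explicit estimates from essential bounds on the inputs\<close>

context
  fixes N1 N2 Nd Ne b0 :: real
  assumes input_bounds: "AE t in lebesgue. t \<ge> 0 \<longrightarrow>
      t1 t \<le> N1 \<and> t2 t \<le> N2 \<and> \<bar>d t\<bar> \<le> Nd \<and> e t \<le> Ne \<and> b0 \<le> b t"
    and b0_pos: "b0 > 0"
begin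

definition "Z = G * Ne\<^sup>2
    + a / (\<kappa> + exp (z 0)) * (Nd\<^sup>2 + g \<kappa> N2 (z 0) + (g \<kappa> N2 (z 0))\<^sup>2)
    + a / (\<kappa> + exp (z 0)) * (4 * b0 * g \<kappa> (1 / b0) (z 0) + (g \<kappa> (R * N1) (z 0))\<^sup>2)"

text \<open>Apart from the factor \<open>a / (\<kappa> + \<zeta> t)\<close>, this bounds the whole
  forcing of \<open>v\<close>. The first summand bounds \<open>(n t)^2 / 2\<close>, obtained from
  the energy estimate by replacing the exponential by one; the others bound \<open>d\<close>, the
  excess of \<open>\<theta>\<^sub>2\<close> and two defects.\<close>

definition "B = 1 / (2 * K1) * (K2 * (n 0)\<^sup>2 + 1 / 2 * \<bar>y 0\<bar>\<^sup>2 + 1 / \<mu> * Z)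
    + g \<kappa> N2 (z 0) + Nd\<^sup>2 + (g \<kappa> N2 (z 0))\<^sup>2 + 2 * b0 * g \<kappa> (1 / b0) (z 0)"

lemma Z_nonneg: "Z \<ge> 0"
  unfolding Z_def using constants b0_pos r_pos[of "z 0"]
  by (intro add_nonneg_nonneg mult_nonneg_nonneg) auto

lemma B_nonneg: "B \<ge> 0"
  unfolding B_def using constants b0_pos Z_nonneg \<mu>_pos
  by (intro add_nonneg_nonneg mult_nonneg_nonneg) auto

text \<open>Along solutions \<open>z\<close> only grows and no term of \<open>load\<close> increases
  with \<open>z\<close>, so \<open>z 0\<close> is the worst case.\<close>

lemma load_le: "AE t in lebesgue. t \<ge> 0 \<longrightarrow> load t \<le> Z"
  using input_bounds
proof eventually_elim
  case (elim t)
  show ?case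
  proof
    assume t: "t \<ge> 0"
    have z: "z 0 \<le> z t" using t by (intro z_mono) auto
    note bd = elim[rule_format, OF t]
    have "(e t)\<^sup>2 \<le> Ne\<^sup>2" using bd nonneg by (intro power_mono) auto
    moreover have "(d t)\<^sup>2 \<le> Nd\<^sup>2" using bd power_mono[of "\<bar>d t\<bar>" Nd 2] by simp
    moreover have g2: "g \<kappa> (t2 t) (z t) \<le> g \<kappa> N2 (z 0)" using bd z by (intro g_mono) auto
    moreover have "(g \<kappa> (t2 t) (z t))\<^sup>2 \<le> (g \<kappa> N2 (z 0))\<^sup>2" using g2 by (intro power_mono) auto
    moreover have "b t * g \<kappa> (1 / b t) (z t) \<le> b0 * g \<kappa> (1 / b0) (z 0)"
      using bd z b0_pos constants by (intro gain_deficit_mono) auto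
    moreover have "(g \<kappa> (R * t1 t) (z t))\<^sup>2 \<le> (g \<kappa> (R * N1) (z 0))\<^sup>2"
      using bd z constants by (intro power_mono g_mono) auto
    moreover have "a / (\<kappa> + exp (z t)) \<le> a / (\<kappa> + exp (z 0))"
      using z constants r_pos by (intro divide_left_mono mult_pos_pos) auto
    moreover have "0 \<le> (d t)\<^sup>2 + g \<kappa> (t2 t) (z t) + (g \<kappa> (t2 t) (z t))\<^sup>2
        + 4 * (b t * g \<kappa> (1 / b t) (z t)) + (g \<kappa> (R * t1 t) (z t))\<^sup>2"
      using bd b0_pos by simp
    moreover have "0 \<le> a / (\<kappa> + exp (z 0))" "0 \<le> G" using constants r_pos[of "z 0"] by auto
    ultimately have "load t \<le> G * Ne\<^sup>2 + a / (\<kappa> + exp (z 0)) * (Nd\<^sup>2 + g \<kappa> N2 (z 0) + (g \<kappa> N2 (z 0))\<^sup>2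
        + 4 * (b0 * g \<kappa> (1 / b0) (z 0)) + (g \<kappa> (R * N1) (z 0))\<^sup>2)"
      unfolding load_def by (intro add_mono[OF mult_left_mono mult_mono]) linarith+
    also have "\<dots> = Z" by (simp add: Z_def distrib_left add_ac)
    finally show "load t \<le> Z" .
  qed
qed

lemma energy_bound:
  assumes "t \<ge> 0" shows "U t \<le> exp (- \<mu> * t) * U 0 + Z / \<mu>"
proof -
  have "U t \<le> Z / \<mu> + exp (- \<mu> * (t - 0)) * (U 0 - Z / \<mu>)"
  proof (rule dini_comparison[OF U_ac \<mu>_pos _ assms])
    show "AE \<tau> in lebesgue. 0 \<le> \<tau> \<and> \<tau> < t \<longrightarrow> dini_le U \<tau> (Z - \<mu> * U \<tau>)"
      using energy_dini load_le by eventually_elim (auto elim: dini_le_mono)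
  qed simp
  also have "\<dots> \<le> exp (- \<mu> * t) * U 0 + Z / \<mu>"
    using Z_nonneg \<mu>_pos by (simp add: right_diff_distrib)
  finally show ?thesis .
qed

lemma U0_le: "U 0 \<le> K2 * (n 0)\<^sup>2 + 1 / 2 * \<bar>y 0\<bar>\<^sup>2"
  using p_upper[of 0] by (simp add: U_def v_def)

lemma state_bound:
  assumes "t \<ge> 0"
  shows "2 * K1 * (n t)\<^sup>2 + \<bar>y t\<bar>\<^sup>2
    \<le> exp (- \<mu> * t) * (2 * K2 * (n 0)\<^sup>2 + \<bar>y 0\<bar>\<^sup>2) + 2 * (1 / \<mu>) * Z"
proof -
  have "K1 * (n t)\<^sup>2 + 1 / 2 * \<bar>y t\<bar>\<^sup>2 \<le> U t" using p_lower[of t] by (simp add: U_def v_def)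
  also note energy_bound[OF assms]
  also have "exp (- \<mu> * t) * U 0 \<le> exp (- \<mu> * t) * (K2 * (n 0)\<^sup>2 + 1 / 2 * \<bar>y 0\<bar>\<^sup>2)"
    using U0_le by (intro mult_left_mono) auto
  finally show ?thesis by (simp add: algebra_simps)
qed

lemma n_square_le:
  assumes "t \<ge> 0"
  shows "(n t)\<^sup>2 / 2 \<le> 1 / (2 * K1) * (K2 * (n 0)\<^sup>2 + 1 / 2 * \<bar>y 0\<bar>\<^sup>2 + 1 / \<mu> * Z)"
proof -
  have "K1 * (n t)\<^sup>2 \<le> U t" using p_lower[of t] v_nonneg[of t] by (simp add: U_def)
  also note energy_bound[OF assms]
  also have "exp (- \<mu> * t) * U 0 \<le> 1 * U 0"
  proof (rule mult_right_mono)
    have "0 \<le> K1 * (n 0)\<^sup>2" using constants by simp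
    then show "0 \<le> U 0" using p_lower[of 0] v_nonneg[of 0] by (simp add: U_def)
  qed (use assms \<mu>_pos in simp)
  also have "1 * U 0 \<le> K2 * (n 0)\<^sup>2 + 1 / 2 * \<bar>y 0\<bar>\<^sup>2" using U0_le by simp
  finally show ?thesis using constants by (simp add: field_simps)
qed

text \<open>The forcing caused by \<open>w\<close> is bounded through the energy, after which all of
  it carries the factor \<open>a / (\<kappa> + \<zeta> t)\<close>. A true derivative is retained,
  since the kink of the positive part of \<open>v - \<epsilon>\<close> calls for one.\<close>

lemma v_deriv_le: "AE t in lebesgue. t \<ge> 0 \<longrightarrow>
    (\<exists>v'. (v has_real_derivative v') (at t within {0..}) \<and> v' \<le> - 2 * C * v t + a * B / (\<kappa> + \<zeta> t))"
  using y_deriv input_bounds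
proof eventually_elim
  case (elim t)
  show ?case
  proof
    assume t: "t \<ge> 0"
    have z: "z 0 \<le> z t" using t by (intro z_mono) auto
    note bd = elim(2)[rule_format, OF t]
    let ?D = "(d t)\<^sup>2 + g \<kappa> (t2 t) (z t) + (g \<kappa> (t2 t) (z t))\<^sup>2 + 2 * (b t * g \<kappa> (1 / b t) (z t))"
    obtain y' where y': "(y has_real_derivative y') (at t within {0..})"
      and le: "y t * y' \<le> - C * (y t)\<^sup>2 + a / (2 * (\<kappa> + exp (z t))) * (n t)\<^sup>2 + a / (\<kappa> + exp (z t)) * ?D"
      using elim(1) t by blast
    have "(d t)\<^sup>2 \<le> Nd\<^sup>2" using bd power_mono[of "\<bar>d t\<bar>" Nd 2] by simp
    moreover have g2: "g \<kappa> (t2 t) (z t) \<le> g \<kappa> N2 (z 0)" using bd z by (intro g_mono) auto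
    moreover have "(g \<kappa> (t2 t) (z t))\<^sup>2 \<le> (g \<kappa> N2 (z 0))\<^sup>2" using g2 by (intro power_mono) auto
    moreover have "b t * g \<kappa> (1 / b t) (z t) \<le> b0 * g \<kappa> (1 / b0) (z 0)"
      using bd z b0_pos constants by (intro gain_deficit_mono) auto
    ultimately have "(n t)\<^sup>2 / 2 + ?D \<le> B"
      unfolding B_def mult.assoc[of 2 b0] using n_square_le[OF t] by linarith
    then have "a / (\<kappa> + \<zeta> t) * ((n t)\<^sup>2 / 2 + ?D) \<le> a / (\<kappa> + \<zeta> t) * B"
      using constants r_pos[of "z t"] by (intro mult_left_mono) (auto simp: \<zeta>_def)
    moreover have "a / (2 * (\<kappa> + exp (z t))) * (n t)\<^sup>2 + a / (\<kappa> + exp (z t)) * ?D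
        = a / (\<kappa> + \<zeta> t) * ((n t)\<^sup>2 / 2 + ?D)"
      by (simp only: \<zeta>_def distrib_left) simp
    moreover have "- C * (y t)\<^sup>2 = - 2 * C * v t" by (simp add: v_def)
    ultimately have "y t * y' \<le> - 2 * C * v t + a / (\<kappa> + \<zeta> t) * B"
      using le by linarith
    then have "y t * y' \<le> - 2 * C * v t + a * B / (\<kappa> + \<zeta> t)" by simp
    then show "\<exists>v'. (v has_real_derivative v') (at t within {0..}) \<and> v' \<le> - 2 * C * v t + a * B / (\<kappa> + \<zeta> t)"
      using v_deriv[OF y'] by blast
  qed
qed

lemma min_pos: "min 1 \<kappa> > 0"
  using constants by simp

text \<open>Uses \<open>\<kappa> + \<zeta> t \<ge> min 1 \<kappa> * (1 + \<zeta> t)\<close>, valid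
  on either side of \<open>\<kappa> = 1\<close>. This is the origin of \<open>min 1 \<kappa>\<close>
  and \<open>1 + exp (z 0)\<close> in the bound for \<open>z\<close>.\<close>

lemma load_B_le: "a * B / (\<kappa> + \<zeta> t) \<le> a * B / (min 1 \<kappa> * (1 + \<zeta> t))"
proof (rule divide_left_mono)
  have "min 1 \<kappa> * (1 + \<zeta> t) = min 1 \<kappa> + min 1 \<kappa> * \<zeta> t" by (simp add: distrib_left)
  also have "\<dots> \<le> \<kappa> + 1 * \<zeta> t" using \<zeta>_pos[of t] by (intro add_mono mult_right_mono) auto
  finally show "min 1 \<kappa> * (1 + \<zeta> t) \<le> \<kappa> + \<zeta> t" by simp
  show "0 \<le> a * B" using B_nonneg constants by simp
  show "0 < (\<kappa> + \<zeta> t) * (min 1 \<kappa> * (1 + \<zeta> t))"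
    using \<zeta>_pos[of t] constants min_pos by (intro mult_pos_pos) auto
qed

lemma v_bound:
  assumes "t \<ge> 0" shows "v t \<le> v 0 + a * B / (2 * C * min 1 \<kappa> * (1 + \<zeta> 0))"
proof -
  let ?c = "a * B / (min 1 \<kappa> * (1 + \<zeta> 0))"
  have c: "?c \<ge> 0" using B_nonneg constants min_pos \<zeta>_pos[of 0] by simp
  have "v t \<le> ?c / (2 * C) + exp (- (2 * C) * (t - 0)) * (v 0 - ?c / (2 * C))"
  proof (rule dini_comparison[OF v_ac _ _ assms])
    show "AE \<tau> in lebesgue. 0 \<le> \<tau> \<and> \<tau> < t \<longrightarrow> dini_le v \<tau> (?c - 2 * C * v \<tau>)"
      using v_deriv_le
    proof eventually_elim
      case (elim \<tau>)
      show ?case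
      proof
        assume \<tau>: "0 \<le> \<tau> \<and> \<tau> < t"
        with elim obtain v' where v': "(v has_real_derivative v') (at \<tau> within {0..})"
          "v' \<le> - 2 * C * v \<tau> + a * B / (\<kappa> + \<zeta> \<tau>)" by blast
        have "a * B / (min 1 \<kappa> * (1 + \<zeta> \<tau>)) \<le> ?c"
          using \<tau> \<zeta>_mono[of 0 \<tau>] \<zeta>_pos[of 0] B_nonneg constants min_pos
          by (intro divide_left_mono mult_left_mono mult_pos_pos) auto
        then have "v' \<le> ?c - 2 * C * v \<tau>" using v'(2) load_B_le[of \<tau>] by simp
        then show "dini_le v \<tau> (?c - 2 * C * v \<tau>)"
          using v'(1) \<tau> by (intro dini_le_mono[OF dini_le_derivative]) auto
      qed
    qed
  qed (use constants in auto)
  also have "\<dots> \<le> ?c / (2 * C) + v 0"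
  proof -
    have "exp (- (2 * C) * (t - 0)) * v 0 \<le> 1 * v 0"
      using assms constants v_nonneg by (intro mult_right_mono) auto
    moreover have "exp (- (2 * C) * (t - 0)) * (?c / (2 * C)) \<ge> 0"
      by (rule mult_nonneg_nonneg[OF _ divide_nonneg_pos[OF c]]) (use constants in auto)
    ultimately show ?thesis by (simp add: right_diff_distrib)
  qed
  also have "?c / (2 * C) = a * B / (2 * C * min 1 \<kappa> * (1 + \<zeta> 0))" by (simp add: mult_ac)
  finally show ?thesis by simp
qed

text \<open>Once \<open>\<zeta> \<ge> a * B / (2 * C * \<epsilon> * min 1 \<kappa>) - 1\<close>, the disturbance can no longer push \<open>v\<close> above
  \<open>\<epsilon>\<close>, and \<open>\<zeta> + \<Gamma> / (2 * C) * max (v - \<epsilon>) 0\<close> is nonincreasing.\<close>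
lemma \<zeta>_bound_from:
  assumes st: "0 \<le> s" "s \<le> t" and large: "a * B / (2 * C * \<epsilon> * min 1 \<kappa>) \<le> 1 + \<zeta> s"
  shows "\<zeta> t \<le> \<zeta> s + \<Gamma> / (2 * C) * v s"
proof -
  let ?H = "\<lambda>\<tau>. \<zeta> \<tau> + \<Gamma> / (2 * C) * max (v \<tau> - \<epsilon>) 0"
  have "?H t \<le> ?H s"
  proof (rule abs_continuous_nonincreasing[where f = ?H])
    show "abs_continuous_on_interval s t ?H"
      using locally_abs_continuousD[OF \<zeta>_ac st(1), of t] locally_abs_continuousD[OF v_ac st(1), of t]
      by (intro abs_continuous_on_interval_add abs_continuous_on_interval_cmult abs_continuous_on_interval_max)
    show "AE \<tau> in lebesgue. s \<le> \<tau> \<and> \<tau> < t \<longrightarrow> dini_le ?H \<tau> 0"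
      using \<zeta>_deriv v_deriv_le
    proof eventually_elim
      case (elim \<tau>)
      show ?case
      proof
        assume \<tau>: "s \<le> \<tau> \<and> \<tau> < t"
        then have \<tau>0: "\<tau> \<ge> 0" using st by simp
        obtain v' where v': "(v has_real_derivative v') (at \<tau> within {0..})"
          "v' \<le> - 2 * C * v \<tau> + a * B / (\<kappa> + \<zeta> \<tau>)" using elim(2) \<tau>0 by blast
        have "a * B / (2 * C * \<epsilon> * min 1 \<kappa>) \<le> 1 + \<zeta> \<tau>"
          using large \<zeta>_mono[of s \<tau>] \<tau> st by simp
        then have "a * B \<le> (1 + \<zeta> \<tau>) * (2 * C * \<epsilon> * min 1 \<kappa>)"
          using constants min_pos by (subst (asm) pos_divide_le_eq) auto
        then have "a * B \<le> 2 * C * \<epsilon> * (min 1 \<kappa> * (1 + \<zeta> \<tau>))"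
          by (simp only: mult_ac)
        moreover have "min 1 \<kappa> * (1 + \<zeta> \<tau>) > 0"
          using min_pos \<zeta>_pos[of \<tau>] by (intro mult_pos_pos) auto
        ultimately have "a * B / (min 1 \<kappa> * (1 + \<zeta> \<tau>)) \<le> 2 * C * \<epsilon>"
          by (simp only: pos_divide_le_eq)
        then have v'': "v' \<le> - 2 * C * (v \<tau> - \<epsilon>)"
          using v'(2) load_B_le[of \<tau>] by (simp add: algebra_simps)
        have d1: "dini_le \<zeta> \<tau> (\<Gamma> * max (v \<tau> - \<epsilon>) 0)"
          using elim(1) \<tau>0 by (intro dini_le_derivative) auto
        \<comment> \<open>At the kink \<open>v \<tau> = \<epsilon>\<close> the bound for
          \<open>v'\<close> becomes \<open>v' \<le> 0\<close>, as the rule for positive parts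
          demands.\<close>
        have d2: "dini_le (\<lambda>\<tau>. max (v \<tau> - \<epsilon>) 0) \<tau> (if v \<tau> > \<epsilon> then v' else 0)"
          using v'(1) \<tau>0 v'' by (intro dini_le_max) auto
        have "dini_le ?H \<tau> (\<Gamma> * max (v \<tau> - \<epsilon>) 0 + \<Gamma> / (2 * C) * (if v \<tau> > \<epsilon> then v' else 0))"
          using d1 d2 constants by (intro dini_le_add dini_le_cmult) auto
        moreover have "\<Gamma> * max (v \<tau> - \<epsilon>) 0 + \<Gamma> / (2 * C) * (if v \<tau> > \<epsilon> then v' else 0) \<le> 0"
        proof (cases "v \<tau> > \<epsilon>")
          case True
          have "\<Gamma> / (2 * C) * v' \<le> \<Gamma> / (2 * C) * (- 2 * C * (v \<tau> - \<epsilon>))"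
            using v'' constants by (intro mult_left_mono) auto
          also have "\<dots> = - (\<Gamma> * (v \<tau> - \<epsilon>))" using constants by simp
          finally show ?thesis using True by simp
        qed simp
        ultimately show "dini_le ?H \<tau> 0" by (rule dini_le_mono)
      qed
    qed
  qed (use st in simp)
  moreover have "\<Gamma> / (2 * C) * max (v t - \<epsilon>) 0 \<ge> 0" using constants by simp
  moreover have "\<Gamma> / (2 * C) * max (v s - \<epsilon>) 0 \<le> \<Gamma> / (2 * C) * v s"
    using constants v_nonneg[of s] by (intro mult_left_mono) auto
  ultimately show ?thesis by linarith
qed

text \<open>If \<open>\<zeta>\<close> ever exceeds both its initial value and the threshold
  \<open>c1 - 1\<close>, there is a time \<open>s\<close> from which it is above the threshold:
  \<open>0\<close>, or the time of crossing. From there it gains at most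
  \<open>\<Gamma> / (2 * C) * v s\<close>, and \<open>v s \<le> v 0 + c2\<close>. The fraction in
  the statement merges \<open>c1\<close> and \<open>c2\<close>.\<close>

lemma \<zeta>_bound:
  assumes t: "t \<ge> 0"
  shows "\<zeta> t \<le> \<zeta> 0 + \<Gamma> / (4 * C) * \<bar>y 0\<bar>\<^sup>2
      + a * B * ((2 * C * (1 + \<zeta> 0) + \<epsilon> * \<Gamma>) / (4 * C\<^sup>2 * \<epsilon> * min 1 \<kappa> * (1 + \<zeta> 0)))"
proof -
  define m where "m = min 1 \<kappa>"
  have m: "m > 0" using min_pos by (simp add: m_def)
  define c1 c2 where "c1 = a * B / (2 * C * \<epsilon> * m)" and "c2 = a * B / (2 * C * m * (1 + \<zeta> 0))"
  have q: "1 + \<zeta> 0 > 0" using \<zeta>_pos[of 0] by simp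
  have c: "c1 \<ge> 0" "c2 \<ge> 0" using B_nonneg constants m q by (auto simp: c1_def c2_def)
  have "\<zeta> t \<le> \<zeta> 0 + c1 + \<Gamma> / (2 * C) * (v 0 + c2)"
  proof (cases "\<zeta> t \<le> max (\<zeta> 0) (c1 - 1)")
    case True
    moreover have "\<Gamma> / (2 * C) * (v 0 + c2) \<ge> 0" using c constants v_nonneg by simp
    ultimately show ?thesis using c \<zeta>_pos[of 0] by linarith
  next
    case False
    obtain s where s: "0 \<le> s" "s \<le> t" "\<zeta> s \<le> \<zeta> 0 + c1" "c1 \<le> 1 + \<zeta> s"
    proof (cases "c1 - 1 \<le> \<zeta> 0")
      case True then show ?thesis using that[of 0] t c by simp
    next
      case 2: False
      have "continuous_on {0..t} \<zeta>"
        using locally_abs_continuousD[OF \<zeta>_ac] by (intro abs_continuous_on_interval_continuous) auto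
      then obtain s where "0 \<le> s" "s \<le> t" "\<zeta> s = c1 - 1"
        using IVT'[of \<zeta> 0 "c1 - 1" t] False 2 t by auto
      then show ?thesis using that[of s] \<zeta>_pos[of 0] by simp
    qed
    have "\<zeta> t \<le> \<zeta> s + \<Gamma> / (2 * C) * v s"
      using s by (intro \<zeta>_bound_from) (auto simp: c1_def m_def)
    also have "\<Gamma> / (2 * C) * v s \<le> \<Gamma> / (2 * C) * (v 0 + c2)"
      using v_bound[OF s(1)] constants by (intro mult_left_mono) (auto simp: c2_def m_def)
    finally show ?thesis using s(3) by simp
  qed
  also have "\<zeta> 0 + c1 + \<Gamma> / (2 * C) * (v 0 + c2) = \<zeta> 0 + \<Gamma> / (4 * C) * \<bar>y 0\<bar>\<^sup>2
      + a * B * ((2 * C * (1 + \<zeta> 0) + \<epsilon> * \<Gamma>) / (4 * C\<^sup>2 * \<epsilon> * m * (1 + \<zeta> 0)))"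
    unfolding c1_def c2_def v_def using m q constants
    by (simp add: divide_simps) (simp add: algebra_simps power2_eq_square)
  finally show ?thesis by (simp add: m_def)
qed

lemma z_bound:
  assumes t: "t \<ge> 0"
  shows "z t \<le> ln (exp (z 0) + \<Gamma> / (4 * C) * \<bar>y 0\<bar>\<^sup>2
      + a * B * ((2 * C * (1 + exp (z 0)) + \<epsilon> * \<Gamma>) / (4 * C\<^sup>2 * \<epsilon> * min 1 \<kappa> * (1 + exp (z 0)))))"
  using \<zeta>_bound[OF t] less_le_trans[OF \<zeta>_pos[of t] \<zeta>_bound[OF t]]
  unfolding \<zeta>_def by (subst ln_ge_iff)

lemma z_convergent: "\<exists>l. (z \<longlongrightarrow> l) at_top"
proof -
  let ?S = "z ` {0..}"
  have bdd: "bdd_above ?S" using z_bound by (intro bdd_aboveI) auto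
  have "(z \<longlongrightarrow> Sup ?S) at_top"
  proof (rule order_tendstoI)
    fix l assume "l < Sup ?S"
    then obtain s where s: "s \<ge> 0" "l < z s"
      using less_cSup_iff[OF _ bdd, of l] by auto
    show "eventually (\<lambda>t. l < z t) at_top"
      using eventually_ge_at_top[of s]
    proof eventually_elim
      case (elim t) then show ?case using s z_mono[of s t] by simp
    qed
  next
    fix l assume l: "Sup ?S < l"
    show "eventually (\<lambda>t. z t < l) at_top"
      using eventually_ge_at_top[of 0]
    proof eventually_elim
      case (elim t)
      then have "z t \<le> Sup ?S" using bdd by (intro cSup_upper) auto
      then show ?case using l by simp
    qed
  qed
  then show ?thesis ..
qed

text \<open>Since \<open>v'\<close> is bounded above, a value \<open>v t \<ge> l > \<epsilon>\<close> forces \<open>\<zeta>\<close> to have increased by a fixed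
  amount shortly before \<open>t\<close>, which the convergence of \<open>\<zeta>\<close> excludes for large \<open>t\<close>.\<close>
lemma v_eventually_less:
  assumes "l > \<epsilon>" shows "eventually (\<lambda>t. v t < l) at_top"
proof -
  \<comment> \<open>The summand 1 keeps \<open>M\<close> positive even if \<open>B = 0\<close>, as
    it divides in \<open>h\<close>.\<close>
  define M where "M = a * B / \<kappa> + 1"
  have M: "M > 0" using B_nonneg constants by (simp add: M_def add_nonneg_pos)
  have v_dini: "AE t in lebesgue. t \<ge> 0 \<longrightarrow> dini_le v t M"
    using v_deriv_le
  proof eventually_elim
    case (elim t)
    show ?case
    proof
      assume t: "t \<ge> 0"
      then obtain v' where v': "(v has_real_derivative v') (at t within {0..})"
        "v' \<le> - 2 * C * v t + a * B / (\<kappa> + \<zeta> t)" using elim by blast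
      have "a * B / (\<kappa> + \<zeta> t) \<le> a * B / \<kappa>"
        using B_nonneg constants \<zeta>_pos[of t] by (intro divide_left_mono mult_pos_pos) auto
      moreover have "- 2 * C * v t \<le> 0" using constants v_nonneg[of t] by simp
      ultimately have "v' \<le> M" using v'(2) by (simp add: M_def)
      then show "dini_le v t M" using v'(1) t by (intro dini_le_mono[OF dini_le_derivative]) auto
    qed
  qed
  \<comment> \<open>Within time \<open>h\<close>, \<open>v\<close> rises by at most
    \<open>M * h = \<eta>\<close>. Hence \<open>v t \<ge> l = \<epsilon> + 2 * \<eta>\<close> forces
    \<open>v \<ge> \<epsilon> + \<eta>\<close> on the preceding interval of length \<open>h\<close>,
    so \<open>\<zeta>\<close> grows there by at least \<open>\<Gamma> * \<eta> * h\<close>. Being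
    within half of that from its limit excludes this.\<close>
  define \<eta> h where "\<eta> = (l - \<epsilon>) / 2" and "h = \<eta> / M"
  have \<eta>: "\<eta> > 0" "h > 0" "M * h = \<eta>" using assms M by (auto simp: \<eta>_def h_def)
  obtain zl where "(z \<longlongrightarrow> zl) at_top" using z_convergent by blast
  then have \<zeta>lim: "(\<zeta> \<longlongrightarrow> exp zl) at_top"
    unfolding \<zeta>_def[abs_def] by (intro tendsto_intros)
  have "eventually (\<lambda>t. dist (\<zeta> t) (exp zl) < \<Gamma> * \<eta> * h / 2) at_top"
    using \<eta> constants by (intro tendstoD[OF \<zeta>lim]) auto
  then obtain T where T: "\<And>t. t \<ge> T \<Longrightarrow> dist (\<zeta> t) (exp zl) < \<Gamma> * \<eta> * h / 2"
    by (auto simp: eventually_at_top_linorder)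
  show ?thesis
    using eventually_ge_at_top[of "max T 0 + h"]
  proof eventually_elim
    case (elim t)
    define s where "s = t - h"
    have s: "s \<ge> 0" "s \<ge> T" "s \<le> t" using elim \<eta> by (auto simp: s_def)
    show ?case
    proof (rule ccontr)
      assume "\<not> v t < l"
      have high: "v \<tau> \<ge> \<epsilon> + \<eta>" if \<tau>: "s \<le> \<tau>" "\<tau> \<le> t" for \<tau>
      proof -
        have "v t - v \<tau> \<le> M * (t - \<tau>)"
        proof (rule dini_le_imp_le[OF v_ac])
          show "AE x in lebesgue. \<tau> \<le> x \<and> x < t \<longrightarrow> dini_le v x M"
            using v_dini by eventually_elim (use \<tau> s in auto)
        qed (use \<tau> s in auto)
        also have "\<dots> \<le> M * h" using \<tau> M by (intro mult_left_mono) (auto simp: s_def)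
        finally show ?thesis using \<open>\<not> v t < l\<close> \<eta> by (simp add: \<eta>_def field_simps)
      qed
      have ac: "locally_abs_continuous (\<lambda>t. (-1) * \<zeta> t)"
        using \<zeta>_ac unfolding locally_abs_continuous_def by (intro allI impI abs_continuous_on_interval_cmult) simp
      have "(-1) * \<zeta> t - (-1) * \<zeta> s \<le> - (\<Gamma> * \<eta>) * (t - s)"
      proof (rule dini_le_imp_le[OF ac s(1,3)])
        show "AE x in lebesgue. s \<le> x \<and> x < t \<longrightarrow> dini_le (\<lambda>t. (-1) * \<zeta> t) x (- (\<Gamma> * \<eta>))"
          using \<zeta>_deriv
        proof eventually_elim
          case (elim x)
          show ?case
          proof
            assume x: "s \<le> x \<and> x < t"
            then have "((\<lambda>t. (-1) * \<zeta> t) has_real_derivative (-1) * (\<Gamma> * max (v x - \<epsilon>) 0)) (at x within {0..})"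
              using elim s by (intro DERIV_cmult) auto
            then have "dini_le (\<lambda>t. (-1) * \<zeta> t) x ((-1) * (\<Gamma> * max (v x - \<epsilon>) 0))"
              using x s by (intro dini_le_derivative) auto
            moreover have "\<Gamma> * \<eta> \<le> \<Gamma> * max (v x - \<epsilon>) 0"
              using high[of x] x constants by (intro mult_left_mono) auto
            ultimately show "dini_le (\<lambda>t. (-1) * \<zeta> t) x (- (\<Gamma> * \<eta>))"
              by (elim dini_le_mono) simp
          qed
        qed
      qed
      then have "\<Gamma> * \<eta> * h \<le> \<zeta> t - \<zeta> s" by (simp add: s_def)
      moreover have "\<zeta> t - \<zeta> s < \<Gamma> * \<eta> * h"
        using T[of t] T[of s] s unfolding dist_real_def by (auto simp: abs_if split: if_splits)
      ultimately show False by simp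
    qed
  qed
qed

end

section \<open>Asymptotic bounds\<close>

text \<open>The dissipation \<open>(n t)^2\<close> is at least \<open>p t / K2\<close>, so
  \<open>p\<close> decays at rate \<open>1 / K2\<close> towards the equilibrium
  \<open>K2 * c\<close>. Together with the lower bound \<open>K1 * (n t)^2\<close> this produces the
  quotient \<open>K2 / K1\<close> of the limit estimate for \<open>w\<close>.\<close>

lemma p_eventually_less:
  assumes "eventually (\<lambda>t. R\<^sup>2 * (t1 t)\<^sup>2 * (y t)\<^sup>2 + G * (e t)\<^sup>2 \<le> c) ess_at_top" and "K2 * c < l"
  shows "eventually (\<lambda>t. p t < l) at_top"
proof (rule dini_comparison_eventually[OF p_ac, of "1 / K2"])
  have "eventually (\<lambda>t. t \<ge> 0 \<longrightarrow>
      dini_le p t (- (n t)\<^sup>2 + R\<^sup>2 * (t1 t)\<^sup>2 * (y t)\<^sup>2 + G * (e t)\<^sup>2)) ess_at_top"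
    unfolding eventually_ess_at_top using p_dini by (auto elim: eventually_mono)
  moreover have "eventually (\<lambda>t::real. t \<ge> 0) ess_at_top"
    unfolding eventually_ess_at_top by (auto intro: exI[of _ 0])
  ultimately show "eventually (\<lambda>t. dini_le p t (c - 1 / K2 * p t)) ess_at_top"
    using assms(1)
  proof eventually_elim
    case (elim t)
    have "1 / K2 * p t \<le> (n t)\<^sup>2" using p_upper[of t] constants by (simp add: field_simps)
    then show ?case using elim by (elim impE dini_le_mono) auto
  qed
qed (use assms constants in \<open>auto simp: mult.commute\<close>)

lemma U_eventually_less:
  assumes "(load \<longlongrightarrow> 0) ess_at_top" "l > 0"
  shows "eventually (\<lambda>t. U t < l) at_top"
proof -
  \<comment> \<open>Forcing below \<open>\<mu> * l / 2\<close> puts the equilibrium at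
    \<open>l / 2\<close>, strictly below \<open>l\<close>.\<close>
  have "\<mu> * l / 2 > 0" using \<mu>_pos assms by simp
  with assms(1) have "eventually (\<lambda>t. load t < \<mu> * l / 2) ess_at_top"
    by (rule order_tendstoD)
  moreover have "eventually (\<lambda>t. t \<ge> 0 \<longrightarrow> dini_le U t (load t - \<mu> * U t)) ess_at_top"
    unfolding eventually_ess_at_top using energy_dini by (auto elim: eventually_mono)
  moreover have "eventually (\<lambda>t::real. t \<ge> 0) ess_at_top"
    unfolding eventually_ess_at_top by (auto intro: exI[of _ 0])
  ultimately have "eventually (\<lambda>t. dini_le U t (\<mu> * l / 2 - \<mu> * U t)) ess_at_top"
    by eventually_elim (auto elim: dini_le_mono)
  then show ?thesis
    by (rule dini_comparison_eventually[OF U_ac \<mu>_pos]) (use \<mu>_pos assms in simp)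
qed

end

section \<open>Essential bounds\<close>

lemma AE_lebesgue_on_nonneg:
  "(AE t in lebesgue_on {0..}. P t) \<longleftrightarrow> (AE t in lebesgue. (t :: real) \<ge> 0 \<longrightarrow> P t)"
  by (simp add: AE_restrict_space_iff)

lemma in_Linf_AE_bound:
  assumes "in_Linf f"
  shows "AE t in lebesgue. t \<ge> 0 \<longrightarrow> norm (f t) \<le> Linf_norm f"
proof -
  let ?N = "esssup (lebesgue_on {0..}) (\<lambda>t. ereal (norm (f t)))"
  have "AE t in lebesgue_on {0..}. ereal (norm (f t)) \<le> ?N"
    by (rule esssup_AE)
  then have "AE t in lebesgue_on {0..}. norm (f t) \<le> Linf_norm f"
  proof eventually_elim
    case (elim t)
    moreover have "?N < \<infinity>" using assms by (simp add: in_Linf_def)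
    ultimately show ?case unfolding Linf_norm_def by (cases ?N) auto
  qed
  then show ?thesis by (simp add: AE_lebesgue_on_nonneg)
qed

text \<open>The limit inferior yields only bounds strictly below it; the null sets for the gaps
  \<open>1 / Suc k\<close> are united to reach the value itself.\<close>

lemma ess_inf_AE_bound:
  assumes "ess_inf f > 0"
  shows "AE t in lebesgue. t \<ge> 0 \<longrightarrow> ess_inf f \<le> f t"
proof -
  let ?I = "Liminf (ae_filter (lebesgue_on {0..})) (\<lambda>t. ereal (f t))"
  \<comment> \<open>An infinite limit inferior would have been converted to the real number 0, which
    positivity excludes.\<close>
  have I: "?I = ereal (ess_inf f)"
    using assms unfolding ess_inf_def by (cases ?I) auto
  have "AE t in lebesgue_on {0..}. ess_inf f - 1 / real (Suc k) < f t" for k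
  proof -
    have "ereal (ess_inf f - 1 / real (Suc k)) < ?I" unfolding I by simp
    then have "AE t in lebesgue_on {0..}. ereal (ess_inf f - 1 / real (Suc k)) < ereal (f t)"
      by (rule less_LiminfD)
    then show ?thesis by simp
  qed
  then have "AE t in lebesgue_on {0..}. \<forall>k. ess_inf f - 1 / real (Suc k) < f t"
    by (simp add: AE_all_countable)
  then have "AE t in lebesgue_on {0..}. ess_inf f \<le> f t"
  proof eventually_elim
    case (elim t)
    have "(\<lambda>k. ess_inf f - 1 / real (Suc k)) \<longlonglongrightarrow> ess_inf f - 0"
      by (intro tendsto_intros LIMSEQ_Suc[OF lim_1_over_n])
    then show ?case using elim by (intro LIMSEQ_le_const2[of _ "ess_inf f"]) (auto intro: less_imp_le)
  qed
  then show ?thesis by (simp add: AE_lebesgue_on_nonneg)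
qed

text \<open>The bound \<open>M\<close> excludes the limit superior \<open>\<infinity>\<close>, which
  the conversion to a real number would turn into 0; the value \<open>-\<infinity>\<close> lies
  below any real bound anyway.\<close>

lemma eventually_less_ess_limsup:
  assumes "eventually (\<lambda>t. f t \<le> M) ess_at_top" "\<eta> > 0"
  shows "eventually (\<lambda>t. f t < ess_limsup f + \<eta>) ess_at_top"
proof -
  let ?L = "Limsup ess_at_top (\<lambda>t. ereal (f t))"
  have "?L \<le> ereal M" using assms(1) by (intro Limsup_bounded) auto
  then have "?L < ereal (ess_limsup f + \<eta>)"
    unfolding ess_limsup_def using assms(2) by (cases ?L) auto
  then have "eventually (\<lambda>t. ereal (f t) < ereal (ess_limsup f + \<eta>)) ess_at_top"
    by (rule Limsup_lessD)
  then show ?thesis by simp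
qed

lemma Limsup_ereal_le:
  fixes f :: "'a \<Rightarrow> real"
  assumes "\<And>x. x > c \<Longrightarrow> eventually (\<lambda>t. f t < x) F"
  shows "Limsup F (\<lambda>t. ereal (f t)) \<le> ereal c"
proof (rule ereal_le_epsilon2)
  fix e :: real assume "e > 0"
  then have "eventually (\<lambda>t. f t < c + e) F" using assms by simp
  then have "eventually (\<lambda>t. ereal (f t) \<le> ereal c + ereal e) F" by eventually_elim simp
  then show "Limsup F (\<lambda>t. ereal (f t)) \<le> ereal c + ereal e" by (rule Limsup_bounded)
qed

lemma eventually_at_top_imp_ess: "eventually P at_top \<Longrightarrow> eventually P ess_at_top"
  unfolding ess_at_top_def by (rule filter_leD[OF inf_le1])

lemma AE_imp_eventually_ess: "AE t in lebesgue. t \<ge> 0 \<longrightarrow> P t \<Longrightarrow> eventually P ess_at_top"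
  unfolding eventually_ess_at_top by blast

text \<open>Because of the positive part, \<open>x\<close> has to be controlled from above only:
  half of the tolerance goes to \<open>x\<close>, half to the convergence of
  \<open>exp z\<close>.\<close>

lemma g_tendsto_zero:
  assumes z: "(z \<longlongrightarrow> l) at_top"
    and x: "\<And>\<eta>. \<eta> > 0 \<Longrightarrow> eventually (\<lambda>t. x t < \<kappa> + exp l + \<eta>) ess_at_top"
  shows "((\<lambda>t. g \<kappa> (x t) (z t)) \<longlongrightarrow> 0) ess_at_top"
proof -
  have "((\<lambda>t. max (x t - \<kappa> - exp (z t)) 0) \<longlongrightarrow> 0) ess_at_top"
  proof (rule tendstoI)
    fix e :: real assume "e > 0"
    have "((\<lambda>t. exp (z t)) \<longlongrightarrow> exp l) at_top" by (intro tendsto_intros z)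
    then have "eventually (\<lambda>t. exp (z t) > exp l - e / 2) at_top"
      by (rule order_tendstoD) (use \<open>e > 0\<close> in simp)
    then have "eventually (\<lambda>t. exp (z t) > exp l - e / 2) ess_at_top"
      by (rule eventually_at_top_imp_ess)
    moreover have "eventually (\<lambda>t. x t < \<kappa> + exp l + e / 2) ess_at_top"
      by (rule x) (use \<open>e > 0\<close> in simp)
    ultimately show "eventually (\<lambda>t. dist (max (x t - \<kappa> - exp (z t)) 0) 0 < e) ess_at_top"
    proof eventually_elim
      case (elim t)
      then have "x t - \<kappa> - exp (z t) < e" by (simp add: field_simps)
      then show ?case using \<open>e > 0\<close> by (simp add: dist_real_def)
    qed
  qed
  then have "((\<lambda>t. (max (x t - \<kappa> - exp (z t)) 0)\<^sup>2) \<longlongrightarrow> 0\<^sup>2) ess_at_top"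
    by (rule tendsto_power)
  then show ?thesis by (simp add: g_def)
qed

theorem theorem1:
  fixes \<iota> :: "'s::banach \<Rightarrow> 'x::banach"
    and dyn :: "(real \<Rightarrow> 'x) \<Rightarrow> (real \<Rightarrow> real) \<Rightarrow> (real \<Rightarrow> 'm::banach) \<Rightarrow> (real \<Rightarrow> 'e::banach) \<Rightarrow> bool"
    and \<Phi> :: "'x \<Rightarrow> real"
    and \<Phi>dot :: "'s \<Rightarrow> real \<Rightarrow> 'm \<Rightarrow> 'e \<Rightarrow> real"
    and L :: "'s \<Rightarrow> real \<Rightarrow> real ^ 'p"
    and \<phi> P1 P2 P3 :: "real \<Rightarrow> real"
    and K1 K2 G R \<epsilon> \<Gamma> \<kappa> a C :: real
    and w :: "real \<Rightarrow> 'x" and y z d b :: "real \<Rightarrow> real"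
    and \<theta>1 :: "real \<Rightarrow> 'm" and \<theta>2 :: "real \<Rightarrow> real ^ 'p" and \<delta> :: "real \<Rightarrow> 'e"
    and \<mu> Z B :: real
  assumes inclusion: "linear \<iota>" "inj \<iota>"
    and A1: "dissipation_assumption \<iota> dyn \<Phi> \<Phi>dot K1 K2 G R"
    and \<phi>: "smooth_real \<phi>" "\<And>\<upsilon>. 0 \<le> \<phi> \<upsilon>"
    and A2: "\<And>v \<upsilon>. norm (L v \<upsilon>) \<le> norm (\<iota> v) + \<phi> \<upsilon> * \<bar>\<upsilon>\<bar>"
    and constants: "\<epsilon> > 0" "\<Gamma> > 0" "\<kappa> > 0" "a > 0" "C > 0" "2 * \<kappa> > a"
    and P_smooth: "smooth_real P1" "smooth_real P2" "smooth_real P3"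
    and P1: "\<And>\<upsilon>. P1 \<upsilon> \<ge> 1 / (4 * a * \<kappa> ^ 6) *
        (\<kappa> + 4 * a * C + 4 * \<kappa> ^ 3 + 4 * a * \<kappa> * \<phi> \<upsilon> + 8 * a * \<kappa>\<^sup>2)"
    and P2: "\<And>\<upsilon>. P2 \<upsilon> \<ge> 1 / (4 * a ^ 3 * \<kappa> ^ 5) *
        (1 / (16 * \<kappa>) * (\<kappa> + 4 * a * C + 4 * \<kappa> ^ 3 + 4 * a * \<kappa> * \<phi> \<upsilon>)\<^sup>2
         + \<kappa>\<^sup>2 + a\<^sup>2 * (\<phi> \<upsilon>)\<^sup>2 + 4 * a\<^sup>2 * (\<kappa> ^ 3 + 1))"
    and P3: "\<And>\<upsilon>. P3 \<upsilon> \<ge> 1 / (64 * a ^ 7 * \<kappa> ^ 4) *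
        ((\<kappa>\<^sup>2 + a\<^sup>2 * (\<phi> \<upsilon>)\<^sup>2)\<^sup>2 + 16 * a ^ 4)"
    and inputs: "in_Linf d" "in_Linf \<theta>1" "in_Linf \<theta>2" "in_Linf \<delta>" "in_Linf b"
    and b_pos: "AE t in lebesgue_on {0..}. b t > 0" "ess_inf b > 0"
    and w_reg: "continuous_on {0..} w" "locally_abs_continuous (\<lambda>t. \<Phi> (w t))"
        "\<And>T. T > 0 \<Longrightarrow> \<exists>v. in_L1 (lebesgue_on {0<..<T}) v \<and>
           (AE t in lebesgue_on {0<..<T}. w t = \<iota> (v t))"
    and z_reg: "C1_on_nonneg z"
    and y_reg: "continuous_on {0..} y" "locally_abs_continuous y"
    and w_dyn: "dyn w y \<theta>1 \<delta>"
    and y_ode: "AE t in lebesgue_on {0..}. \<exists>v. w t = \<iota> v \<and>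
        (y has_real_derivative
           b t * feedback \<kappa> P1 P2 P3 (y t) (z t) + L v (y t) \<bullet> \<theta>2 t + d t) (at t within {0..})"
    and z_ode: "AE t in lebesgue_on {0..}.
        (z has_real_derivative \<Gamma> * exp (- z t) * max (V (y t) - \<epsilon>) 0) (at t within {0..})"
    and \<mu>: "\<mu> = min ((2 * \<kappa> - a) / (2 * \<kappa> * K2)) (2 * C)"
    and Z: "Z = G * (Linf_norm \<delta>)\<^sup>2
        + a / (\<kappa> + exp (z 0)) *
            ((Linf_norm d)\<^sup>2 + g \<kappa> (Linf_norm \<theta>2) (z 0) + (g \<kappa> (Linf_norm \<theta>2) (z 0))\<^sup>2)
        + a / (\<kappa> + exp (z 0)) *
            (4 * ess_inf b * g \<kappa> (1 / ess_inf b) (z 0) + (g \<kappa> (R * Linf_norm \<theta>1) (z 0))\<^sup>2)"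
    and B: "B = 1 / (2 * K1) * (K2 * (norm (w 0))\<^sup>2 + 1 / 2 * \<bar>y 0\<bar>\<^sup>2 + 1 / \<mu> * Z)
        + g \<kappa> (Linf_norm \<theta>2) (z 0) + (Linf_norm d)\<^sup>2 + (g \<kappa> (Linf_norm \<theta>2) (z 0))\<^sup>2
        + 2 * ess_inf b * g \<kappa> (1 / ess_inf b) (z 0)"
  shows "(\<forall>t\<ge>0.
            2 * K1 * (norm (w t))\<^sup>2 + \<bar>y t\<bar>\<^sup>2
              \<le> exp (- \<mu> * t) * (2 * K2 * (norm (w 0))\<^sup>2 + \<bar>y 0\<bar>\<^sup>2) + 2 * (1 / \<mu>) * Z
          \<and> z 0 \<le> z t
          \<and> z t \<le> ln (exp (z 0) + \<Gamma> / (4 * C) * \<bar>y 0\<bar>\<^sup>2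
                + a * B * ((2 * C * (1 + exp (z 0)) + \<epsilon> * \<Gamma>)
                           / (4 * C\<^sup>2 * \<epsilon> * min 1 \<kappa> * (1 + exp (z 0))))))
    \<and> Limsup at_top (\<lambda>t. ereal (norm (w t)))
        \<le> ereal (sqrt (K2 / K1 * (2 * \<epsilon> * R\<^sup>2 * (ess_limsup (\<lambda>t. norm (\<theta>1 t)))\<^sup>2
                                   + G * (ess_limsup (\<lambda>t. norm (\<delta> t)))\<^sup>2)))
    \<and> Limsup at_top (\<lambda>t. ereal \<bar>y t\<bar>) \<le> ereal (sqrt (2 * \<epsilon>))
    \<and> ((d \<longlongrightarrow> 0) ess_at_top \<and> (\<delta> \<longlongrightarrow> 0) ess_at_top \<and>
         Liminf ess_at_top (\<lambda>t. ereal (b t)) \<ge> ereal (1 / \<kappa>)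
       \<longrightarrow> (((\<lambda>t. \<bar>y t\<bar>) \<longlongrightarrow> 0) at_top \<and> ((\<lambda>t. norm (w t)) \<longlongrightarrow> 0) at_top)
         \<or> (\<exists>z_lim. (z \<longlongrightarrow> z_lim) at_top \<and>
              \<kappa> + exp z_lim < ess_limsup (\<lambda>t. max (R * norm (\<theta>1 t)) (norm (\<theta>2 t)))))"
proof -
  note A1_D = A1[unfolded dissipation_assumption_def]
  have cpos: "K1 > 0" "K2 > 0" "G > 0" "R > 0" using A1_D by auto
  have \<Phi>_bounds: "K1 * (norm x)\<^sup>2 \<le> \<Phi> x" "\<Phi> x \<le> K2 * (norm x)\<^sup>2" for x
    using A1_D by auto
  have \<Phi>dot_le: "\<Phi>dot v \<upsilon> \<theta> e \<le> - (norm (\<iota> v))\<^sup>2 + R\<^sup>2 * (norm \<theta>)\<^sup>2 * \<bar>\<upsilon>\<bar>\<^sup>2 + G * (norm e)\<^sup>2" for v \<upsilon> \<theta> e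
    using A1_D by auto
  have \<Phi>dot_eq: "\<Phi>dot v (y t) (\<theta>1 t) (\<delta> t) = r" if "t \<ge> 0" "w t = \<iota> v"
    "Limsup (at_right 0) (\<lambda>h. ereal ((\<Phi> (w (t + h)) - \<Phi> (w t)) / h)) = ereal r" for t v r
    using A1_D w_dyn that by blast
  have y_ode': "AE t in lebesgue. t \<ge> 0 \<longrightarrow> (\<exists>v. w t = \<iota> v \<and>
        (y has_real_derivative
           b t * feedback \<kappa> P1 P2 P3 (y t) (z t) + L v (y t) \<bullet> \<theta>2 t + d t) (at t within {0..}))"
    using y_ode by (simp add: AE_lebesgue_on_nonneg)
  have b_ge: "AE t in lebesgue. t \<ge> 0 \<longrightarrow> ess_inf b \<le> b t"
    using b_pos(2) by (rule ess_inf_AE_bound)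
  interpret cl: closed_loop "\<lambda>t. \<Phi> (w t)" "\<lambda>t. norm (w t)" y z "\<lambda>t. norm (\<theta>1 t)" "\<lambda>t. norm (\<theta>2 t)"
    d b "\<lambda>t. norm (\<delta> t)" K1 K2 G R \<epsilon> \<Gamma> \<kappa> a C
  proof
    show "locally_abs_continuous z" using z_reg by (rule C1_on_nonneg_locally_abs_continuous)
    show "AE t in lebesgue. 0 \<le> t \<longrightarrow> dini_le (\<lambda>t. \<Phi> (w t)) t
        (- (norm (w t))\<^sup>2 + R\<^sup>2 * (norm (\<theta>1 t))\<^sup>2 * (y t)\<^sup>2 + G * (norm (\<delta> t))\<^sup>2)"
      \<comment> \<open>For almost every \<open>t\<close> the output equation supplies an element of
        \<open>S\<close> representing \<open>w t\<close>. Where the upper limit of the quotients is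
        finite it equals \<open>\<Phi>dot\<close>, and the value \<open>-\<infinity>\<close>
        satisfies every bound.\<close>
      using abs_continuous_Limsup_quotient_finite[OF w_reg(2)] y_ode'
    proof eventually_elim
      case (elim t)
      show ?case
      proof
        assume t: "t \<ge> 0"
        let ?L = "Limsup (at_right 0) (\<lambda>h. ereal ((\<Phi> (w (t + h)) - \<Phi> (w t)) / h))"
        obtain v where v: "w t = \<iota> v" using elim(2) t by blast
        have "?L \<le> ereal (- (norm (w t))\<^sup>2 + R\<^sup>2 * (norm (\<theta>1 t))\<^sup>2 * (y t)\<^sup>2 + G * (norm (\<delta> t))\<^sup>2)"
        proof (cases ?L)
          case (real r)
          then show ?thesis
            using \<Phi>dot_eq[OF t v real] \<Phi>dot_le[of v "y t" "\<theta>1 t" "\<delta> t"] v by simp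
        qed (use elim(1) t in auto)
        then show "dini_le (\<lambda>t. \<Phi> (w t)) t
            (- (norm (w t))\<^sup>2 + R\<^sup>2 * (norm (\<theta>1 t))\<^sup>2 * (y t)\<^sup>2 + G * (norm (\<delta> t))\<^sup>2)"
          by (rule Limsup_quotient_dini_le)
      qed
    qed
    show "AE t in lebesgue. 0 \<le> t \<longrightarrow>
        (z has_real_derivative \<Gamma> * exp (- z t) * max ((y t)\<^sup>2 / 2 - \<epsilon>) 0) (at t within {0..})"
      using z_ode by (simp add: AE_lebesgue_on_nonneg V_def)
    show "AE t in lebesgue. t \<ge> 0 \<longrightarrow>
        (\<exists>y'. (y has_real_derivative y') (at t within {0..}) \<and>
          y t * y' \<le> - C * (y t)\<^sup>2 + a / (2 * (\<kappa> + exp (z t))) * (norm (w t))\<^sup>2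
            + a / (\<kappa> + exp (z t)) * ((d t)\<^sup>2 + g \<kappa> (norm (\<theta>2 t)) (z t) + (g \<kappa> (norm (\<theta>2 t)) (z t))\<^sup>2
                + 2 * (b t * g \<kappa> (1 / b t) (z t))) \<and>
          y t * y' \<le> - C * (y t)\<^sup>2 - 2 * (\<kappa> + exp (z t))\<^sup>2 * (y t)\<^sup>2 - (\<kappa> + exp (z t)) / a * (y t) ^ 4
            + a / (2 * (\<kappa> + exp (z t))) * (norm (w t))\<^sup>2
            + a / (\<kappa> + exp (z t)) * ((d t)\<^sup>2 + g \<kappa> (norm (\<theta>2 t)) (z t) + (g \<kappa> (norm (\<theta>2 t)) (z t))\<^sup>2
                + 4 * (b t * g \<kappa> (1 / b t) (z t))))"
      using y_ode' b_ge
    proof eventually_elim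
      case (elim t)
      show ?case
      proof
        assume t: "t \<ge> 0"
        define y' where "y' v = b t * feedback \<kappa> P1 P2 P3 (y t) (z t) + L v (y t) \<bullet> \<theta>2 t + d t" for v
        obtain v where v: "w t = \<iota> v" "(y has_real_derivative y' v) (at t within {0..})"
          using elim(1) t unfolding y'_def by blast
        have bt: "b t > 0" using elim(2) t b_pos(2) by simp
        have sq: "(max (s - (\<kappa> + exp (z t))) 0)\<^sup>2 = g \<kappa> s (z t)"
          "(max (s - (\<kappa> + exp (z t))) 0) ^ 4 = (g \<kappa> s (z t))\<^sup>2" for s
          by (simp_all add: g_def diff_diff_eq flip: power_mult)
        have Lv: "norm (L v (y t)) \<le> norm (w t) + \<phi> (y t) * \<bar>y t\<bar>" using A2[of v "y t"] v by simp
        have rk: "\<kappa> \<le> \<kappa> + exp (z t)" by simp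
        have y'_eq: "b t * (- ((\<kappa> + exp (z t)) ^ 7
            * (P1 (y t) + P2 (y t) * (y t)\<^sup>2 + P3 (y t) * (y t) ^ 6) * y t)) + L v (y t) \<bullet> \<theta>2 t + d t = y' v"
          by (simp add: y'_def feedback_def)
        note cpb = control_power_bounds[of a C \<kappa> "\<phi> (y t)" "\<kappa> + exp (z t)" "P1 (y t)" "P2 (y t)" "P3 (y t)"
            "L v (y t)" "norm (w t)" "y t" "b t" "\<theta>2 t" "d t", OF constants(4,5,3) \<phi>(2) rk P1 P2 P3 Lv norm_ge_zero bt,
            unfolded sq y'_eq]
        show "\<exists>y'. (y has_real_derivative y') (at t within {0..}) \<and>
          y t * y' \<le> - C * (y t)\<^sup>2 + a / (2 * (\<kappa> + exp (z t))) * (norm (w t))\<^sup>2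
            + a / (\<kappa> + exp (z t)) * ((d t)\<^sup>2 + g \<kappa> (norm (\<theta>2 t)) (z t) + (g \<kappa> (norm (\<theta>2 t)) (z t))\<^sup>2
                + 2 * (b t * g \<kappa> (1 / b t) (z t))) \<and>
          y t * y' \<le> - C * (y t)\<^sup>2 - 2 * (\<kappa> + exp (z t))\<^sup>2 * (y t)\<^sup>2 - (\<kappa> + exp (z t)) / a * (y t) ^ 4
            + a / (2 * (\<kappa> + exp (z t))) * (norm (w t))\<^sup>2
            + a / (\<kappa> + exp (z t)) * ((d t)\<^sup>2 + g \<kappa> (norm (\<theta>2 t)) (z t) + (g \<kappa> (norm (\<theta>2 t)) (z t))\<^sup>2
                + 4 * (b t * g \<kappa> (1 / b t) (z t)))"
          by (intro exI[of _ "y' v"] conjI v(2) cpb)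
      qed
    qed
  qed (use cpos constants \<Phi>_bounds w_reg(2) y_reg(2) in auto)
  have bounds: "AE t in lebesgue. t \<ge> 0 \<longrightarrow> norm (\<theta>1 t) \<le> Linf_norm \<theta>1 \<and> norm (\<theta>2 t) \<le> Linf_norm \<theta>2
      \<and> \<bar>d t\<bar> \<le> Linf_norm d \<and> norm (\<delta> t) \<le> Linf_norm \<delta> \<and> ess_inf b \<le> b t"
    using in_Linf_AE_bound[OF inputs(1)] in_Linf_AE_bound[OF inputs(2)] in_Linf_AE_bound[OF inputs(3)]
      in_Linf_AE_bound[OF inputs(4)] b_ge
    by eventually_elim simp
  have \<mu>_eq: "cl.\<mu> = \<mu>" unfolding \<mu> cl.\<mu>_def ..
  have Z_eq: "cl.Z (Linf_norm \<theta>1) (Linf_norm \<theta>2) (Linf_norm d) (Linf_norm \<delta>) (ess_inf b) = Z"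
    unfolding Z cl.Z_def[OF bounds b_pos(2)] ..
  have B_eq: "cl.B (Linf_norm \<theta>1) (Linf_norm \<theta>2) (Linf_norm d) (Linf_norm \<delta>) (ess_inf b) = B"
    unfolding B cl.B_def[OF bounds b_pos(2)] Z_eq \<mu>_eq ..
  note y_small = cl.v_eventually_less[OF bounds b_pos(2)]
  have "2 * K1 * (norm (w t))\<^sup>2 + \<bar>y t\<bar>\<^sup>2
      \<le> exp (- \<mu> * t) * (2 * K2 * (norm (w 0))\<^sup>2 + \<bar>y 0\<bar>\<^sup>2) + 2 * (1 / \<mu>) * Z"
    if "t \<ge> 0" for t
    using cl.state_bound[OF bounds b_pos(2) that] unfolding \<mu>_eq Z_eq .
  moreover have "z t \<le> ln (exp (z 0) + \<Gamma> / (4 * C) * \<bar>y 0\<bar>\<^sup>2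
                + a * B * ((2 * C * (1 + exp (z 0)) + \<epsilon> * \<Gamma>)
                           / (4 * C\<^sup>2 * \<epsilon> * min 1 \<kappa> * (1 + exp (z 0)))))"
    if "t \<ge> 0" for t
    using cl.z_bound[OF bounds b_pos(2) that] unfolding B_eq .
  moreover have "z 0 \<le> z t" if "t \<ge> 0" for t
    using that by (intro cl.z_mono) auto
  moreover have "Limsup at_top (\<lambda>t. ereal \<bar>y t\<bar>) \<le> ereal (sqrt (2 * \<epsilon>))"
  proof (rule Limsup_ereal_le)
    fix x assume x: "sqrt (2 * \<epsilon>) < x"
    then have x0: "x > 0" using constants by (meson less_trans mult_pos_pos real_sqrt_gt_zero zero_less_numeral)
    have "2 * \<epsilon> < x\<^sup>2" using x x0 by (metis real_sqrt_less_iff real_sqrt_abs abs_of_pos)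
    then have "eventually (\<lambda>t. cl.v t < x\<^sup>2 / 2) at_top" by (intro y_small) simp
    then show "eventually (\<lambda>t. \<bar>y t\<bar> < x) at_top"
    proof eventually_elim
      case (elim t)
      then have "\<bar>y t\<bar>\<^sup>2 < x\<^sup>2" by (simp add: cl.v_def)
      then show ?case using x0 by (intro power_less_imp_less_base[of _ 2 x]) auto
    qed
  qed
  moreover have "Limsup at_top (\<lambda>t. ereal (norm (w t)))
        \<le> ereal (sqrt (K2 / K1 * (2 * \<epsilon> * R\<^sup>2 * (ess_limsup (\<lambda>t. norm (\<theta>1 t)))\<^sup>2
                                   + G * (ess_limsup (\<lambda>t. norm (\<delta> t)))\<^sup>2)))"
  proof (rule Limsup_ereal_le)
    let ?\<theta> = "ess_limsup (\<lambda>t. norm (\<theta>1 t))" and ?\<delta> = "ess_limsup (\<lambda>t. norm (\<delta> t))"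
    \<comment> \<open>The asymptotic bounds for \<open>\<theta>1\<close>, \<open>\<delta>\<close>
      and \<open>v\<close> are all enlarged by \<open>\<eta>\<close>. As
      \<open>K2 * Q 0 < K1 * x^2\<close> is strict, continuity leaves room for some
      \<open>\<eta> > 0\<close>.\<close>
    define Q where "Q \<eta> = R\<^sup>2 * (?\<theta> + \<eta>)\<^sup>2 * (2 * (\<epsilon> + \<eta>)) + G * (?\<delta> + \<eta>)\<^sup>2" for \<eta>
    have Q0: "Q 0 = 2 * \<epsilon> * R\<^sup>2 * ?\<theta>\<^sup>2 + G * ?\<delta>\<^sup>2" "Q 0 \<ge> 0"
      using constants cpos by (auto simp: Q_def)
    fix x assume "sqrt (K2 / K1 * (2 * \<epsilon> * R\<^sup>2 * ?\<theta>\<^sup>2 + G * ?\<delta>\<^sup>2)) < x"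
    then have x: "sqrt (K2 / K1 * Q 0) < x" by (simp only: Q0(1))
    have KQ: "K2 / K1 * Q 0 \<ge> 0" using Q0(2) cpos by simp
    then have "0 \<le> sqrt (K2 / K1 * Q 0)" by simp
    with x have x0: "x > 0" by linarith
    have "K2 / K1 * Q 0 < x\<^sup>2" using x x0 by (metis real_sqrt_less_iff real_sqrt_abs abs_of_pos)
    then have lt: "K2 * Q 0 < K1 * x\<^sup>2" using cpos by (simp add: field_simps)
    have "((\<lambda>\<eta>. K2 * Q \<eta>) \<longlongrightarrow> K2 * (R\<^sup>2 * (?\<theta> + 0)\<^sup>2 * (2 * (\<epsilon> + 0)) + G * (?\<delta> + 0)\<^sup>2)) (at_right 0)"
      unfolding Q_def by (intro tendsto_intros)
    then have "((\<lambda>\<eta>. K2 * Q \<eta>) \<longlongrightarrow> K2 * Q 0) (at_right 0)"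
      unfolding Q_def[of 0] .
    then have "eventually (\<lambda>\<eta>. K2 * Q \<eta> < K1 * x\<^sup>2) (at_right 0)"
      using lt by (rule order_tendstoD)
    then have "eventually (\<lambda>\<eta>. K2 * Q \<eta> < K1 * x\<^sup>2 \<and> \<eta> > 0) (at_right 0)"
      using eventually_at_right_less[of 0] by eventually_elim simp
    then obtain \<eta> where \<eta>: "K2 * Q \<eta> < K1 * x\<^sup>2" "\<eta> > 0"
      using eventually_happens'[of "at_right (0::real)"] by fastforce
    have "eventually (\<lambda>t. norm (\<theta>1 t) < ?\<theta> + \<eta>) ess_at_top" "eventually (\<lambda>t. norm (\<delta> t) < ?\<delta> + \<eta>) ess_at_top"
      by (rule eventually_less_ess_limsup[OF AE_imp_eventually_ess[OF in_Linf_AE_bound]], fact inputs, fact \<eta>)+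
    moreover have "eventually (\<lambda>t. cl.v t < \<epsilon> + \<eta>) ess_at_top"
      using \<eta>(2) by (intro eventually_at_top_imp_ess y_small) simp
    ultimately have "eventually (\<lambda>t. R\<^sup>2 * (norm (\<theta>1 t))\<^sup>2 * (y t)\<^sup>2 + G * (norm (\<delta> t))\<^sup>2 \<le> Q \<eta>) ess_at_top"
    proof eventually_elim
      case (elim t)
      have "(y t)\<^sup>2 \<le> 2 * (\<epsilon> + \<eta>)" using elim(3) by (simp add: cl.v_def)
      moreover have "(norm (\<theta>1 t))\<^sup>2 \<le> (?\<theta> + \<eta>)\<^sup>2" "(norm (\<delta> t))\<^sup>2 \<le> (?\<delta> + \<eta>)\<^sup>2"
        using elim(1,2) by (auto intro!: power_mono)
      ultimately show ?case
        unfolding Q_def using cpos constants by (intro add_mono mult_mono mult_left_mono) auto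
    qed
    then have "eventually (\<lambda>t. \<Phi> (w t) < K1 * x\<^sup>2) at_top"
      using \<eta>(1) by (rule cl.p_eventually_less)
    then show "eventually (\<lambda>t. norm (w t) < x) at_top"
    proof eventually_elim
      case (elim t)
      then have "K1 * (norm (w t))\<^sup>2 < K1 * x\<^sup>2" using \<Phi>_bounds(1)[of "w t"] by simp
      then have "(norm (w t))\<^sup>2 < x\<^sup>2" using cpos by simp
      then show ?case using x0 by (intro power_less_imp_less_base[of _ 2 x]) auto
    qed
  qed
  moreover have "(((\<lambda>t. \<bar>y t\<bar>) \<longlongrightarrow> 0) at_top \<and> ((\<lambda>t. norm (w t)) \<longlongrightarrow> 0) at_top)
         \<or> (\<exists>z_lim. (z \<longlongrightarrow> z_lim) at_top \<and>
              \<kappa> + exp z_lim < ess_limsup (\<lambda>t. max (R * norm (\<theta>1 t)) (norm (\<theta>2 t))))"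
    if vanish: "(d \<longlongrightarrow> 0) ess_at_top \<and> (\<delta> \<longlongrightarrow> 0) ess_at_top \<and>
         Liminf ess_at_top (\<lambda>t. ereal (b t)) \<ge> ereal (1 / \<kappa>)"
  proof -
    let ?m = "\<lambda>t. max (R * norm (\<theta>1 t)) (norm (\<theta>2 t))"
    obtain zl where zl: "(z \<longlongrightarrow> zl) at_top" using cl.z_convergent[OF bounds b_pos(2)] by blast
    \<comment> \<open>The limit \<open>zl\<close> exists in any case, so the dichotomy amounts to
      convergence whenever the strict inequality for \<open>zl\<close> fails.\<close>
    have "((\<lambda>t. \<bar>y t\<bar>) \<longlongrightarrow> 0) at_top \<and> ((\<lambda>t. norm (w t)) \<longlongrightarrow> 0) at_top"
      if le: "ess_limsup ?m \<le> \<kappa> + exp zl"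
    proof -
      have "AE t in lebesgue. t \<ge> 0 \<longrightarrow> ?m t \<le> max (R * Linf_norm \<theta>1) (Linf_norm \<theta>2)"
        using in_Linf_AE_bound[OF inputs(2)] in_Linf_AE_bound[OF inputs(3)]
      proof eventually_elim
        case (elim t)
        then show ?case using cpos(4) by (intro impI max.mono mult_left_mono) simp_all
      qed
      then have m0: "eventually (\<lambda>t. ?m t \<le> max (R * Linf_norm \<theta>1) (Linf_norm \<theta>2)) ess_at_top"
        by (rule AE_imp_eventually_ess)
      have m: "eventually (\<lambda>t. ?m t < \<kappa> + exp zl + \<eta>) ess_at_top" if "\<eta> > 0" for \<eta>
        using eventually_less_ess_limsup[OF m0 that] by eventually_elim (use le in auto)
      have g1: "((\<lambda>t. g \<kappa> (R * norm (\<theta>1 t)) (z t)) \<longlongrightarrow> 0) ess_at_top"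
        by (rule g_tendsto_zero[OF zl], drule m, erule eventually_mono) simp
      have g2: "((\<lambda>t. g \<kappa> (norm (\<theta>2 t)) (z t)) \<longlongrightarrow> 0) ess_at_top"
        by (rule g_tendsto_zero[OF zl], drule m, erule eventually_mono) simp
      \<comment> \<open>The gap between \<open>\<kappa>\<close> and
        \<open>\<kappa> + exp (z 0)\<close> turns the assumption on the limit inferior into a strict
        one. Eventually \<open>b\<close> exceeds \<open>1 / (\<kappa> + exp (z 0))\<close>, and the
        defect is exactly zero rather than merely small.\<close>
      have "ereal (1 / (\<kappa> + exp (z 0))) < Liminf ess_at_top (\<lambda>t. ereal (b t))"
      proof (rule less_le_trans)
        show "ereal (1 / (\<kappa> + exp (z 0))) < ereal (1 / \<kappa>)"
          using constants by (simp add: frac_less2)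
      qed (use vanish in blast)
      then have "eventually (\<lambda>t. ereal (1 / (\<kappa> + exp (z 0))) < ereal (b t)) ess_at_top"
        by (rule less_LiminfD)
      moreover have "eventually (\<lambda>t::real. t \<ge> 0) ess_at_top"
        by (intro eventually_at_top_imp_ess eventually_ge_at_top)
      ultimately have "eventually (\<lambda>t. b t * g \<kappa> (1 / b t) (z t) = 0) ess_at_top"
      proof eventually_elim
        case (elim t)
        have r: "\<kappa> + exp (z 0) > 0" by (rule cl.r_pos)
        then have bt: "b t > 0" using elim(1) by (auto intro: less_trans[rotated])
        have "1 / b t \<le> \<kappa> + exp (z 0)" using elim(1) r bt by (simp add: field_simps)
        also have "\<dots> \<le> \<kappa> + exp (z t)" using cl.z_mono[of 0 t] elim(2) by simp
        finally show ?case by (simp add: g_def max_def)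
      qed
      then have gb: "((\<lambda>t. b t * g \<kappa> (1 / b t) (z t)) \<longlongrightarrow> 0) ess_at_top"
        by (rule tendsto_eventually)
      have "(z \<longlongrightarrow> zl) ess_at_top"
        using zl unfolding ess_at_top_def by (rule tendsto_mono[OF inf_le1])
      moreover have "\<kappa> + exp zl \<noteq> 0" using cl.r_pos[of zl] by simp
      moreover have "((\<lambda>t. norm (\<delta> t)) \<longlongrightarrow> 0) ess_at_top" "(d \<longlongrightarrow> 0) ess_at_top"
        using vanish by (auto intro: tendsto_norm_zero)
      ultimately have "((\<lambda>t. G * (norm (\<delta> t))\<^sup>2 + a / (\<kappa> + exp (z t)) *
          ((d t)\<^sup>2 + g \<kappa> (norm (\<theta>2 t)) (z t) + (g \<kappa> (norm (\<theta>2 t)) (z t))\<^sup>2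
            + 4 * (b t * g \<kappa> (1 / b t) (z t)) + (g \<kappa> (R * norm (\<theta>1 t)) (z t))\<^sup>2))
          \<longlongrightarrow> G * 0\<^sup>2 + a / (\<kappa> + exp zl) * (0\<^sup>2 + 0 + 0\<^sup>2 + 4 * 0 + 0\<^sup>2)) ess_at_top"
        using g1 g2 gb by (intro tendsto_intros)
      then have "(cl.load \<longlongrightarrow> 0) ess_at_top" by (simp add: cl.load_def[abs_def])
      note small = cl.U_eventually_less[OF this]
      have p0: "\<Phi> (w t) \<ge> 0" for t using A1_D by auto
      have "((\<lambda>t. \<bar>y t\<bar>) \<longlongrightarrow> 0) at_top"
      proof (rule tendstoI)
        fix e :: real assume e: "e > 0"
        then have "eventually (\<lambda>t. cl.U t < e\<^sup>2 / 2) at_top" by (intro small) simp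
        then show "eventually (\<lambda>t. dist \<bar>y t\<bar> 0 < e) at_top"
        proof eventually_elim
          case (elim t)
          then have "\<bar>y t\<bar>\<^sup>2 < e\<^sup>2" using p0[of t] by (simp add: cl.U_def cl.v_def)
          then have "\<bar>y t\<bar> < e" using e by (intro power_less_imp_less_base[of _ 2 e]) auto
          then show ?case by simp
        qed
      qed
      moreover have "((\<lambda>t. norm (w t)) \<longlongrightarrow> 0) at_top"
      proof (rule tendstoI)
        fix e :: real assume e: "e > 0"
        then have "eventually (\<lambda>t. cl.U t < K1 * e\<^sup>2) at_top" using cpos by (intro small) simp
        then show "eventually (\<lambda>t. dist (norm (w t)) 0 < e) at_top"
        proof eventually_elim
          case (elim t)
          then have "K1 * (norm (w t))\<^sup>2 < K1 * e\<^sup>2"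
            using \<Phi>_bounds(1)[of "w t"] cl.v_nonneg[of t] by (simp add: cl.U_def)
          then have "(norm (w t))\<^sup>2 < e\<^sup>2" using cpos by simp
          then have "norm (w t) < e" using e by (intro power_less_imp_less_base[of _ 2 e]) auto
          then show ?case by simp
        qed
      qed
      ultimately show ?thesis ..
    qed
    then show ?thesis using zl by (meson not_le)
  qed
  ultimately show ?thesis by blast
qed

end
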